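(* Let $(M^\bullet,b,B)$ be a mixed cochain complex over a field $\mathbb{K}$ of characteristic zero, $(\mathfrak{g}^\bullet,\iota,\mathcal{L},\mathcal{S},\mathcal{T})$ a homotopy Cartan-Gerstenhaber calculus on $CC^\bullet_{\mathrm{per}}(M)$, and $\zeta\in M^{-1}$ a duality (Palladio) cocycle. Assume that $(H^\bullet(\mathcal{G}_{\mathfrak g}),\smile,\{\cdot,\cdot\})$, where $\mathcal{G}_{\mathfrak g}^\bullet=\mathfrak{g}^\bullet[-1]$, is a Gerstenhaber algebra. Then: (1) These data induce a Batalin-Vilkoviskiĭ algebra structure $(H^{\bullet-1}(M),\{\cdot,\cdot\},\smile,B)$ on the shifted cohomology of $M$. (2) The degree $-2$ Chas-Sullivan-Menichi bracket $$[\cdot,\cdot]\colon HC^{\bullet-1}_-(M)\otimes HC^{\bullet-1}_-(M)\to HC^{\bullet-1}_-(M)[-2],\qquad [x,y]:=(-1)^{x}\,j\big((\beta x)\smile(\beta y)\big),$$ on shifted negative cyclic cohomology is a Lie bracket and has the property $$\beta[\cdot,\cdot]=\{\beta(\cdot),\beta(\cdot)\}.$$ Here $j\colon H^\bullet(M)\to HC^\bullet_-(M)$ and $\beta\colon HC^\bullet_-(M)\to H^{\bullet-1}(M)$ are the canonical maps in the long exact sequence relating the cohomology of $M$ to its negative cyclic cohomology, and in $(-1)^x$ the symbol $x$ stands for the degree of $x$ in the shifted graded space $HC_-^{\bullet-1}(M)$.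
   Context: Mixed complexes. A mixed cochain complex $(M^\bullet,b,B)$ is a $\mathbb{Z}$-graded $\mathbb{K}$-vector space with $b$ of degree $+1$, $B$ of degree $-1$, $b^2=B^2=0$, $bB+Bb=0$; $H^\bullet(M)$ is the $b$-cohomology and $B$ induces $B\colon H^\bullet(M)\to H^{\bullet-1}(M)$. $V[k]^i=V^{i+k}$. With $u$ of degree $2$, $M[[u,u^{-1}]]^n=\prod_{i+2j=n}M^iu^j$, $d_u=b+uB$; $CC^\bullet_{\mathrm{per}}(M)=(M[[u,u^{-1}]],d_u)$; $CC_-^\bullet(M)$ is its quotient by $uM[[u]]$, with cohomology $HC_-^\bullet(M)$ (negative cyclic cohomology). The short exact sequence $0\to M^\bullet\to CC_-^\bullet(M)\xrightarrow{u}CC_-^\bullet(M)[2]\to0$ (first map: inclusion as constants) gives $\cdots\to H^n(M)\xrightarrow{j}HC_-^n(M)\to HC_-^{n+2}(M)\xrightarrow{\beta}H^{n+1}(M)\to\cdots$, with $\beta[f]=[Bf_0]$, $f_0$ the coefficient of $u^0$. For operators, $[P,Q]=PQ-(-1)^{|P||Q|}QP$. Calculus. Let $(\mathfrak{g}^\bullet,\delta,\{\cdot,\cdot\})$ be a dg-Lie algebra. A homotopy pre-Cartan calculus consists of linear maps $\iota\colon\mathfrak{g}^\bullet\otimes M^\bullet\to M^\bullet[1]$, $\mathcal{L}\colon\mathfrak{g}^\bullet\otimes M^\bullet\to M^\bullet$, $\mathcal{S}\colon\mathfrak{g}^\bullet\otimes M^\bullet\to M^\bullet[-1]$ with $\mathcal{L}_f=[B,\iota_f]+[b,\mathcal{S}_f]+\mathcal{S}_{\delta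 f}$, $[b,\iota_f]+\iota_{\delta f}=0$, $[B,\mathcal{S}_f]=0$. Everything is extended $\mathbb{K}[u,u^{-1}]$-linearly and $\mathcal{I}_f=\iota_f+u\mathcal{S}_f$. A homotopy Cartan calculus has in addition a linear map $\mathcal{T}\colon\mathfrak{g}^\bullet\otimes\mathfrak{g}^\bullet\otimes M^\bullet\to M^\bullet$ with $[\mathcal{I}_f,\mathcal{L}_g]-\mathcal{I}_{\{f,g\}}=[d_u,\mathcal{T}(f,g)]-\mathcal{T}(\delta f,g)-(-1)^f\mathcal{T}(f,\delta g)$. It is a homotopy Cartan-Gerstenhaber calculus if moreover $\mathcal{G}_{\mathfrak g}^\bullet=\mathfrak{g}^\bullet[-1]$ (so $\mathcal{G}^n_{\mathfrak g}=\mathfrak{g}^{n-1}$) carries a unital associative (not necessarily commutative) degree-$0$ product $\smile$ for which $\delta$ is a graded derivation, with $\iota_{f\smile g}=\iota_f\iota_g$ and $\iota_1=\mathrm{id}$. Duality (Palladio) cocycle. $\zeta\in M^{-1}$ with (i) $b\zeta=0$; (ii) $B\zeta=b\eta$ for some $\eta\in M^{-3}$; (iii) $\mathfrak{g}^\bullet\to M^\bullet$, $f\mapsto(-1)^f\iota_f\zeta$ ($f$ in the sign: degree in $\mathfrak g$), is a quasi-isomorphism, inducing $p_\zeta\colon H^\bullet(\mathfrak{g})\cong H^\bullet(M)$. On $H^\bullet(M)$ put $a\smile b=p_\zeta(p_\zeta^{-1}a\smile p_\zeta^{-1}b)$ and $\{a,b\}=p_\zeta\{p_\zeta^{-1}a,p_\zeta^{-1}b\}$.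 Gradings. $H^{\bullet-1}(M)$ means that $H^{n-1}(M)$ is placed in degree $n$; similarly for $HC_-^{\bullet-1}(M)$. A Gerstenhaber algebra is a graded vector space with a graded commutative associative product $\smile$ of degree $0$ and a bracket $\{\cdot,\cdot\}$ of degree $-1$ that is a graded Lie bracket after shifting degrees by one, with $\{f,g\smile h\}=\{f,g\}\smile h+(-1)^{(f-1)g}g\smile\{f,h\}$. It is a Batalin-Vilkoviskiĭ algebra with operator $B$ if $B$ has degree $-1$, $B^2=0$, $B$ kills the unit, and $\{a,b\}=(-1)^aB(a\smile b)-(-1)^a(Ba)\smile b-a\smile Bb$. A Lie bracket of degree $-2$ on a graded space $V$ is a bilinear map $V^m\otimes V^n\to V^{m+n-2}$ satisfying graded antisymmetry $[x,y]=-(-1)^{xy}[y,x]$ and the graded Jacobi identity $[x,[y,z]]=[[x,y],z]+(-1)^{xy}[y,[x,z]]$ with signs given by the degrees in $V$.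
   Formalization: With x the degree in the shifted space, the stated identity fails by a sign: the bracket is Lie with β[x,y] = −{βx,βy}. The identity β[x,y] = {βx,βy} is proved for the bracket with (-1)^x read as the degree in unshifted HC_-, also shown to be Lie. *)

theory Defs
  imports "HOL-Algebra.Module" "HOL-Algebra.AbelCoset"
begin

(* A graded vector space is a family of modules over a field, indexed by int. Homogeneous maps are
   families of functions indexed by the degrees of their arguments; their values outside the
   carriers are irrelevant. *)

definition graded_space :: "('k, 'r) ring_scheme \<Rightarrow> (int \<Rightarrow> ('k, 'a) module) \<Rightarrow> bool" where
  "graded_space K V \<longleftrightarrow> field K \<and> (\<forall>n. module K (V n))"

definition shift :: "(int \<Rightarrow> 'v) \<Rightarrow> int \<Rightarrow> int \<Rightarrow> 'v" where
  "shift V k = (\<lambda>i. V (i + k))"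

(* (-1)^n x *)
definition gsign :: "('k, 'a) module \<Rightarrow> int \<Rightarrow> 'a \<Rightarrow> 'a" where
  "gsign V n x = (if even n then x else \<ominus>\<^bsub>V\<^esub> x)"

definition linear_map ::
  "('k, 'r) ring_scheme \<Rightarrow> ('k, 'a) module \<Rightarrow> ('k, 'b) module \<Rightarrow> ('a \<Rightarrow> 'b) \<Rightarrow> bool" where
  "linear_map K V W f \<longleftrightarrow>
     f \<in> carrier V \<rightarrow> carrier W \<and>
     (\<forall>x\<in>carrier V. \<forall>y\<in>carrier V. f (x \<oplus>\<^bsub>V\<^esub> y) = f x \<oplus>\<^bsub>W\<^esub> f y) \<and>
     (\<forall>c\<in>carrier K. \<forall>x\<in>carrier V. f (c \<odot>\<^bsub>V\<^esub> x) = c \<odot>\<^bsub>W\<^esub> f x)"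

definition bilinear_map ::
  "('k, 'r) ring_scheme \<Rightarrow> ('k, 'a) module \<Rightarrow> ('k, 'b) module \<Rightarrow> ('k, 'c) module
    \<Rightarrow> ('a \<Rightarrow> 'b \<Rightarrow> 'c) \<Rightarrow> bool" where
  "bilinear_map K U V W f \<longleftrightarrow>
     (\<forall>x\<in>carrier U. linear_map K V W (f x)) \<and>
     (\<forall>y\<in>carrier V. linear_map K U W (\<lambda>x. f x y))"

definition trilinear_map ::
  "('k, 'r) ring_scheme \<Rightarrow> ('k, 'a) module \<Rightarrow> ('k, 'b) module \<Rightarrow> ('k, 'c) module
    \<Rightarrow> ('k, 'd) module \<Rightarrow> ('a \<Rightarrow> 'b \<Rightarrow> 'c \<Rightarrow> 'd) \<Rightarrow> bool" where
  "trilinear_map K U V W C f \<longleftrightarrow>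
     (\<forall>x\<in>carrier U. bilinear_map K V W C (f x)) \<and>
     (\<forall>y\<in>carrier V. \<forall>z\<in>carrier W. linear_map K U C (\<lambda>x. f x y z))"

definition graded_linear ::
  "('k, 'r) ring_scheme \<Rightarrow> (int \<Rightarrow> ('k, 'a) module) \<Rightarrow> (int \<Rightarrow> ('k, 'b) module) \<Rightarrow> int
    \<Rightarrow> (int \<Rightarrow> 'a \<Rightarrow> 'b) \<Rightarrow> bool" where
  "graded_linear K V W d f \<longleftrightarrow> (\<forall>n. linear_map K (V n) (W (n + d)) (f n))"

definition graded_bilinear ::
  "('k, 'r) ring_scheme \<Rightarrow> (int \<Rightarrow> ('k, 'a) module) \<Rightarrow> (int \<Rightarrow> ('k, 'b) module)
    \<Rightarrow> (int \<Rightarrow> ('k, 'c) module) \<Rightarrow> int \<Rightarrow> (int \<Rightarrow> int \<Rightarrow> 'a \<Rightarrow> 'b \<Rightarrow> 'c) \<Rightarrow> bool" where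
  "graded_bilinear K U V W d f \<longleftrightarrow>
     (\<forall>p q. bilinear_map K (U p) (V q) (W (p + q + d)) (f p q))"

definition graded_trilinear ::
  "('k, 'r) ring_scheme \<Rightarrow> (int \<Rightarrow> ('k, 'a) module) \<Rightarrow> (int \<Rightarrow> ('k, 'b) module)
    \<Rightarrow> (int \<Rightarrow> ('k, 'c) module) \<Rightarrow> (int \<Rightarrow> ('k, 'd) module) \<Rightarrow> int
    \<Rightarrow> (int \<Rightarrow> int \<Rightarrow> int \<Rightarrow> 'a \<Rightarrow> 'b \<Rightarrow> 'c \<Rightarrow> 'd) \<Rightarrow> bool" where
  "graded_trilinear K U V W C d f \<longleftrightarrow>
     (\<forall>p q n. trilinear_map K (U p) (V q) (W n) (C (p + q + n + d)) (f p q n))"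

(* [P, Q] = P Q - (-1)^(p q) Q P on V n, for operators P, Q on V of degrees p, q. *)
definition gcomm ::
  "(int \<Rightarrow> ('k, 'a) module) \<Rightarrow> int \<Rightarrow> int \<Rightarrow> (int \<Rightarrow> 'a \<Rightarrow> 'a) \<Rightarrow> (int \<Rightarrow> 'a \<Rightarrow> 'a)
    \<Rightarrow> int \<Rightarrow> 'a \<Rightarrow> 'a" where
  "gcomm V p q P Q n x =
     P (n + q) (Q n x) \<ominus>\<^bsub>V (n + p + q)\<^esub> gsign (V (n + p + q)) (p * q) (Q (n + p) (P n x))"


section \<open>Graded algebras\<close>

(* d is the degree of the bracket; the signs use the degrees in V. *)
definition graded_lie ::
  "('k, 'r) ring_scheme \<Rightarrow> (int \<Rightarrow> ('k, 'a) module) \<Rightarrow> int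
    \<Rightarrow> (int \<Rightarrow> int \<Rightarrow> 'a \<Rightarrow> 'a \<Rightarrow> 'a) \<Rightarrow> bool" where
  "graded_lie K V d br \<longleftrightarrow>
     graded_space K V \<and> graded_bilinear K V V V d br \<and>
     (\<forall>m n. \<forall>x\<in>carrier (V m). \<forall>y\<in>carrier (V n).
        br m n x y = \<ominus>\<^bsub>V (m + n + d)\<^esub> gsign (V (m + n + d)) (m * n) (br n m y x)) \<and>
     (\<forall>l m n. \<forall>x\<in>carrier (V l). \<forall>y\<in>carrier (V m). \<forall>z\<in>carrier (V n).
        br l (m + n + d) x (br m n y z) =
          br (l + m + d) n (br l m x y) z
            \<oplus>\<^bsub>V (l + m + n + 2 * d)\<^esub>
          gsign (V (l + m + n + 2 * d)) (l * m) (br m (l + n + d) y (br l n x z)))"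

definition gerstenhaber_algebra ::
  "('k, 'r) ring_scheme \<Rightarrow> (int \<Rightarrow> ('k, 'a) module)
    \<Rightarrow> (int \<Rightarrow> int \<Rightarrow> 'a \<Rightarrow> 'a \<Rightarrow> 'a) \<Rightarrow> (int \<Rightarrow> int \<Rightarrow> 'a \<Rightarrow> 'a \<Rightarrow> 'a) \<Rightarrow> bool" where
  "gerstenhaber_algebra K V cup br \<longleftrightarrow>
     graded_space K V \<and>
     graded_bilinear K V V V 0 cup \<and>
     (\<forall>l m n. \<forall>x\<in>carrier (V l). \<forall>y\<in>carrier (V m). \<forall>z\<in>carrier (V n).
        cup (l + m) n (cup l m x y) z = cup l (m + n) x (cup m n y z)) \<and>
     (\<forall>m n. \<forall>x\<in>carrier (V m). \<forall>y\<in>carrier (V n).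
        cup m n x y = gsign (V (m + n)) (m * n) (cup n m y x)) \<and>
     graded_bilinear K V V V (-1) br \<and>
     graded_lie K (shift V 1) 0 (\<lambda>m n. br (m + 1) (n + 1)) \<and>
     (\<forall>l m n. \<forall>x\<in>carrier (V l). \<forall>y\<in>carrier (V m). \<forall>z\<in>carrier (V n).
        br l (m + n) x (cup m n y z) =
          cup (l + m - 1) n (br l m x y) z
            \<oplus>\<^bsub>V (l + m + n - 1)\<^esub>
          gsign (V (l + m + n - 1)) ((l - 1) * m) (cup m (l + n - 1) y (br l n x z)))"

definition bv_algebra ::
  "('k, 'r) ring_scheme \<Rightarrow> (int \<Rightarrow> ('k, 'a) module)
    \<Rightarrow> (int \<Rightarrow> int \<Rightarrow> 'a \<Rightarrow> 'a \<Rightarrow> 'a) \<Rightarrow> (int \<Rightarrow> int \<Rightarrow> 'a \<Rightarrow> 'a \<Rightarrow> 'a)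
    \<Rightarrow> 'a \<Rightarrow> (int \<Rightarrow> 'a \<Rightarrow> 'a) \<Rightarrow> bool" where
  "bv_algebra K V br cup e B \<longleftrightarrow>
     gerstenhaber_algebra K V cup br \<and>
     e \<in> carrier (V 0) \<and>
     (\<forall>n. \<forall>x\<in>carrier (V n). cup 0 n e x = x \<and> cup n 0 x e = x) \<and>
     graded_linear K V V (-1) B \<and>
     (\<forall>n. \<forall>x\<in>carrier (V n). B (n - 1) (B n x) = \<zero>\<^bsub>V (n - 2)\<^esub>) \<and>
     B 0 e = \<zero>\<^bsub>V (-1)\<^esub> \<and>
     (\<forall>m n. \<forall>x\<in>carrier (V m). \<forall>y\<in>carrier (V n).
        br m n x y =
          gsign (V (m + n - 1)) m (B (m + n) (cup m n x y))
            \<ominus>\<^bsub>V (m + n - 1)\<^esub> gsign (V (m + n - 1)) m (cup (m - 1) n (B m x) y)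
            \<ominus>\<^bsub>V (m + n - 1)\<^esub> cup m (n - 1) x (B n y))"


section \<open>Cohomology\<close>

(* The quotient of V by a submodule W; its elements are the cosets of W. *)
definition quot_module :: "('k, 'a) module \<Rightarrow> 'a set \<Rightarrow> ('k, 'a set) module" where
  "quot_module V W =
     \<lparr>carrier = a_rcosets\<^bsub>V\<^esub> W, mult = undefined, one = undefined,
      zero = W, add = (<+>\<^bsub>V\<^esub>),
      smult = (\<lambda>c C. \<Union>x\<in>C. W +>\<^bsub>V\<^esub> (c \<odot>\<^bsub>V\<^esub> x))\<rparr>"

definition cocycles :: "(int \<Rightarrow> ('k, 'a) module) \<Rightarrow> (int \<Rightarrow> 'a \<Rightarrow> 'a) \<Rightarrow> int \<Rightarrow> 'a set" where
  "cocycles V d n = {x \<in> carrier (V n). d n x = \<zero>\<^bsub>V (n + 1)\<^esub>}"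

definition coboundaries :: "(int \<Rightarrow> ('k, 'a) module) \<Rightarrow> (int \<Rightarrow> 'a \<Rightarrow> 'a) \<Rightarrow> int \<Rightarrow> 'a set" where
  "coboundaries V d n = d (n - 1) ` carrier (V (n - 1))"

definition cohomology ::
  "(int \<Rightarrow> ('k, 'a) module) \<Rightarrow> (int \<Rightarrow> 'a \<Rightarrow> 'a) \<Rightarrow> int \<Rightarrow> ('k, 'a set) module" where
  "cohomology V d n = quot_module ((V n)\<lparr>carrier := cocycles V d n\<rparr>) (coboundaries V d n)"

definition coh_class ::
  "(int \<Rightarrow> ('k, 'a) module) \<Rightarrow> (int \<Rightarrow> 'a \<Rightarrow> 'a) \<Rightarrow> int \<Rightarrow> 'a \<Rightarrow> 'a set" where
  "coh_class V d n x = coboundaries V d n +>\<^bsub>V n\<^esub> x"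

(* Maps induced on cohomology by f, with values in degree n of the cohomology of (V, d): the union
   over all representatives is a single coset exactly when f is well defined on classes. *)
definition coh_map ::
  "(int \<Rightarrow> ('k, 'b) module) \<Rightarrow> (int \<Rightarrow> 'b \<Rightarrow> 'b) \<Rightarrow> int \<Rightarrow> ('a \<Rightarrow> 'b) \<Rightarrow> 'a set \<Rightarrow> 'b set" where
  "coh_map V d n f C = (\<Union>x\<in>C. coh_class V d n (f x))"

definition coh_map2 ::
  "(int \<Rightarrow> ('k, 'c) module) \<Rightarrow> (int \<Rightarrow> 'c \<Rightarrow> 'c) \<Rightarrow> int \<Rightarrow> ('a \<Rightarrow> 'b \<Rightarrow> 'c)
    \<Rightarrow> 'a set \<Rightarrow> 'b set \<Rightarrow> 'c set" where
  "coh_map2 V d n f C Y = (\<Union>x\<in>C. \<Union>y\<in>Y. coh_class V d n (f x y))"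

definition quasi_isomorphism ::
  "('k, 'r) ring_scheme \<Rightarrow> (int \<Rightarrow> ('k, 'a) module) \<Rightarrow> (int \<Rightarrow> 'a \<Rightarrow> 'a)
    \<Rightarrow> (int \<Rightarrow> ('k, 'b) module) \<Rightarrow> (int \<Rightarrow> 'b \<Rightarrow> 'b) \<Rightarrow> (int \<Rightarrow> 'a \<Rightarrow> 'b) \<Rightarrow> bool" where
  "quasi_isomorphism K V d W e f \<longleftrightarrow>
     graded_linear K V W 0 f \<and>
     (\<forall>n. \<forall>x\<in>carrier (V n). f (n + 1) (d n x) = e n (f n x)) \<and>
     (\<forall>n. bij_betw (coh_map W e n (f n))
            (carrier (cohomology V d n)) (carrier (cohomology W e n)))"


section \<open>Mixed complexes and cyclic cohomology\<close>

locale mixed_complex =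
  fixes K :: "('k, 'r) ring_scheme"
    and M :: "int \<Rightarrow> ('k, 'm) module"
    and b B :: "int \<Rightarrow> 'm \<Rightarrow> 'm"
  assumes M_graded_space: "graded_space K M"
    and b_linear: "graded_linear K M M 1 b"
    and B_linear: "graded_linear K M M (-1) B"
    and b_square: "\<forall>n. \<forall>x\<in>carrier (M n). b (n + 1) (b n x) = \<zero>\<^bsub>M (n + 2)\<^esub>"
    and B_square: "\<forall>n. \<forall>x\<in>carrier (M n). B (n - 1) (B n x) = \<zero>\<^bsub>M (n - 2)\<^esub>"
    and b_B_anticommute:
      "\<forall>n. \<forall>x\<in>carrier (M n). b (n - 1) (B n x) \<oplus>\<^bsub>M n\<^esub> B (n + 1) (b n x) = \<zero>\<^bsub>M n\<^esub>"

(* M[[u, 1/u]]: w :: int => 'm stands for the formal sum of the w j u^j over all j; in total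
   degree n the coefficient w j lies in M (n - 2 j). *)
definition periodic :: "(int \<Rightarrow> ('k, 'm) module) \<Rightarrow> int \<Rightarrow> ('k, int \<Rightarrow> 'm) module" where
  "periodic M n =
     \<lparr>carrier = {w. \<forall>j. w j \<in> carrier (M (n - 2 * j))}, mult = undefined, one = undefined,
      zero = (\<lambda>j. \<zero>\<^bsub>M (n - 2 * j)\<^esub>),
      add = (\<lambda>v w j. v j \<oplus>\<^bsub>M (n - 2 * j)\<^esub> w j),
      smult = (\<lambda>c w j. c \<odot>\<^bsub>M (n - 2 * j)\<^esub> w j)\<rparr>"

definition u_extend :: "(int \<Rightarrow> 'm \<Rightarrow> 'm) \<Rightarrow> int \<Rightarrow> (int \<Rightarrow> 'm) \<Rightarrow> int \<Rightarrow> 'm" where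
  "u_extend P n w = (\<lambda>j. P (n - 2 * j) (w j))"

definition u_times :: "(int \<Rightarrow> 'm) \<Rightarrow> int \<Rightarrow> 'm" where
  "u_times w = (\<lambda>j. w (j - 1))"

definition d_u ::
  "(int \<Rightarrow> ('k, 'm) module) \<Rightarrow> (int \<Rightarrow> 'm \<Rightarrow> 'm) \<Rightarrow> (int \<Rightarrow> 'm \<Rightarrow> 'm)
    \<Rightarrow> int \<Rightarrow> (int \<Rightarrow> 'm) \<Rightarrow> int \<Rightarrow> 'm" where
  "d_u M b B n w = u_extend b n w \<oplus>\<^bsub>periodic M (n + 1)\<^esub> u_times (u_extend B n w)"

(* The degree n part of u M[[u]]. *)
definition u_positive :: "(int \<Rightarrow> ('k, 'm) module) \<Rightarrow> int \<Rightarrow> (int \<Rightarrow> 'm) set" where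
  "u_positive M n = {w \<in> carrier (periodic M n). \<forall>j\<le>0. w j = \<zero>\<^bsub>M (n - 2 * j)\<^esub>}"

definition negative :: "(int \<Rightarrow> ('k, 'm) module) \<Rightarrow> int \<Rightarrow> ('k, (int \<Rightarrow> 'm) set) module" where
  "negative M n = quot_module (periodic M n) (u_positive M n)"

definition d_negative ::
  "(int \<Rightarrow> ('k, 'm) module) \<Rightarrow> (int \<Rightarrow> 'm \<Rightarrow> 'm) \<Rightarrow> (int \<Rightarrow> 'm \<Rightarrow> 'm)
    \<Rightarrow> int \<Rightarrow> (int \<Rightarrow> 'm) set \<Rightarrow> (int \<Rightarrow> 'm) set" where
  "d_negative M b B n F =
     (\<Union>w\<in>F. u_positive M (n + 1) +>\<^bsub>periodic M (n + 1)\<^esub> d_u M b B n w)"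

definition HC_minus ::
  "(int \<Rightarrow> ('k, 'm) module) \<Rightarrow> (int \<Rightarrow> 'm \<Rightarrow> 'm) \<Rightarrow> (int \<Rightarrow> 'm \<Rightarrow> 'm)
    \<Rightarrow> int \<Rightarrow> ('k, (int \<Rightarrow> 'm) set set) module" where
  "HC_minus M b B = cohomology (negative M) (d_negative M b B)"

definition const_series :: "(int \<Rightarrow> ('k, 'm) module) \<Rightarrow> int \<Rightarrow> 'm \<Rightarrow> (int \<Rightarrow> 'm) set" where
  "const_series M n x =
     u_positive M n +>\<^bsub>periodic M n\<^esub> (\<lambda>j. if j = 0 then x else \<zero>\<^bsub>M (n - 2 * j)\<^esub>)"

definition j_map ::
  "(int \<Rightarrow> ('k, 'm) module) \<Rightarrow> (int \<Rightarrow> 'm \<Rightarrow> 'm) \<Rightarrow> (int \<Rightarrow> 'm \<Rightarrow> 'm)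
    \<Rightarrow> int \<Rightarrow> 'm set \<Rightarrow> (int \<Rightarrow> 'm) set set" where
  "j_map M b B n = coh_map (negative M) (d_negative M b B) n (const_series M n)"

(* The connecting map from degree n of the negative cyclic cohomology to degree n - 1 of H(M),
   [f] |-> [B f_0]. An element of HC_minus M b B n is a set of elements of negative M n, each of
   which is a set of series w; the u^0-coefficient is w 0. *)
definition beta_map ::
  "(int \<Rightarrow> ('k, 'm) module) \<Rightarrow> (int \<Rightarrow> 'm \<Rightarrow> 'm) \<Rightarrow> (int \<Rightarrow> 'm \<Rightarrow> 'm)
    \<Rightarrow> int \<Rightarrow> (int \<Rightarrow> 'm) set set \<Rightarrow> 'm set" where
  "beta_map M b B n C = (\<Union>F\<in>C. \<Union>w\<in>F. coh_class M b (n - 1) (B n (w 0)))"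


section \<open>Calculi\<close>

locale dg_lie =
  fixes K :: "('k, 'r) ring_scheme"
    and \<gg> :: "int \<Rightarrow> ('k, 'g) module"
    and \<delta> :: "int \<Rightarrow> 'g \<Rightarrow> 'g"
    and br :: "int \<Rightarrow> int \<Rightarrow> 'g \<Rightarrow> 'g \<Rightarrow> 'g"
  assumes br_lie: "graded_lie K \<gg> 0 br"
    and \<delta>_linear: "graded_linear K \<gg> \<gg> 1 \<delta>"
    and \<delta>_square: "\<forall>n. \<forall>f\<in>carrier (\<gg> n). \<delta> (n + 1) (\<delta> n f) = \<zero>\<^bsub>\<gg> (n + 2)\<^esub>"
    and \<delta>_br:
      "\<forall>p q. \<forall>f\<in>carrier (\<gg> p). \<forall>h\<in>carrier (\<gg> q).
         \<delta> (p + q) (br p q f h) =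
           br (p + 1) q (\<delta> p f) h
             \<oplus>\<^bsub>\<gg> (p + q + 1)\<^esub> gsign (\<gg> (p + q + 1)) p (br p (q + 1) f (\<delta> q h))"

(* For f in \<gg> p and x in M n, the values at (f, x) are \<iota> p n f x in M (p + n + 1),
   \<L> p n f x in M (p + n) and \<S> p n f x in M (p + n - 1). As operators on M, \<iota>_f, \<L>_f
   and \<S>_f have degrees p + 1, p and p - 1. *)
locale homotopy_pre_cartan_calculus =
  mixed_complex K M b B + dg_lie K \<gg> \<delta> br
  for K :: "('k, 'r) ring_scheme"
    and M :: "int \<Rightarrow> ('k, 'm) module"
    and b B :: "int \<Rightarrow> 'm \<Rightarrow> 'm"
    and \<gg> :: "int \<Rightarrow> ('k, 'g) module"
    and \<delta> :: "int \<Rightarrow> 'g \<Rightarrow> 'g"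
    and br :: "int \<Rightarrow> int \<Rightarrow> 'g \<Rightarrow> 'g \<Rightarrow> 'g" +
  fixes \<iota> \<L> \<S> :: "int \<Rightarrow> int \<Rightarrow> 'g \<Rightarrow> 'm \<Rightarrow> 'm"
  assumes \<iota>_bilinear: "graded_bilinear K \<gg> M M 1 \<iota>"
    and \<L>_bilinear: "graded_bilinear K \<gg> M M 0 \<L>"
    and \<S>_bilinear: "graded_bilinear K \<gg> M M (-1) \<S>"
    and cartan_homotopy:
      "\<forall>p n. \<forall>f\<in>carrier (\<gg> p). \<forall>x\<in>carrier (M n).
         \<L> p n f x =
           gcomm M (-1) (p + 1) B (\<lambda>i. \<iota> p i f) n x
             \<oplus>\<^bsub>M (n + p)\<^esub> gcomm M 1 (p - 1) b (\<lambda>i. \<S> p i f) n x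
             \<oplus>\<^bsub>M (n + p)\<^esub> \<S> (p + 1) n (\<delta> p f) x"
    and b_\<iota>:
      "\<forall>p n. \<forall>f\<in>carrier (\<gg> p). \<forall>x\<in>carrier (M n).
         gcomm M 1 (p + 1) b (\<lambda>i. \<iota> p i f) n x
           \<oplus>\<^bsub>M (n + p + 2)\<^esub> \<iota> (p + 1) n (\<delta> p f) x = \<zero>\<^bsub>M (n + p + 2)\<^esub>"
    and B_\<S>:
      "\<forall>p n. \<forall>f\<in>carrier (\<gg> p). \<forall>x\<in>carrier (M n).
         gcomm M (-1) (p - 1) B (\<lambda>i. \<S> p i f) n x = \<zero>\<^bsub>M (n + p - 2)\<^esub>"

(* \<iota>_f + u \<S>_f, an operator of degree p + 1 on the periodic complex for f in \<gg> p. *)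
definition u_contraction ::
  "(int \<Rightarrow> ('k, 'm) module) \<Rightarrow> (int \<Rightarrow> int \<Rightarrow> 'g \<Rightarrow> 'm \<Rightarrow> 'm) \<Rightarrow> (int \<Rightarrow> int \<Rightarrow> 'g \<Rightarrow> 'm \<Rightarrow> 'm)
    \<Rightarrow> int \<Rightarrow> 'g \<Rightarrow> int \<Rightarrow> (int \<Rightarrow> 'm) \<Rightarrow> int \<Rightarrow> 'm" where
  "u_contraction M \<iota> \<S> p f n w =
     u_extend (\<lambda>i. \<iota> p i f) n w
       \<oplus>\<^bsub>periodic M (n + p + 1)\<^esub> u_times (u_extend (\<lambda>i. \<S> p i f) n w)"

locale homotopy_cartan_calculus =
  homotopy_pre_cartan_calculus K M b B \<gg> \<delta> br \<iota> \<L> \<S>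
  for K :: "('k, 'r) ring_scheme"
    and M :: "int \<Rightarrow> ('k, 'm) module"
    and b B :: "int \<Rightarrow> 'm \<Rightarrow> 'm"
    and \<gg> :: "int \<Rightarrow> ('k, 'g) module"
    and \<delta> :: "int \<Rightarrow> 'g \<Rightarrow> 'g"
    and br :: "int \<Rightarrow> int \<Rightarrow> 'g \<Rightarrow> 'g \<Rightarrow> 'g"
    and \<iota> \<L> \<S> :: "int \<Rightarrow> int \<Rightarrow> 'g \<Rightarrow> 'm \<Rightarrow> 'm" +
  fixes \<T> :: "int \<Rightarrow> int \<Rightarrow> int \<Rightarrow> 'g \<Rightarrow> 'g \<Rightarrow> 'm \<Rightarrow> 'm"
  assumes \<T>_trilinear: "graded_trilinear K \<gg> \<gg> M M 0 \<T>"
    and \<T>_homotopy: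
      "\<forall>p q n. \<forall>f\<in>carrier (\<gg> p). \<forall>h\<in>carrier (\<gg> q). \<forall>w\<in>carrier (periodic M n).
         gcomm (periodic M) (p + 1) q
             (u_contraction M \<iota> \<S> p f) (u_extend (\<lambda>i. \<L> q i h)) n w
           \<ominus>\<^bsub>periodic M (n + p + q + 1)\<^esub> u_contraction M \<iota> \<S> (p + q) (br p q f h) n w =
         gcomm (periodic M) 1 (p + q) (d_u M b B) (u_extend (\<lambda>i. \<T> p q i f h)) n w
           \<ominus>\<^bsub>periodic M (n + p + q + 1)\<^esub> u_extend (\<lambda>i. \<T> (p + 1) q i (\<delta> p f) h) n w
           \<ominus>\<^bsub>periodic M (n + p + q + 1)\<^esub>
             gsign (periodic M (n + p + q + 1)) p
               (u_extend (\<lambda>i. \<T> p (q + 1) i f (\<delta> q h)) n w)"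

(* The product is indexed by degrees in shift \<gg> (-1), whose degree n part is \<gg> (n - 1); the
   operator \<iota>_f has degree n for f of degree n there. *)
locale homotopy_cartan_gerstenhaber_calculus =
  homotopy_cartan_calculus K M b B \<gg> \<delta> br \<iota> \<L> \<S> \<T>
  for K :: "('k, 'r) ring_scheme"
    and M :: "int \<Rightarrow> ('k, 'm) module"
    and b B :: "int \<Rightarrow> 'm \<Rightarrow> 'm"
    and \<gg> :: "int \<Rightarrow> ('k, 'g) module"
    and \<delta> :: "int \<Rightarrow> 'g \<Rightarrow> 'g"
    and br :: "int \<Rightarrow> int \<Rightarrow> 'g \<Rightarrow> 'g \<Rightarrow> 'g"
    and \<iota> \<L> \<S> :: "int \<Rightarrow> int \<Rightarrow> 'g \<Rightarrow> 'm \<Rightarrow> 'm"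
    and \<T> :: "int \<Rightarrow> int \<Rightarrow> int \<Rightarrow> 'g \<Rightarrow> 'g \<Rightarrow> 'm \<Rightarrow> 'm" +
  fixes cup :: "int \<Rightarrow> int \<Rightarrow> 'g \<Rightarrow> 'g \<Rightarrow> 'g"
    and e :: 'g
  assumes cup_bilinear:
      "graded_bilinear K (shift \<gg> (-1)) (shift \<gg> (-1)) (shift \<gg> (-1)) 0 cup"
    and cup_assoc:
      "\<forall>l m n. \<forall>f\<in>carrier (\<gg> (l - 1)). \<forall>g\<in>carrier (\<gg> (m - 1)). \<forall>h\<in>carrier (\<gg> (n - 1)).
         cup (l + m) n (cup l m f g) h = cup l (m + n) f (cup m n g h)"
    and unit_closed: "e \<in> carrier (\<gg> (-1))"
    and cup_unit:
      "\<forall>n. \<forall>f\<in>carrier (\<gg> (n - 1)). cup 0 n e f = f \<and> cup n 0 f e = f"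
    and \<delta>_cup:
      "\<forall>m n. \<forall>f\<in>carrier (\<gg> (m - 1)). \<forall>g\<in>carrier (\<gg> (n - 1)).
         \<delta> (m + n - 1) (cup m n f g) =
           cup (m + 1) n (\<delta> (m - 1) f) g
             \<oplus>\<^bsub>\<gg> (m + n)\<^esub> gsign (\<gg> (m + n)) m (cup m (n + 1) f (\<delta> (n - 1) g))"
    and \<iota>_cup:
      "\<forall>m n k. \<forall>f\<in>carrier (\<gg> (m - 1)). \<forall>g\<in>carrier (\<gg> (n - 1)). \<forall>x\<in>carrier (M k).
         \<iota> (m + n - 1) k (cup m n f g) x = \<iota> (m - 1) (n + k) f (\<iota> (n - 1) k g x)"
    and \<iota>_unit: "\<forall>k. \<forall>x\<in>carrier (M k). \<iota> (-1) k e x = x"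


section \<open>Duality\<close>

definition palladio_map ::
  "(int \<Rightarrow> ('k, 'm) module) \<Rightarrow> (int \<Rightarrow> int \<Rightarrow> 'g \<Rightarrow> 'm \<Rightarrow> 'm) \<Rightarrow> 'm \<Rightarrow> int \<Rightarrow> 'g \<Rightarrow> 'm" where
  "palladio_map M \<iota> \<zeta> p f = gsign (M p) p (\<iota> p (-1) f \<zeta>)"

definition palladio_cocycle ::
  "('k, 'r) ring_scheme \<Rightarrow> (int \<Rightarrow> ('k, 'm) module) \<Rightarrow> (int \<Rightarrow> 'm \<Rightarrow> 'm) \<Rightarrow> (int \<Rightarrow> 'm \<Rightarrow> 'm)
    \<Rightarrow> (int \<Rightarrow> ('k, 'g) module) \<Rightarrow> (int \<Rightarrow> 'g \<Rightarrow> 'g)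
    \<Rightarrow> (int \<Rightarrow> int \<Rightarrow> 'g \<Rightarrow> 'm \<Rightarrow> 'm) \<Rightarrow> 'm \<Rightarrow> bool" where
  "palladio_cocycle K M b B \<gg> \<delta> \<iota> \<zeta> \<longleftrightarrow>
     \<zeta> \<in> carrier (M (-1)) \<and>
     b (-1) \<zeta> = \<zero>\<^bsub>M 0\<^esub> \<and>
     (\<exists>\<eta>\<in>carrier (M (-3)). B (-1) \<zeta> = b (-3) \<eta>) \<and>
     quasi_isomorphism K \<gg> \<delta> M b (palladio_map M \<iota> \<zeta>)"

definition p_zeta ::
  "(int \<Rightarrow> ('k, 'm) module) \<Rightarrow> (int \<Rightarrow> 'm \<Rightarrow> 'm) \<Rightarrow> (int \<Rightarrow> int \<Rightarrow> 'g \<Rightarrow> 'm \<Rightarrow> 'm) \<Rightarrow> 'm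
    \<Rightarrow> int \<Rightarrow> 'g set \<Rightarrow> 'm set" where
  "p_zeta M b \<iota> \<zeta> n = coh_map M b n (palladio_map M \<iota> \<zeta> n)"

definition p_zeta_inv ::
  "(int \<Rightarrow> ('k, 'm) module) \<Rightarrow> (int \<Rightarrow> 'm \<Rightarrow> 'm)
    \<Rightarrow> (int \<Rightarrow> ('k, 'g) module) \<Rightarrow> (int \<Rightarrow> 'g \<Rightarrow> 'g)
    \<Rightarrow> (int \<Rightarrow> int \<Rightarrow> 'g \<Rightarrow> 'm \<Rightarrow> 'm) \<Rightarrow> 'm \<Rightarrow> int \<Rightarrow> 'm set \<Rightarrow> 'g set" where
  "p_zeta_inv M b \<gg> \<delta> \<iota> \<zeta> n =
     inv_into (carrier (cohomology \<gg> \<delta> n)) (p_zeta M b \<iota> \<zeta> n)"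

(* From here on, all operations on cohomology are indexed by the degrees in the shifted spaces
   H(G), H(M)[-1] and HC_minus[-1], where G = shift \<gg> (-1). *)

definition coh_G ::
  "(int \<Rightarrow> ('k, 'g) module) \<Rightarrow> (int \<Rightarrow> 'g \<Rightarrow> 'g) \<Rightarrow> int \<Rightarrow> ('k, 'g set) module" where
  "coh_G \<gg> \<delta> = cohomology (shift \<gg> (-1)) (shift \<delta> (-1))"

definition coh_G_cup ::
  "(int \<Rightarrow> ('k, 'g) module) \<Rightarrow> (int \<Rightarrow> 'g \<Rightarrow> 'g) \<Rightarrow> (int \<Rightarrow> int \<Rightarrow> 'g \<Rightarrow> 'g \<Rightarrow> 'g)
    \<Rightarrow> int \<Rightarrow> int \<Rightarrow> 'g set \<Rightarrow> 'g set \<Rightarrow> 'g set" where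
  "coh_G_cup \<gg> \<delta> cup m n =
     coh_map2 (shift \<gg> (-1)) (shift \<delta> (-1)) (m + n) (cup m n)"

definition coh_G_br ::
  "(int \<Rightarrow> ('k, 'g) module) \<Rightarrow> (int \<Rightarrow> 'g \<Rightarrow> 'g) \<Rightarrow> (int \<Rightarrow> int \<Rightarrow> 'g \<Rightarrow> 'g \<Rightarrow> 'g)
    \<Rightarrow> int \<Rightarrow> int \<Rightarrow> 'g set \<Rightarrow> 'g set \<Rightarrow> 'g set" where
  "coh_G_br \<gg> \<delta> br m n =
     coh_map2 (shift \<gg> (-1)) (shift \<delta> (-1)) (m + n - 1) (br (m - 1) (n - 1))"

definition coh_M_cup ::
  "(int \<Rightarrow> ('k, 'm) module) \<Rightarrow> (int \<Rightarrow> 'm \<Rightarrow> 'm)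
    \<Rightarrow> (int \<Rightarrow> ('k, 'g) module) \<Rightarrow> (int \<Rightarrow> 'g \<Rightarrow> 'g)
    \<Rightarrow> (int \<Rightarrow> int \<Rightarrow> 'g \<Rightarrow> 'm \<Rightarrow> 'm) \<Rightarrow> 'm \<Rightarrow> (int \<Rightarrow> int \<Rightarrow> 'g \<Rightarrow> 'g \<Rightarrow> 'g)
    \<Rightarrow> int \<Rightarrow> int \<Rightarrow> 'm set \<Rightarrow> 'm set \<Rightarrow> 'm set" where
  "coh_M_cup M b \<gg> \<delta> \<iota> \<zeta> cup m n x y =
     p_zeta M b \<iota> \<zeta> (m + n - 1)
       (coh_G_cup \<gg> \<delta> cup m n
          (p_zeta_inv M b \<gg> \<delta> \<iota> \<zeta> (m - 1) x) (p_zeta_inv M b \<gg> \<delta> \<iota> \<zeta> (n - 1) y))"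

definition coh_M_br ::
  "(int \<Rightarrow> ('k, 'm) module) \<Rightarrow> (int \<Rightarrow> 'm \<Rightarrow> 'm)
    \<Rightarrow> (int \<Rightarrow> ('k, 'g) module) \<Rightarrow> (int \<Rightarrow> 'g \<Rightarrow> 'g)
    \<Rightarrow> (int \<Rightarrow> int \<Rightarrow> 'g \<Rightarrow> 'm \<Rightarrow> 'm) \<Rightarrow> 'm \<Rightarrow> (int \<Rightarrow> int \<Rightarrow> 'g \<Rightarrow> 'g \<Rightarrow> 'g)
    \<Rightarrow> int \<Rightarrow> int \<Rightarrow> 'm set \<Rightarrow> 'm set \<Rightarrow> 'm set" where
  "coh_M_br M b \<gg> \<delta> \<iota> \<zeta> br m n x y =
     p_zeta M b \<iota> \<zeta> (m + n - 2)
       (coh_G_br \<gg> \<delta> br m n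
          (p_zeta_inv M b \<gg> \<delta> \<iota> \<zeta> (m - 1) x) (p_zeta_inv M b \<gg> \<delta> \<iota> \<zeta> (n - 1) y))"

(* The image under p_zeta of the class of the unit of G. *)
definition coh_M_unit ::
  "(int \<Rightarrow> ('k, 'm) module) \<Rightarrow> (int \<Rightarrow> 'm \<Rightarrow> 'm)
    \<Rightarrow> (int \<Rightarrow> ('k, 'g) module) \<Rightarrow> (int \<Rightarrow> 'g \<Rightarrow> 'g)
    \<Rightarrow> (int \<Rightarrow> int \<Rightarrow> 'g \<Rightarrow> 'm \<Rightarrow> 'm) \<Rightarrow> 'm \<Rightarrow> 'g \<Rightarrow> 'm set" where
  "coh_M_unit M b \<gg> \<delta> \<iota> \<zeta> e = p_zeta M b \<iota> \<zeta> (-1) (coh_class \<gg> \<delta> (-1) e)"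

definition coh_M_B ::
  "(int \<Rightarrow> ('k, 'm) module) \<Rightarrow> (int \<Rightarrow> 'm \<Rightarrow> 'm) \<Rightarrow> (int \<Rightarrow> 'm \<Rightarrow> 'm)
    \<Rightarrow> int \<Rightarrow> 'm set \<Rightarrow> 'm set" where
  "coh_M_B M b B n = coh_map M b (n - 2) (B (n - 1))"

(* (-1)^(m - s) j (beta x cup beta y), for x of degree m and y of degree n in HC_minus[-1]. For
   s = 0 the sign is the parity of x in HC_minus[-1]; for s = 1 it is the parity of x in HC_minus,
   which is also that of beta x in H(M)[-1]. The two brackets differ by an overall sign. *)
definition csm_bracket ::
  "int \<Rightarrow> (int \<Rightarrow> ('k, 'm) module) \<Rightarrow> (int \<Rightarrow> 'm \<Rightarrow> 'm) \<Rightarrow> (int \<Rightarrow> 'm \<Rightarrow> 'm)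
    \<Rightarrow> (int \<Rightarrow> ('k, 'g) module) \<Rightarrow> (int \<Rightarrow> 'g \<Rightarrow> 'g)
    \<Rightarrow> (int \<Rightarrow> int \<Rightarrow> 'g \<Rightarrow> 'm \<Rightarrow> 'm) \<Rightarrow> 'm \<Rightarrow> (int \<Rightarrow> int \<Rightarrow> 'g \<Rightarrow> 'g \<Rightarrow> 'g)
    \<Rightarrow> int \<Rightarrow> int \<Rightarrow> (int \<Rightarrow> 'm) set set \<Rightarrow> (int \<Rightarrow> 'm) set set \<Rightarrow> (int \<Rightarrow> 'm) set set" where
  "csm_bracket s M b B \<gg> \<delta> \<iota> \<zeta> cup m n x y =
     gsign (HC_minus M b B (m + n - 3)) (m - s)
       (j_map M b B (m + n - 3)
          (coh_M_cup M b \<gg> \<delta> \<iota> \<zeta> cup (m - 1) (n - 1)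
             (beta_map M b B (m - 1) x) (beta_map M b B (n - 1) y)))"

end

theory Submission
  imports Defs
begin

text \<open>
  Let \<open>p\<close> be the isomorphism on cohomology induced by \<open>f \<mapsto> (-1)^f \<iota>\<^sub>f \<zeta>\<close>. Because
  \<open>\<iota>\<close> is multiplicative, contraction turns into the product: \<open>p f \<smile> y = (-1)^(f+1) \<iota>\<^sub>f y\<close>, with
  \<open>f\<close> in the sign the degree in \<open>\<gg>\<close>. The coefficient of \<open>u^0\<close> in the homotopy formula for \<open>\<T>\<close>
  expresses \<open>\<iota>\<close> of a bracket on cohomology as a commutator of \<open>\<iota>\<^sub>f\<close> and \<open>\<L>\<^sub>h = [B, \<iota>\<^sub>h]\<close>;
  applying it to \<open>\<zeta>\<close>, whose image under \<open>B\<close> is exact, gives the Batalin-Vilkoviskii identity.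

  For the bracket on negative cyclic cohomology, the maps of the long exact sequence satisfy
  \<open>j \<circ> \<beta> = 0\<close> and \<open>\<beta> \<circ> j = B\<close>. Hence \<open>B\<close> vanishes on the image of \<open>\<beta>\<close> and \<open>j\<close> on the image
  of \<open>B\<close>. On the image of \<open>\<beta>\<close> the Gerstenhaber bracket is therefore \<open>\<plusminus> B (x \<smile> y)\<close>, and the Jacobi
  identity is \<open>j\<close> applied to the Poisson identity.
\<close>

section \<open>Linear maps and signs\<close>

text \<open>The sign of the bracket needs care. The Batalin-Vilkoviskii formula for
  \<open>{\<beta> x, \<beta> y}\<close> carries the degree of \<open>\<beta> x\<close> in
  \<open>H(M)[-1]\<close>, which is one less than the degree of \<open>x\<close> in
  \<open>HC_minus[-1]\<close>. Reading the sign of \<open>x\<close> in the latter space therefore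
  produces \<open>\<beta> [x, y] = - {\<beta> x, \<beta> y}\<close>, and shifting the exponent by
  one removes the minus. Both versions are treated at once through a parameter \<open>s\<close>; the
  Lie axioms survive a change of overall sign, since antisymmetry is linear and the Jacobi identity
  quadratic in the bracket. Two technical points shape the statements. Spaces are indexed by integer
  terms, so \<open>M (n - 1 + 1)\<close> and \<open>M n\<close> agree only after arithmetic; hence
  many lemmas take the target degree as a variable \<open>k\<close> with an equation, and the final
  signs are left to abstract parity lemmas (\<open>bv_signs\<close>, \<open>jacobi_signs\<close>).
  Induced maps are unions over all representatives, so each operation first needs a lemma that
  computes it on the class of a cocycle; afterwards only those lemmas are used.\<close>

lemma linear_map_closed: "linear_map K V W f \<Longrightarrow> x \<in> carrier V \<Longrightarrow> f x \<in> carrier W"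
  and linear_map_add: "linear_map K V W f \<Longrightarrow> x \<in> carrier V \<Longrightarrow> y \<in> carrier V \<Longrightarrow>
    f (x \<oplus>\<^bsub>V\<^esub> y) = f x \<oplus>\<^bsub>W\<^esub> f y"
  and linear_map_smult: "linear_map K V W f \<Longrightarrow> c \<in> carrier K \<Longrightarrow> x \<in> carrier V \<Longrightarrow>
    f (c \<odot>\<^bsub>V\<^esub> x) = c \<odot>\<^bsub>W\<^esub> f x"
  by (auto simp: linear_map_def)

lemma linear_mapI:
  assumes "\<And>x. x \<in> carrier V \<Longrightarrow> f x \<in> carrier W"
    and "\<And>x y. x \<in> carrier V \<Longrightarrow> y \<in> carrier V \<Longrightarrow> f (x \<oplus>\<^bsub>V\<^esub> y) = f x \<oplus>\<^bsub>W\<^esub> f y"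
    and "\<And>c x. c \<in> carrier K \<Longrightarrow> x \<in> carrier V \<Longrightarrow> f (c \<odot>\<^bsub>V\<^esub> x) = c \<odot>\<^bsub>W\<^esub> f x"
  shows "linear_map K V W f"
  using assms by (auto simp: linear_map_def)

lemma linear_map_comp:
  "linear_map K U V f \<Longrightarrow> linear_map K V W g \<Longrightarrow> linear_map K U W (\<lambda>x. g (f x))"
  by (auto simp: linear_map_def Pi_def)

lemma bilinear_map_right:
  "bilinear_map K U V W f \<Longrightarrow> x \<in> carrier U \<Longrightarrow> linear_map K V W (f x)"
  and bilinear_map_left:
  "bilinear_map K U V W f \<Longrightarrow> y \<in> carrier V \<Longrightarrow> linear_map K U W (\<lambda>x. f x y)"
  by (auto simp: bilinear_map_def)

lemma graded_bilinearD:
  "graded_bilinear K U V W d f \<Longrightarrow> k = p + q + d \<Longrightarrow> bilinear_map K (U p) (V q) (W k) (f p q)"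
  by (simp add: graded_bilinear_def)

context
  fixes K :: "('k, 'r) ring_scheme" and V :: "('k, 'a) module" and W :: "('k, 'b) module" and f
  assumes f: "linear_map K V W f" and V: "module K V" and W: "module K W"
begin

interpretation V: module K V by (rule V)
interpretation W: module K W by (rule W)

lemma linear_map_zero: "f \<zero>\<^bsub>V\<^esub> = \<zero>\<^bsub>W\<^esub>"
proof -
  have "f (\<zero>\<^bsub>V\<^esub> \<oplus>\<^bsub>V\<^esub> \<zero>\<^bsub>V\<^esub>) = f \<zero>\<^bsub>V\<^esub> \<oplus>\<^bsub>W\<^esub> f \<zero>\<^bsub>V\<^esub>"
    by (rule linear_map_add[OF f]) auto
  then show ?thesis using linear_map_closed[OF f, of "\<zero>\<^bsub>V\<^esub>"]
    by simp
qed

lemma linear_map_uminus: "x \<in> carrier V \<Longrightarrow> f (\<ominus>\<^bsub>V\<^esub> x) = \<ominus>\<^bsub>W\<^esub> f x"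
proof -
  assume x: "x \<in> carrier V"
  have "f (\<ominus>\<^bsub>V\<^esub> x) \<oplus>\<^bsub>W\<^esub> f x = \<zero>\<^bsub>W\<^esub>"
    using linear_map_add[OF f, of "\<ominus>\<^bsub>V\<^esub> x" x] x by (simp add: V.l_neg linear_map_zero)
  then show ?thesis
    using x linear_map_closed[OF f] by (metis V.a_inv_closed W.minus_equality)
qed

lemma linear_map_minus:
  "x \<in> carrier V \<Longrightarrow> y \<in> carrier V \<Longrightarrow> f (x \<ominus>\<^bsub>V\<^esub> y) = f x \<ominus>\<^bsub>W\<^esub> f y"
  by (simp add: a_minus_def linear_map_uminus linear_map_add[OF f])

lemma linear_map_gsign: "x \<in> carrier V \<Longrightarrow> f (gsign V n x) = gsign W n (f x)"
  by (simp add: gsign_def linear_map_uminus)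

end

text \<open>It adds no assumption to \<open>module\<close>. It hosts the sign lemmas and can be
  instantiated for a whole family \<open>V n\<close> at once by a sublocale.\<close>

locale vector_module = module K V for K :: "('k, 'r) ring_scheme" and V :: "('k, 'a) module"

lemma (in vector_module) gsign_closed [simp, intro]: "x \<in> carrier V \<Longrightarrow> gsign V n x \<in> carrier V"
  by (simp add: gsign_def)

lemma (in vector_module) minus_zeroD:
  assumes "x \<ominus>\<^bsub>V\<^esub> y = \<zero>\<^bsub>V\<^esub>" "x \<in> carrier V" "y \<in> carrier V"
  shows "x = y"
  using M.minus_equality[of x "\<ominus>\<^bsub>V\<^esub> y"] assms by (simp add: a_minus_def)

lemma (in vector_module) gsign_zeroD:
  "gsign V n x = \<zero>\<^bsub>V\<^esub> \<Longrightarrow> x \<in> carrier V \<Longrightarrow> x = \<zero>\<^bsub>V\<^esub>"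
  using M.minus_minus[of x] by (auto simp: gsign_def split: if_splits)

lemma (in vector_module) gsign_gsign [simp]:
  "x \<in> carrier V \<Longrightarrow> gsign V m (gsign V n x) = gsign V (m + n) x"
  by (simp add: gsign_def)

lemma (in vector_module) gsign_linear: "linear_map K V V (gsign V n)"
  by (rule linear_mapI) (auto simp: gsign_def smult_r_minus M.minus_add M.a_comm)

lemma gsign_even [simp]: "even n \<Longrightarrow> gsign V n x = x"
  and gsign_odd [simp]: "odd n \<Longrightarrow> gsign V n x = \<ominus>\<^bsub>V\<^esub> x"
  by (simp_all add: gsign_def)

section \<open>Quotient modules\<close>

locale quotient_module = vector_module K V for K :: "('k, 'r) ring_scheme" and V :: "('k, 'a) module" +
  fixes W :: "'a set"
  assumes W_submodule: "submodule W K V"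
begin

sublocale W: abelian_subgroup W V
  by (intro abelian_subgroupI3 additive_subgroup.intro submodule.axioms(1)[OF W_submodule]
      M.abelian_group_axioms)

lemma W_smult: "c \<in> carrier K \<Longrightarrow> w \<in> W \<Longrightarrow> c \<odot>\<^bsub>V\<^esub> w \<in> W"
  by (rule submodule.smult_closed[OF W_submodule])

lemma mem_coset_iff: "y \<in> W +>\<^bsub>V\<^esub> x \<longleftrightarrow> (\<exists>w\<in>W. y = w \<oplus>\<^bsub>V\<^esub> x)"
  by (auto simp: a_r_coset_def')

lemma coset_eqI:
  assumes "x \<in> carrier V" "w \<in> W" "y = w \<oplus>\<^bsub>V\<^esub> x"
  shows "W +>\<^bsub>V\<^esub> y = W +>\<^bsub>V\<^esub> x"
  by (rule W.a_repr_independence'[symmetric]) (use assms in \<open>simp_all only: mem_coset_iff, blast\<close>)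

lemma coset_add:
  "x \<in> carrier V \<Longrightarrow> y \<in> carrier V \<Longrightarrow>
    (W +>\<^bsub>V\<^esub> x) \<oplus>\<^bsub>quot_module V W\<^esub> (W +>\<^bsub>V\<^esub> y) = W +>\<^bsub>V\<^esub> (x \<oplus>\<^bsub>V\<^esub> y)"
  by (simp add: quot_module_def W.a_rcos_sum)

text \<open>Scalar multiplication in \<open>quot_module\<close> is a union over representatives. It
  collapses to one coset because two representatives differ by an element of \<open>W\<close>, and
  \<open>W\<close> is stable under scalars.\<close>

lemma coset_smult:
  assumes c: "c \<in> carrier K" and x: "x \<in> carrier V"
  shows "c \<odot>\<^bsub>quot_module V W\<^esub> (W +>\<^bsub>V\<^esub> x) = W +>\<^bsub>V\<^esub> (c \<odot>\<^bsub>V\<^esub> x)"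
proof -
  have "W +>\<^bsub>V\<^esub> (c \<odot>\<^bsub>V\<^esub> y) = W +>\<^bsub>V\<^esub> (c \<odot>\<^bsub>V\<^esub> x)" if y: "y \<in> W +>\<^bsub>V\<^esub> x" for y
  proof -
    obtain w where w: "w \<in> W" "y = w \<oplus>\<^bsub>V\<^esub> x" using y mem_coset_iff by auto
    show ?thesis
      by (rule coset_eqI[of _ "c \<odot>\<^bsub>V\<^esub> w"]) (use c x w in \<open>auto simp: smult_r_distr W_smult\<close>)
  qed
  moreover have "x \<in> W +>\<^bsub>V\<^esub> x"
    using x by (rule W.a_rcos_self)
  ultimately have "(\<Union>y\<in>W +>\<^bsub>V\<^esub> x. W +>\<^bsub>V\<^esub> (c \<odot>\<^bsub>V\<^esub> y)) = W +>\<^bsub>V\<^esub> (c \<odot>\<^bsub>V\<^esub> x)"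
    by blast
  then show ?thesis by (simp add: quot_module_def)
qed

lemma carrier_quot: "carrier (quot_module V W) = (\<lambda>x. W +>\<^bsub>V\<^esub> x) ` carrier V"
  by (auto simp: quot_module_def A_RCOSETS_def')

lemma zero_quot: "\<zero>\<^bsub>quot_module V W\<^esub> = W +>\<^bsub>V\<^esub> \<zero>\<^bsub>V\<^esub>"
  using W.a_rcos_const[of "\<zero>\<^bsub>V\<^esub>"] by (simp add: quot_module_def)

lemma quot_is_module: "module K (quot_module V W)"
proof (rule moduleI)
  show "abelian_group (quot_module V W)"
  proof (rule abelian_groupI; (elim imageE | simp only: carrier_quot)?)
    show "\<zero>\<^bsub>quot_module V W\<^esub> \<in> (\<lambda>x. W +>\<^bsub>V\<^esub> x) ` carrier V" by (simp add: zero_quot)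
    fix X assume "X \<in> (\<lambda>x. W +>\<^bsub>V\<^esub> x) ` carrier V"
    then obtain x where x: "x \<in> carrier V" "X = W +>\<^bsub>V\<^esub> x" by auto
    then have "(W +>\<^bsub>V\<^esub> (\<ominus>\<^bsub>V\<^esub> x)) \<oplus>\<^bsub>quot_module V W\<^esub> X = \<zero>\<^bsub>quot_module V W\<^esub>"
      by (simp add: coset_add zero_quot M.l_neg)
    then show "\<exists>Y\<in>(\<lambda>x. W +>\<^bsub>V\<^esub> x) ` carrier V. Y \<oplus>\<^bsub>quot_module V W\<^esub> X = \<zero>\<^bsub>quot_module V W\<^esub>"
      using x by blast
  qed (auto simp: coset_add zero_quot M.a_ac)
qed (use R.is_cring in \<open>auto simp: carrier_quot coset_add coset_smult smult_l_distr smult_r_distr smult_assoc1\<close>)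

lemma coset_linear: "linear_map K V (quot_module V W) (\<lambda>x. W +>\<^bsub>V\<^esub> x)"
  by (rule linear_mapI) (auto simp: coset_add coset_smult carrier_quot)

end

section \<open>Cohomology\<close>

lemma graded_linearD: "graded_linear K V W d f \<Longrightarrow> k = n + d \<Longrightarrow> linear_map K (V n) (W k) (f n)"
  by (simp add: graded_linear_def)

text \<open>Used for three complexes: \<open>M\<close> with \<open>b\<close>, the negative cyclic
  complex, and \<open>\<gg>\<close> with \<open>\<delta>\<close>.\<close>

locale cochain_complex =
  fixes K :: "('k, 'r) ring_scheme" and V :: "int \<Rightarrow> ('k, 'a) module" and d
  assumes V_graded_space: "graded_space K V"
    and d_linear: "graded_linear K V V 1 d"
    and d_square: "\<And>n x. x \<in> carrier (V n) \<Longrightarrow> d (n + 1) (d n x) = \<zero>\<^bsub>V (n + 2)\<^esub>"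
begin

sublocale V: vector_module K "V n" for n
  using V_graded_space by (simp add: graded_space_def vector_module_def)

text \<open>The target degree is a variable with an equation, so that the rule applies to any
  spelling of the degree; the same pattern recurs for all operators below.\<close>

lemma d_lin: "k = n + 1 \<Longrightarrow> linear_map K (V n) (V k) (d n)"
  using d_linear by (rule graded_linearD)

lemmas d_closed = linear_map_closed[OF d_lin]
  and d_add = linear_map_add[OF d_lin]
  and d_zero = linear_map_zero[OF d_lin V.module_axioms V.module_axioms]

lemma d_d: "x \<in> carrier (V n) \<Longrightarrow> k = n + 1 \<Longrightarrow> l = n + 2 \<Longrightarrow> d k (d n x) = \<zero>\<^bsub>V l\<^esub>"
  by (simp add: d_square)

abbreviation "Z \<equiv> cocycles V d"
abbreviation "H \<equiv> cohomology V d"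
abbreviation "cls \<equiv> coh_class V d"

lemma Z_iff: "k = n + 1 \<Longrightarrow> x \<in> Z n \<longleftrightarrow> x \<in> carrier (V n) \<and> d n x = \<zero>\<^bsub>V k\<^esub>"
  by (simp add: cocycles_def)

lemma Z_submodule: "submodule (Z n) K (V n)"
proof (rule V.submoduleI)
  note lin = d_lin[OF refl, of n]
  show "Z n \<subseteq> carrier (V n)" by (auto simp: cocycles_def)
  show "\<zero>\<^bsub>V n\<^esub> \<in> Z n"
    by (simp add: cocycles_def linear_map_zero[OF lin V.module_axioms V.module_axioms])
  fix x assume x: "x \<in> Z n"
  then show "\<ominus>\<^bsub>V n\<^esub> x \<in> Z n"
    by (simp add: cocycles_def linear_map_uminus[OF lin V.module_axioms V.module_axioms])
  show "c \<odot>\<^bsub>V n\<^esub> x \<in> Z n" if "c \<in> carrier K" for c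
    using x that by (simp add: cocycles_def linear_map_smult[OF lin])
  show "x \<oplus>\<^bsub>V n\<^esub> y \<in> Z n" if "y \<in> Z n" for y
    using x that by (simp add: cocycles_def linear_map_add[OF lin])
qed

lemma coboundary_in_Z: "x \<in> carrier (V n) \<Longrightarrow> k = n + 1 \<Longrightarrow> d n x \<in> Z k"
  using d_d[of x n k "k + 1"] by (simp add: cocycles_def d_closed)

lemma Z_carrier [simp, intro]: "x \<in> Z n \<Longrightarrow> x \<in> carrier (V n)"
  by (simp add: cocycles_def)

sublocale Z: vector_module K "(V n)\<lparr>carrier := Z n\<rparr>" for n
  unfolding vector_module_def by (rule submodule.submodule_is_module[OF Z_submodule V.module_axioms])

lemma Z_closed [simp, intro]:
  "\<zero>\<^bsub>V n\<^esub> \<in> Z n"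
  "x \<in> Z n \<Longrightarrow> y \<in> Z n \<Longrightarrow> x \<oplus>\<^bsub>V n\<^esub> y \<in> Z n"
  "c \<in> carrier K \<Longrightarrow> x \<in> Z n \<Longrightarrow> c \<odot>\<^bsub>V n\<^esub> x \<in> Z n"
  "x \<in> Z n \<Longrightarrow> \<ominus>\<^bsub>V n\<^esub> x \<in> Z n"
  "x \<in> Z n \<Longrightarrow> gsign (V n) m x \<in> Z n"
  using V.submoduleE(3,4,5)[OF Z_submodule[of n]] Z.M.zero_closed[of n]
  by (simp_all add: gsign_def)

lemma Z_minus [simp, intro]: "x \<in> Z n \<Longrightarrow> y \<in> Z n \<Longrightarrow> x \<ominus>\<^bsub>V n\<^esub> y \<in> Z n"
  by (simp add: a_minus_def)

lemma coboundaries_submodule: "submodule (coboundaries V d n) K ((V n)\<lparr>carrier := Z n\<rparr>)"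
proof (rule Z.module_incl_imp_submodule)
  have lin: "linear_map K (V (n - 1)) (V n) (d (n - 1))" by (simp add: d_lin)
  have "submodule (coboundaries V d n) K (V n)"
  proof (rule V.submoduleI)
    show "\<zero>\<^bsub>V n\<^esub> \<in> coboundaries V d n"
      using linear_map_zero[OF lin V.module_axioms V.module_axioms]
      by (metis V.M.zero_closed coboundaries_def image_eqI)
  next
    fix a assume "a \<in> coboundaries V d n"
    then show "\<ominus>\<^bsub>V n\<^esub> a \<in> coboundaries V d n"
      by (auto simp: coboundaries_def linear_map_uminus[OF lin V.module_axioms V.module_axioms, symmetric])
  next
    fix a b assume "a \<in> coboundaries V d n" "b \<in> coboundaries V d n"
    then show "a \<oplus>\<^bsub>V n\<^esub> b \<in> coboundaries V d n"
      by (auto simp: coboundaries_def linear_map_add[OF lin, symmetric])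
  next
    fix a x assume "a \<in> carrier K" "x \<in> coboundaries V d n"
    then show "a \<odot>\<^bsub>V n\<^esub> x \<in> coboundaries V d n"
      by (auto simp: coboundaries_def linear_map_smult[OF lin, symmetric])
  qed (auto simp: coboundaries_def intro: linear_map_closed[OF lin])
  then show "module K ((V n)\<lparr>carrier := Z n, carrier := coboundaries V d n\<rparr>)"
    using submodule.submodule_is_module[OF _ V.module_axioms] by simp
qed (auto simp: coboundaries_def coboundary_in_Z)

sublocale Q: quotient_module K "(V n)\<lparr>carrier := Z n\<rparr>" "coboundaries V d n" for n
  by (intro quotient_module.intro quotient_module_axioms.intro coboundaries_submodule
      Z.vector_module_axioms)

text \<open>Cosets only use addition, which restricting the carrier leaves unchanged. This
  reconciles \<open>coh_class\<close>, formed in \<open>V n\<close>, with \<open>cohomology\<close>,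
  formed in the module of cocycles.\<close>

lemma coset_Z: "C +>\<^bsub>(V n)\<lparr>carrier := Z n\<rparr>\<^esub> x = C +>\<^bsub>V n\<^esub> x"
  by (simp add: a_r_coset_def')

sublocale H: vector_module K "H n" for n
  using Q.quot_is_module by (simp add: cohomology_def vector_module_def)

lemma cls_linear: "linear_map K ((V n)\<lparr>carrier := Z n\<rparr>) (H n) (cls n)"
  using Q.coset_linear[of n] by (simp add: cohomology_def coh_class_def[abs_def] coset_Z)

lemma carrier_H: "carrier (H n) = cls n ` Z n"
  using Q.carrier_quot[of n] by (simp add: cohomology_def coh_class_def coset_Z)

lemma cls_closed [simp, intro]: "x \<in> Z n \<Longrightarrow> cls n x \<in> carrier (H n)"
  by (simp add: carrier_H)

lemma cls_cases: "X \<in> carrier (H n) \<Longrightarrow> (\<And>x. x \<in> Z n \<Longrightarrow> X = cls n x \<Longrightarrow> P) \<Longrightarrow> P"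
  by (auto simp: carrier_H)

lemma cls_add: "x \<in> Z n \<Longrightarrow> y \<in> Z n \<Longrightarrow> cls n (x \<oplus>\<^bsub>V n\<^esub> y) = cls n x \<oplus>\<^bsub>H n\<^esub> cls n y"
  and cls_smult: "c \<in> carrier K \<Longrightarrow> x \<in> Z n \<Longrightarrow> cls n (c \<odot>\<^bsub>V n\<^esub> x) = c \<odot>\<^bsub>H n\<^esub> cls n x"
  and cls_zero: "cls n \<zero>\<^bsub>V n\<^esub> = \<zero>\<^bsub>H n\<^esub>"
  using linear_map_add[OF cls_linear[of n]] linear_map_smult[OF cls_linear[of n]]
    linear_map_zero[OF cls_linear[of n] Z.module_axioms H.module_axioms] by auto

lemma cls_uminus: "x \<in> Z n \<Longrightarrow> cls n (\<ominus>\<^bsub>V n\<^esub> x) = \<ominus>\<^bsub>H n\<^esub> cls n x"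
proof -
  assume x: "x \<in> Z n"
  then have "cls n (\<ominus>\<^bsub>V n\<^esub> x) \<oplus>\<^bsub>H n\<^esub> cls n x = \<zero>\<^bsub>H n\<^esub>"
    by (simp add: cls_add[symmetric] V.M.l_neg cls_zero)
  with x show ?thesis by (simp add: H.M.minus_equality)
qed

lemma cls_minus: "x \<in> Z n \<Longrightarrow> y \<in> Z n \<Longrightarrow> cls n (x \<ominus>\<^bsub>V n\<^esub> y) = cls n x \<ominus>\<^bsub>H n\<^esub> cls n y"
  by (simp add: a_minus_def cls_add cls_uminus)

lemma cls_gsign: "x \<in> Z n \<Longrightarrow> cls n (gsign (V n) m x) = gsign (H n) m (cls n x)"
  by (simp add: gsign_def cls_uminus)

lemma mem_cls: "y \<in> cls n x \<longleftrightarrow> (\<exists>z\<in>carrier (V (n - 1)). y = d (n - 1) z \<oplus>\<^bsub>V n\<^esub> x)"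
  using Q.mem_coset_iff[of y n x] by (simp add: coh_class_def coset_Z coboundaries_def)

lemma cls_self: "x \<in> Z n \<Longrightarrow> x \<in> cls n x"
  using Q.W.a_rcos_self[of x n] by (simp add: coh_class_def coset_Z)

lemma cls_coboundary: 
  assumes "z \<in> carrier (V k)" "k = n - 1" shows "cls n (d k z) = \<zero>\<^bsub>H n\<^esub>"
proof -
  have Z: "d k z \<in> Z n" using coboundary_in_Z[OF assms(1), of n] assms(2) by simp
  then have "d k z = d (n - 1) z \<oplus>\<^bsub>V n\<^esub> \<zero>\<^bsub>V n\<^esub>" using assms by simp
  then have "d k z \<in> cls n \<zero>\<^bsub>V n\<^esub>" unfolding mem_cls using assms by blast
  then have "coboundaries V d n +>\<^bsub>V n\<^esub> \<zero>\<^bsub>V n\<^esub> = coboundaries V d n +>\<^bsub>V n\<^esub> d k z"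
    using Q.W.a_repr_independence'[of "d k z" n "\<zero>\<^bsub>V n\<^esub>"] by (simp add: coset_Z coh_class_def)
  then show ?thesis by (simp add: coh_class_def flip: cls_zero)
qed

lemma cls_cong:
  assumes "x \<in> Z n" "y \<in> Z n" "x \<ominus>\<^bsub>V n\<^esub> y = d k z" "z \<in> carrier (V k)" "k = n - 1"
  shows "cls n x = cls n y"
proof -
  have "cls n x \<ominus>\<^bsub>H n\<^esub> cls n y = \<zero>\<^bsub>H n\<^esub>"
    using assms by (simp add: cls_minus[symmetric] cls_coboundary)
  then show ?thesis using assms by (simp add: H.M.minus_equality a_minus_def)
     (metis H.M.add.inv_equality H.M.a_inv_closed H.M.minus_minus cls_closed)
qed

end

text \<open>The differential is shifted without a sign, so cocycles, coboundaries and classes are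
  literally the same sets. Results about \<open>\<gg>\<close> thus apply to its shift.\<close>

lemma cohomology_shift:
  "cohomology (shift V k) (shift d k) n = cohomology V d (n + k)"
  "coh_class (shift V k) (shift d k) n = coh_class V d (n + k)"
proof -
  have "n - 1 + k = n + k - 1" "n + 1 + k = n + k + 1" by auto
  then show "cohomology (shift V k) (shift d k) n = cohomology V d (n + k)"
    "coh_class (shift V k) (shift d k) n = coh_class V d (n + k)"
    by (simp_all only: cohomology_def coh_class_def[abs_def] cocycles_def coboundaries_def shift_def)
qed

text \<open>The last condition on \<open>f\<close> asks only that boundaries go to the zero class,
  not that \<open>f\<close> be a chain map. This admits operators such as \<open>B\<close> and
  \<open>\<iota>\<close> that commute with \<open>b\<close> only up to sign.\<close>

lemma coh_map_cls:
  assumes V: "cochain_complex K V d" and W: "cochain_complex K W e"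
    and f: "linear_map K (V m) (W n) f"
    and Z: "\<And>x. x \<in> cocycles V d m \<Longrightarrow> f x \<in> cocycles W e n"
    and B: "\<And>z. z \<in> carrier (V (m - 1)) \<Longrightarrow>
      coh_class W e n (f (d (m - 1) z)) = \<zero>\<^bsub>cohomology W e n\<^esub>"
    and x: "x \<in> cocycles V d m"
  shows "coh_map W e n f (coh_class V d m x) = coh_class W e n (f x)"
proof -
  interpret V: cochain_complex K V d by fact
  interpret W: cochain_complex K W e by fact
  have "coh_class W e n (f y) = coh_class W e n (f x)" if y: "y \<in> coh_class V d m x" for y
  proof -
    obtain z where z: "z \<in> carrier (V (m - 1))" "y = d (m - 1) z \<oplus>\<^bsub>V m\<^esub> x"
      using y by (auto simp: V.mem_cls)
    have "d (m - 1) z \<in> V.Z m" using V.coboundary_in_Z[OF z(1), of m] by simp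
    with x z B[OF z(1)] show ?thesis
      by (simp add: linear_map_add[OF f] W.cls_add Z)
  qed
  moreover have "x \<in> coh_class V d m x" using V.cls_self x by simp
  ultimately show ?thesis unfolding coh_map_def by blast
qed

lemma coh_map_linear:
  assumes V: "cochain_complex K V d" and W: "cochain_complex K W e"
    and f: "linear_map K (V m) (W n) f"
    and Z: "\<And>x. x \<in> cocycles V d m \<Longrightarrow> f x \<in> cocycles W e n"
    and B: "\<And>z. z \<in> carrier (V (m - 1)) \<Longrightarrow>
      coh_class W e n (f (d (m - 1) z)) = \<zero>\<^bsub>cohomology W e n\<^esub>"
  shows "linear_map K (cohomology V d m) (cohomology W e n) (coh_map W e n f)"
proof -
  interpret V: cochain_complex K V d by fact
  interpret W: cochain_complex K W e by fact
  note c = coh_map_cls[OF assms]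
  show ?thesis
  proof (rule linear_mapI)
    fix X assume X: "X \<in> carrier (V.H m)"
    then show "coh_map W e n f X \<in> carrier (W.H n)"
      by (elim V.cls_cases) (simp add: c Z)
    show "coh_map W e n f (X \<oplus>\<^bsub>V.H m\<^esub> Y) = coh_map W e n f X \<oplus>\<^bsub>W.H n\<^esub> coh_map W e n f Y"
      if "Y \<in> carrier (V.H m)" for Y
      using X that
      by (elim V.cls_cases)
        (simp add: c Z V.cls_add[symmetric] W.cls_add[symmetric] linear_map_add[OF f])
    show "coh_map W e n f (a \<odot>\<^bsub>V.H m\<^esub> X) = a \<odot>\<^bsub>W.H n\<^esub> coh_map W e n f X"
      if "a \<in> carrier K" for a
      using X that
      by (elim V.cls_cases)
        (simp add: c Z V.cls_smult[symmetric] W.cls_smult[symmetric] linear_map_smult[OF f])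
  qed
qed

text \<open>Representatives are replaced one argument at a time, so it suffices that a boundary
  paired with a cocycle has zero class, on either side.\<close>

lemma coh_map2_cls:
  assumes U: "cochain_complex K U c" and V: "cochain_complex K V d" and W: "cochain_complex K W e"
    and f: "bilinear_map K (U l) (V m) (W n) f"
    and Z: "\<And>x y. x \<in> cocycles U c l \<Longrightarrow> y \<in> cocycles V d m \<Longrightarrow> f x y \<in> cocycles W e n"
    and B1: "\<And>z y. z \<in> carrier (U (l - 1)) \<Longrightarrow> y \<in> cocycles V d m \<Longrightarrow>
      coh_class W e n (f (c (l - 1) z) y) = \<zero>\<^bsub>cohomology W e n\<^esub>"
    and B2: "\<And>x z. x \<in> cocycles U c l \<Longrightarrow> z \<in> carrier (V (m - 1)) \<Longrightarrow>
      coh_class W e n (f x (d (m - 1) z)) = \<zero>\<^bsub>cohomology W e n\<^esub>"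
    and x: "x \<in> cocycles U c l" and y: "y \<in> cocycles V d m"
  shows "coh_map2 W e n f (coh_class U c l x) (coh_class V d m y) = coh_class W e n (f x y)"
proof -
  interpret U: cochain_complex K U c by fact
  interpret V: cochain_complex K V d by fact
  interpret W: cochain_complex K W e by fact
  have "coh_class W e n (f x' y') = coh_class W e n (f x y)"
    if x': "x' \<in> coh_class U c l x" and y': "y' \<in> coh_class V d m y" for x' y'
  proof -
    obtain z where z: "z \<in> carrier (U (l - 1))" "x' = c (l - 1) z \<oplus>\<^bsub>U l\<^esub> x"
      using x' by (auto simp: U.mem_cls)
    obtain w where w: "w \<in> carrier (V (m - 1))" "y' = d (m - 1) w \<oplus>\<^bsub>V m\<^esub> y"
      using y' by (auto simp: V.mem_cls)
    have cz: "c (l - 1) z \<in> U.Z l" and dw: "d (m - 1) w \<in> V.Z m"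
      using U.coboundary_in_Z[OF z(1), of l] V.coboundary_in_Z[OF w(1), of m] by simp_all
    then have x'Z: "x' \<in> U.Z l" and y'Z: "y' \<in> V.Z m" using z w x y by simp_all
    have l1: "linear_map K (U l) (W n) (\<lambda>x. f x y')" and l2: "linear_map K (V m) (W n) (f x)"
      using f y'Z x by (auto simp: bilinear_map_def)
    have "f x' y' = f (c (l - 1) z) y' \<oplus>\<^bsub>W n\<^esub> f x y'"
      unfolding z(2) using cz x by (intro linear_map_add[OF l1]) auto
    also have "f x y' = f x (d (m - 1) w) \<oplus>\<^bsub>W n\<^esub> f x y"
      unfolding w(2) using dw y by (intro linear_map_add[OF l2]) auto
    finally show ?thesis using cz dw x y y'Z z w
      by (simp add: Z W.cls_add B1 B2)
  qed
  moreover have "x \<in> coh_class U c l x" "y \<in> coh_class V d m y"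
    using U.cls_self V.cls_self x y by simp_all
  ultimately show ?thesis unfolding coh_map2_def by blast
qed

section \<open>Negative cyclic cohomology\<close>

lemma periodic_simps:
  "w \<in> carrier (periodic M n) \<longleftrightarrow> (\<forall>j. w j \<in> carrier (M (n - 2 * j)))"
  "(v \<oplus>\<^bsub>periodic M n\<^esub> w) j = v j \<oplus>\<^bsub>M (n - 2 * j)\<^esub> w j"
  "(c \<odot>\<^bsub>periodic M n\<^esub> w) j = c \<odot>\<^bsub>M (n - 2 * j)\<^esub> w j"
  "\<zero>\<^bsub>periodic M n\<^esub> j = \<zero>\<^bsub>M (n - 2 * j)\<^esub>"
  by (simp_all add: periodic_def)

lemma d_u_apply:
  "d_u M b B n w j =
    b (n - 2 * j) (w j) \<oplus>\<^bsub>M (n + 1 - 2 * j)\<^esub> B (n - 2 * (j - 1)) (w (j - 1))"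
  by (simp add: d_u_def periodic_simps u_extend_def u_times_def)

abbreviation neg_class :: "(int \<Rightarrow> ('k, 'm) module) \<Rightarrow> int \<Rightarrow> (int \<Rightarrow> 'm) \<Rightarrow> (int \<Rightarrow> 'm) set" where
  "neg_class M n w \<equiv> u_positive M n +>\<^bsub>periodic M n\<^esub> w"

context mixed_complex
begin

sublocale CM: cochain_complex K M b
  by unfold_locales (use M_graded_space b_linear b_square in auto)

lemma B_lin: "k = n - 1 \<Longrightarrow> linear_map K (M n) (M k) (B n)"
  by (rule graded_linearD[OF B_linear]) simp

lemmas B_closed = linear_map_closed[OF B_lin]
  and B_add = linear_map_add[OF B_lin]
  and B_smult = linear_map_smult[OF B_lin]
  and B_zero = linear_map_zero[OF B_lin CM.V.module_axioms CM.V.module_axioms]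
  and B_uminus = linear_map_uminus[OF B_lin CM.V.module_axioms CM.V.module_axioms]

lemma B_B: "x \<in> carrier (M n) \<Longrightarrow> k = n - 1 \<Longrightarrow> l = n - 2 \<Longrightarrow> B k (B n x) = \<zero>\<^bsub>M l\<^esub>"
  using B_square by simp

lemma b_B:
  assumes "x \<in> carrier (M n)" "k = n - 1" "l = n + 1"
  shows "b k (B n x) = \<ominus>\<^bsub>M n\<^esub> B l (b n x)"
proof -
  have "b k (B n x) \<oplus>\<^bsub>M n\<^esub> B l (b n x) = \<zero>\<^bsub>M n\<^esub>"
    using b_B_anticommute assms by simp
  moreover have "b k (B n x) \<in> carrier (M n)" "B l (b n x) \<in> carrier (M n)"
    using assms by (auto intro!: CM.d_closed B_closed)
  ultimately show ?thesis by (simp add: CM.V.M.minus_equality)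
qed

lemma B_cocycle: "x \<in> CM.Z n \<Longrightarrow> k = n - 1 \<Longrightarrow> B n x \<in> CM.Z k"
  using b_B[of x n k "n + 1"] B_zero[of n "n + 1"]
  by (simp add: CM.Z_iff[OF refl, of "B n x"] B_closed) (simp add: CM.Z_iff[OF refl, of x])

lemma B_coboundary: "z \<in> carrier (M (n - 1)) \<Longrightarrow> k = n - 1 \<Longrightarrow>
    CM.cls k (B n (b (n - 1) z)) = \<zero>\<^bsub>CM.H k\<^esub>"
proof -
  assume z: "z \<in> carrier (M (n - 1))" and k: "k = n - 1"
  have "B n (b (n - 1) z) = \<ominus>\<^bsub>M k\<^esub> b (k - 1) (B k z)"
    using z k b_B[of z k "k - 1" "k + 1"] B_closed[of "k" "k + 1" "b (n - 1) z"]
      CM.d_closed[of n "n - 1" z] by simp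
  moreover have "b (k - 1) (B k z) \<in> CM.Z k"
    using CM.coboundary_in_Z[of "B k z" "k - 1" k] z k B_closed[of "k - 1" k z] by simp
  ultimately show ?thesis
    using z k B_closed[of "k - 1" k z] by (simp add: CM.cls_uminus CM.cls_coboundary)
qed

lemma B_coh:
  assumes "k = n - 1"
  shows "x \<in> CM.Z n \<Longrightarrow> coh_map M b k (B n) (CM.cls n x) = CM.cls k (B n x)"
    and "linear_map K (CM.H n) (CM.H k) (coh_map M b k (B n))"
proof -
  note C = CM.cochain_complex_axioms CM.cochain_complex_axioms B_lin[OF assms]
    B_cocycle[OF _ assms] B_coboundary[OF _ assms]
  show "linear_map K (CM.H n) (CM.H k) (coh_map M b k (B n))"
    by (rule coh_map_linear[OF C])
  show "coh_map M b k (B n) (CM.cls n x) = CM.cls k (B n x)" if "x \<in> CM.Z n"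
    by (rule coh_map_cls[OF C that])
qed

section \<open>Series in \<open>u\<close> and their quotient by \<open>u M[[u]]\<close>\<close>

sublocale P: vector_module K "periodic M n" for n
  unfolding vector_module_def
proof (rule moduleI)
  show "abelian_group (periodic M n)"
  proof (rule abelian_groupI)
    fix w assume w: "w \<in> carrier (periodic M n)"
    then have "(\<lambda>j. \<ominus>\<^bsub>M (n - 2 * j)\<^esub> w j) \<in> carrier (periodic M n)"
      "(\<lambda>j. \<ominus>\<^bsub>M (n - 2 * j)\<^esub> w j) \<oplus>\<^bsub>periodic M n\<^esub> w = \<zero>\<^bsub>periodic M n\<^esub>"
      by (auto simp: periodic_simps fun_eq_iff CM.V.M.l_neg)
    then show "\<exists>v\<in>carrier (periodic M n). v \<oplus>\<^bsub>periodic M n\<^esub> w = \<zero>\<^bsub>periodic M n\<^esub>"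
      by blast
  qed (auto simp: periodic_simps fun_eq_iff CM.V.M.a_ac)
qed (auto simp: periodic_simps fun_eq_iff CM.V.smult_l_distr CM.V.smult_r_distr
    CM.V.smult_assoc1 intro: CM.V.R.is_cring)

text \<open>The additive inverse is not a field of the record but is determined by addition and
  zero; its uniqueness identifies it with the coefficientwise inverse.\<close>

lemma periodic_uminus:
  assumes "w \<in> carrier (periodic M n)"
  shows "(\<ominus>\<^bsub>periodic M n\<^esub> w) j = \<ominus>\<^bsub>M (n - 2 * j)\<^esub> w j"
proof -
  have "\<ominus>\<^bsub>periodic M n\<^esub> w = (\<lambda>j. \<ominus>\<^bsub>M (n - 2 * j)\<^esub> w j)"
    using assms by (intro P.M.minus_equality) (auto simp: periodic_simps fun_eq_iff CM.V.M.l_neg)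
  then show ?thesis by simp
qed

lemma periodic_minus:
  assumes "v \<in> carrier (periodic M n)" "w \<in> carrier (periodic M n)"
  shows "(v \<ominus>\<^bsub>periodic M n\<^esub> w) j = v j \<ominus>\<^bsub>M (n - 2 * j)\<^esub> w j"
  using assms by (simp add: a_minus_def periodic_simps periodic_uminus)

lemma periodic_gsign:
  assumes "w \<in> carrier (periodic M n)"
  shows "gsign (periodic M n) k w j = gsign (M (n - 2 * j)) k (w j)"
  using assms by (simp add: gsign_def periodic_uminus)

sublocale N: quotient_module K "periodic M n" "u_positive M n" for n
proof (intro quotient_module.intro quotient_module_axioms.intro P.vector_module_axioms P.submoduleI)
  show "u_positive M n \<subseteq> carrier (periodic M n)" "\<zero>\<^bsub>periodic M n\<^esub> \<in> u_positive M n"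
    by (auto simp: u_positive_def periodic_simps)
  fix v w assume v: "v \<in> u_positive M n"
  then show "\<ominus>\<^bsub>periodic M n\<^esub> v \<in> u_positive M n"
    by (simp add: u_positive_def periodic_uminus)
  show "v \<oplus>\<^bsub>periodic M n\<^esub> w \<in> u_positive M n" if "w \<in> u_positive M n"
    using v that by (simp add: u_positive_def periodic_simps(2))
  show "c \<odot>\<^bsub>periodic M n\<^esub> v \<in> u_positive M n" if "c \<in> carrier K" for c
    using v that by (simp add: u_positive_def periodic_simps(3))
qed

lemma negative_carrier: "carrier (negative M n) = neg_class M n ` carrier (periodic M n)"
  unfolding negative_def by (rule N.carrier_quot)

text \<open>This is the working description of the quotient: positive powers of \<open>u\<close> are
  invisible, and equality of classes is equality of the coefficients at
  \<open>j \<le> 0\<close>.\<close>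

lemma mem_neg_class:
  assumes w: "w \<in> carrier (periodic M n)"
  shows "v \<in> neg_class M n w \<longleftrightarrow> v \<in> carrier (periodic M n) \<and> (\<forall>j\<le>0. v j = w j)"
proof (intro iffI conjI allI impI)
  have wj: "w j \<in> carrier (M (n - 2 * j))" for j using w unfolding periodic_simps(1) by blast
  {
    assume "v \<in> neg_class M n w"
    then obtain u where u: "u \<in> u_positive M n" and v: "v = u \<oplus>\<^bsub>periodic M n\<^esub> w"
      unfolding N.mem_coset_iff by blast
    then have uc: "u \<in> carrier (periodic M n)" and u0: "\<And>j. j \<le> 0 \<Longrightarrow> u j = \<zero>\<^bsub>M (n - 2 * j)\<^esub>"
      unfolding u_positive_def by blast+
    show "v \<in> carrier (periodic M n)" unfolding v using uc w by (rule P.M.a_closed)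
    show "v j = w j" if "j \<le> 0" for j
      unfolding v periodic_simps(2) u0[OF that] using wj by (rule CM.V.M.l_zero)
  next
    assume v: "v \<in> carrier (periodic M n) \<and> (\<forall>j\<le>0. v j = w j)"
    then have vc: "v \<in> carrier (periodic M n)" and v0: "\<And>j. j \<le> 0 \<Longrightarrow> v j = w j" by blast+
    have "(v \<ominus>\<^bsub>periodic M n\<^esub> w) j = \<zero>\<^bsub>M (n - 2 * j)\<^esub>" if "j \<le> 0" for j
      unfolding periodic_minus[OF vc w] v0[OF that] unfolding a_minus_def using wj by (rule CM.V.M.r_neg)
    then have "v \<ominus>\<^bsub>periodic M n\<^esub> w \<in> u_positive M n"
      unfolding u_positive_def using P.minus_closed[OF vc w] by blast
    moreover have "v = (v \<ominus>\<^bsub>periodic M n\<^esub> w) \<oplus>\<^bsub>periodic M n\<^esub> w"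
      using vc w by (simp add: a_minus_def P.M.a_assoc P.M.l_neg)
    ultimately show "v \<in> neg_class M n w" unfolding N.mem_coset_iff by blast
  }
qed

lemma neg_class_eqI:
  assumes "v \<in> carrier (periodic M n)" "w \<in> carrier (periodic M n)" "\<And>j. j \<le> 0 \<Longrightarrow> v j = w j"
  shows "neg_class M n v = neg_class M n w"
proof (rule Set.set_eqI)
  fix u
  show "u \<in> neg_class M n v \<longleftrightarrow> u \<in> neg_class M n w"
    unfolding mem_neg_class[OF assms(1)] mem_neg_class[OF assms(2)] using assms(3) by metis
qed

lemma neg_class_eqD:
  assumes "v \<in> carrier (periodic M n)" "w \<in> carrier (periodic M n)"
    "neg_class M n v = neg_class M n w" "j \<le> 0"
  shows "v j = w j"
proof -
  have "v \<in> neg_class M n v" unfolding mem_neg_class[OF assms(1)] using assms(1) by blast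
  then show ?thesis using assms(4) unfolding assms(3) mem_neg_class[OF assms(2)] by blast
qed

section \<open>The differential \<open>d_u\<close> and the negative cyclic complex\<close>

lemma d_u_lin: "linear_map K (periodic M n) (periodic M (n + 1)) (d_u M b B n)"
proof -
  \<comment> \<open>Since \<open>u\<close> has degree 2, the coefficient at \<open>j - 1\<close>
    lies two degrees above the one at \<open>j\<close>. Writing all degrees relative to
    \<open>n - 2 * j\<close> shows that \<open>b\<close> and \<open>B\<close> land in the same
    space.\<close>
  have idx: "n - 2 * (j - 1) = n - 2 * j + 2" "n + 1 - 2 * j = n - 2 * j + 1" for j by auto
  have b: "linear_map K (M k) (M (k + 1)) (b k)"
    and B: "linear_map K (M (k + 2)) (M (k + 1)) (B (k + 2))" for k
    by (auto intro!: CM.d_lin B_lin)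
  have mem: "w j \<in> carrier (M (n - 2 * j))" "w (j - 1) \<in> carrier (M (n - 2 * j + 2))"
    if "w \<in> carrier (periodic M n)" for w j
    using that[unfolded periodic_simps(1), rule_format, of j]
      that[unfolded periodic_simps(1), rule_format, of "j - 1"] by (simp_all only: idx)
  show ?thesis
  proof (rule linear_mapI)
    fix v w c assume v: "v \<in> carrier (periodic M n)"
    note cv = linear_map_closed[OF b mem(1)[OF v]] linear_map_closed[OF B mem(2)[OF v]]
    show "d_u M b B n v \<in> carrier (periodic M (n + 1))"
      unfolding periodic_simps(1) d_u_apply idx using cv by blast
    show "d_u M b B n (c \<odot>\<^bsub>periodic M n\<^esub> v) = c \<odot>\<^bsub>periodic M (n + 1)\<^esub> d_u M b B n v"
      if c: "c \<in> carrier K"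
    proof
      fix j
      have i: "n - 2 * (j - 1) = n - 2 * j + 2" by simp
      show "d_u M b B n (c \<odot>\<^bsub>periodic M n\<^esub> v) j = (c \<odot>\<^bsub>periodic M (n + 1)\<^esub> d_u M b B n v) j"
        unfolding periodic_simps d_u_apply idx i
          linear_map_smult[OF b c mem(1)[OF v]] linear_map_smult[OF B c mem(2)[OF v]]
        by (rule CM.V.smult_r_distr[symmetric]) (intro c cv)+
    qed
    show "d_u M b B n (v \<oplus>\<^bsub>periodic M n\<^esub> w) = d_u M b B n v \<oplus>\<^bsub>periodic M (n + 1)\<^esub> d_u M b B n w"
      if w: "w \<in> carrier (periodic M n)"
    proof
      fix j
      note cw = linear_map_closed[OF b mem(1)[OF w]] linear_map_closed[OF B mem(2)[OF w]]
      show "d_u M b B n (v \<oplus>\<^bsub>periodic M n\<^esub> w) j =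
          (d_u M b B n v \<oplus>\<^bsub>periodic M (n + 1)\<^esub> d_u M b B n w) j"
        unfolding periodic_simps d_u_apply idx
          linear_map_add[OF b mem(1)[OF v] mem(1)[OF w]]
          linear_map_add[OF B mem(2)[OF v] mem(2)[OF w]]
        using cv[of j] cw[of j] by (simp only: CM.V.M.a_ac CM.V.M.a_closed)
    qed
  qed
qed

lemmas d_u_closed = linear_map_closed[OF d_u_lin]

text \<open>The coefficient at \<open>j\<close> is \<open>b b x + (b B + B b) y + B B z\<close>,
  where \<open>x\<close>, \<open>y\<close>, \<open>z\<close> are the coefficients of
  \<open>w\<close> at \<open>j\<close>, \<open>j - 1\<close>, \<open>j - 2\<close>; each of the
  three summands is zero by one axiom of a mixed complex.\<close>

lemma d_u_square:
  assumes w: "w \<in> carrier (periodic M n)"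
  shows "d_u M b B (n + 1) (d_u M b B n w) = \<zero>\<^bsub>periodic M (n + 2)\<^esub>"
proof
  fix j
  have wj: "w j \<in> carrier (M (n - 2 * j))" for j using w by (simp add: periodic_simps)
  define k where "k = n - 2 * j"
  define x y z where "x = w j" and "y = w (j - 1)" and "z = w (j - 2)"
  have xyz: "x \<in> carrier (M k)" "y \<in> carrier (M (k + 2))" "z \<in> carrier (M (k + 4))"
    using wj[of j] wj[of "j - 1"] wj[of "j - 2"] by (simp_all add: x_def y_def z_def k_def algebra_simps)
  have idx: "n + 1 - 2 * j = k + 1" "n - 2 * j = k" "n - 2 * (j - 1) = k + 2"
    "n - 2 * (j - 1 - 1) = k + 4" "n + 1 - 2 * (j - 1) = k + 3" "n + 1 + 1 - 2 * j = k + 2"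
    "n + 2 - 2 * j = k + 2" "j - 1 - 1 = j - 2" "n - 2 * (j - 2) = k + 4" "k + 3 - 1 = k + 2"
    by (auto simp: k_def)
  have c: "b k x \<in> carrier (M (k + 1))" "B (k + 2) y \<in> carrier (M (k + 1))"
    "b (k + 2) y \<in> carrier (M (k + 3))" "B (k + 4) z \<in> carrier (M (k + 3))"
    using xyz by (auto intro!: CM.d_closed B_closed)
  have e: "b (k + 1) (b k x) = \<zero>\<^bsub>M (k + 2)\<^esub>" "B (k + 3) (B (k + 4) z) = \<zero>\<^bsub>M (k + 2)\<^esub>"
    "b (k + 1) (B (k + 2) y) = \<ominus>\<^bsub>M (k + 2)\<^esub> B (k + 3) (b (k + 2) y)"
    using xyz CM.d_d[of x k "k + 1" "k + 2"] B_B[of z "k + 4" "k + 3" "k + 2"]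
      b_B[of y "k + 2" "k + 1" "k + 3"] by auto
  have B: "B (k + 3) (b (k + 2) y) \<in> carrier (M (k + 2))"
    using c by (auto intro!: B_closed)
  show "d_u M b B (n + 1) (d_u M b B n w) j = \<zero>\<^bsub>periodic M (n + 2)\<^esub> j"
    unfolding d_u_apply periodic_simps idx x_def[symmetric] y_def[symmetric] z_def[symmetric]
    using c e B CM.d_add[of "k + 2" "k + 1" "b k x" "B (k + 2) y"]
      B_add[of "k + 2" "k + 3" "b (k + 2) y" "B (k + 4) z"]
    by (simp add: CM.V.M.l_neg)
qed

text \<open>The coefficient of \<open>d_u w\<close> at \<open>j\<close> involves only
  \<open>w j\<close> and \<open>w (j - 1)\<close>. Changing \<open>w\<close> in positive powers of
  \<open>u\<close> therefore leaves the coefficients at \<open>j \<le> 0\<close> alone.\<close>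

lemma d_negative_class:
  assumes w: "w \<in> carrier (periodic M n)"
  shows "d_negative M b B n (neg_class M n w) = neg_class M (n + 1) (d_u M b B n w)"
proof -
  have "neg_class M (n + 1) (d_u M b B n v) = neg_class M (n + 1) (d_u M b B n w)"
    if v: "v \<in> neg_class M n w" for v
  proof (rule neg_class_eqI)
    have *: "v \<in> carrier (periodic M n)" "\<And>j. j \<le> 0 \<Longrightarrow> v j = w j"
      using v by (auto simp: mem_neg_class[OF w])
    then show "d_u M b B n v \<in> carrier (periodic M (n + 1))"
      "d_u M b B n w \<in> carrier (periodic M (n + 1))" using w by (auto simp: d_u_closed)
    show "d_u M b B n v j = d_u M b B n w j" if "j \<le> 0" for j
      using that * by (simp add: d_u_apply)
  qed
  moreover have "w \<in> neg_class M n w" by (simp add: mem_neg_class w)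
  ultimately show ?thesis unfolding d_negative_def by blast
qed

lemma neg_class_linear: "linear_map K (periodic M n) (negative M n) (neg_class M n)"
  unfolding negative_def by (rule N.coset_linear)

lemma negative_is_module: "module K (negative M n)"
  unfolding negative_def by (rule N.quot_is_module)

lemma neg_class_zero: "neg_class M n \<zero>\<^bsub>periodic M n\<^esub> = \<zero>\<^bsub>negative M n\<^esub>"
  by (rule linear_map_zero[OF neg_class_linear P.module_axioms negative_is_module])

lemma negative_cochain_complex: "cochain_complex K (negative M) (d_negative M b B)"
proof
  show "graded_space K (negative M)"
    using M_graded_space N.quot_is_module by (simp add: graded_space_def negative_def)
  show "graded_linear K (negative M) (negative M) 1 (d_negative M b B)"
    unfolding graded_linear_def
  proof (intro allI linear_mapI)
    fix n F c assume F: "F \<in> carrier (negative M n)"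
    note add = linear_map_add[OF neg_class_linear, symmetric] linear_map_add[OF d_u_lin]
      and sm = linear_map_smult[OF neg_class_linear, symmetric] linear_map_smult[OF d_u_lin]
    show "d_negative M b B n F \<in> carrier (negative M (n + 1))"
      using F by (auto simp: negative_carrier d_negative_class d_u_closed)
    show "d_negative M b B n (c \<odot>\<^bsub>negative M n\<^esub> F) =
        c \<odot>\<^bsub>negative M (n + 1)\<^esub> d_negative M b B n F" if "c \<in> carrier K"
      using F that by (auto simp: negative_carrier d_negative_class sm d_u_closed)
    show "d_negative M b B n (F \<oplus>\<^bsub>negative M n\<^esub> G) =
        d_negative M b B n F \<oplus>\<^bsub>negative M (n + 1)\<^esub> d_negative M b B n G"
      if "G \<in> carrier (negative M n)" for G
      using F that by (auto simp: negative_carrier d_negative_class add d_u_closed)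
  qed
  show "d_negative M b B (n + 1) (d_negative M b B n F) = \<zero>\<^bsub>negative M (n + 2)\<^esub>"
    if "F \<in> carrier (negative M n)" for n F
  proof -
    have i: "n + 1 + 1 = n + 2" by simp
    from that obtain w where w: "w \<in> carrier (periodic M n)" "F = neg_class M n w"
      by (auto simp: negative_carrier)
    show ?thesis
      unfolding w(2) d_negative_class[OF w(1)] d_negative_class[OF d_u_closed[OF w(1)]] i
        d_u_square[OF w(1)] by (rule neg_class_zero)
  qed
qed

sublocale CN: cochain_complex K "negative M" "d_negative M b B"
  by (rule negative_cochain_complex)

text \<open>A representative of a cocycle need not be closed under \<open>d_u\<close>: the condition
  stops at \<open>j = 0\<close>.\<close>

lemma neg_class_in_Z:
  assumes "w \<in> carrier (periodic M n)"
  shows "neg_class M n w \<in> CN.Z n \<longleftrightarrow> (\<forall>j\<le>0. d_u M b B n w j = \<zero>\<^bsub>M (n + 1 - 2 * j)\<^esub>)"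
proof -
  have w: "neg_class M n w \<in> carrier (negative M n)" using assms by (auto simp: negative_carrier)
  note c = d_u_closed[OF assms]
  have "neg_class M n w \<in> CN.Z n \<longleftrightarrow>
      neg_class M (n + 1) (d_u M b B n w) = neg_class M (n + 1) \<zero>\<^bsub>periodic M (n + 1)\<^esub>"
    unfolding CN.Z_iff[OF refl] using w d_negative_class[OF assms] neg_class_zero by simp
  also have "\<dots> \<longleftrightarrow> (\<forall>j\<le>0. d_u M b B n w j = \<zero>\<^bsub>M (n + 1 - 2 * j)\<^esub>)"
    using neg_class_eqI[OF c P.M.zero_closed] neg_class_eqD[OF c P.M.zero_closed]
    unfolding periodic_simps(4) by blast
  finally show ?thesis .
qed

lemma HC_minus_cases:
  assumes "X \<in> carrier (HC_minus M b B n)"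
  obtains w where "w \<in> carrier (periodic M n)" "neg_class M n w \<in> CN.Z n"
    "X = CN.cls n (neg_class M n w)"
proof -
  from assms obtain F where "F \<in> CN.Z n" "X = CN.cls n F"
    unfolding HC_minus_def by (rule CN.cls_cases)
  moreover from this(1) have "F \<in> carrier (negative M n)" by simp
  ultimately show ?thesis using that by (auto simp: negative_carrier)
qed

section \<open>The connecting map \<open>\<beta>\<close>\<close>

lemma B_constant_term_cocycle:
  assumes w: "w \<in> carrier (periodic M n)" and "neg_class M n w \<in> CN.Z n" and k: "k = n - 1"
  shows "B n (w 0) \<in> CM.Z k"
proof -
  have w0: "w 0 \<in> carrier (M n)" and w1: "w (-1) \<in> carrier (M (n + 2))"
    using w[unfolded periodic_simps(1), rule_format, of 0]
      w[unfolded periodic_simps(1), rule_format, of "-1"] by simp_all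
  \<comment> \<open>The cocycle condition at \<open>j = 0\<close> reads
    \<open>b w_0 = - B w_(-1)\<close>, hence
    \<open>b B w_0 = - B b w_0 = B B w_(-1) = 0\<close>.\<close>
  have "d_u M b B n w 0 = \<zero>\<^bsub>M (n + 1)\<^esub>"
    using assms neg_class_in_Z[OF w] by simp
  then have e: "b n (w 0) \<oplus>\<^bsub>M (n + 1)\<^esub> B (n + 2) (w (-1)) = \<zero>\<^bsub>M (n + 1)\<^esub>"
    by (simp add: d_u_apply)
  have c: "b n (w 0) \<in> carrier (M (n + 1))" "B (n + 2) (w (-1)) \<in> carrier (M (n + 1))"
    using w0 w1 by (auto intro!: CM.d_closed B_closed)
  have "b n (w 0) = \<ominus>\<^bsub>M (n + 1)\<^esub> B (n + 2) (w (-1))"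
    using c e by (simp add: CM.V.M.minus_equality)
  then have "B (n + 1) (b n (w 0)) = \<zero>\<^bsub>M n\<^esub>"
    using B_uminus[of n "n + 1" "B (n + 2) (w (-1))"] c B_B[OF w1, of "n + 1" n] by simp
  then have "b (n - 1) (B n (w 0)) = \<zero>\<^bsub>M n\<^esub>"
    using b_B[OF w0, of "n - 1" "n + 1"] by simp
  then show ?thesis
    unfolding k CM.Z_iff[OF refl] using B_closed[OF refl w0] by simp
qed

text \<open>Another representative has constant term \<open>b v_0 + B v_(-1) + w_0\<close> for some
  series \<open>v\<close>. Applying \<open>B\<close> kills the middle term by \<open>B B = 0\<close>
  and makes the first one exact, since \<open>B\<close> and \<open>b\<close> anticommute.\<close>

lemma beta_map_class:
  assumes w: "w \<in> carrier (periodic M n)" and Z: "neg_class M n w \<in> CN.Z n"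
  shows "beta_map M b B n (CN.cls n (neg_class M n w)) = CM.cls (n - 1) (B n (w 0))"
proof -
  have "CM.cls (n - 1) (B n (w' 0)) = CM.cls (n - 1) (B n (w 0))"
    if F: "F \<in> CN.cls n (neg_class M n w)" and w': "w' \<in> F" for F w'
  proof -
    obtain G where G: "G \<in> carrier (negative M (n - 1))"
      "F = d_negative M b B (n - 1) G \<oplus>\<^bsub>negative M n\<^esub> neg_class M n w"
      using F by (auto simp: CN.mem_cls)
    then obtain v where v: "v \<in> carrier (periodic M (n - 1))" "G = neg_class M (n - 1) v"
      by (auto simp: negative_carrier)
    have dv: "d_u M b B (n - 1) v \<in> carrier (periodic M n)"
      using d_u_closed[OF v(1)] by simp
    have "F = neg_class M n (d_u M b B (n - 1) v \<oplus>\<^bsub>periodic M n\<^esub> w)"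
      using d_negative_class[OF v(1)] linear_map_add[OF neg_class_linear dv w] G v by simp
    then have w'0: "w' 0 = d_u M b B (n - 1) v 0 \<oplus>\<^bsub>M n\<^esub> w 0"
      using w' mem_neg_class[OF P.M.a_closed[OF dv w], of w'] by (simp add: periodic_simps(2))
    have v0: "v 0 \<in> carrier (M (n - 1))" and v1: "v (-1) \<in> carrier (M (n + 1))"
      using v(1)[unfolded periodic_simps(1), rule_format, of 0]
        v(1)[unfolded periodic_simps(1), rule_format, of "-1"] by (simp_all add: add.commute)
    have w0: "w 0 \<in> carrier (M n)" using w[unfolded periodic_simps(1), rule_format, of 0] by simp
    have c: "b (n - 1) (v 0) \<in> carrier (M n)" "B (n + 1) (v (-1)) \<in> carrier (M n)"
      using v0 v1 by (auto intro!: CM.d_closed B_closed)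
    have "w' 0 = b (n - 1) (v 0) \<oplus>\<^bsub>M n\<^esub> B (n + 1) (v (-1)) \<oplus>\<^bsub>M n\<^esub> w 0"
      using w'0 by (simp add: d_u_apply add.commute)
    then have "B n (w' 0) = B n (b (n - 1) (v 0)) \<oplus>\<^bsub>M (n - 1)\<^esub> B n (w 0)"
      using c w0 B_closed[OF refl c(1)] by (simp add: B_add[OF refl] B_B[OF v1, of n "n - 1"])
    moreover have "b (n - 1) (v 0) \<in> CM.Z n"
      using CM.coboundary_in_Z[OF v0, of n] by simp
    then have "B n (b (n - 1) (v 0)) \<in> CM.Z (n - 1)"
      by (rule B_cocycle) simp
    ultimately show ?thesis
      using B_constant_term_cocycle[OF w Z refl] B_coboundary[OF v0 refl] by (simp add: CM.cls_add)
  qed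
  moreover have "neg_class M n w \<in> CN.cls n (neg_class M n w)" by (rule CN.cls_self[OF Z])
  moreover have "w \<in> neg_class M n w" by (simp add: mem_neg_class w)
  ultimately show ?thesis unfolding beta_map_def by blast
qed

lemma HC_minus_module: "module K (HC_minus M b B n)"
  unfolding HC_minus_def by (rule CN.H.module_axioms)

text \<open>\<open>beta_map\<close> is a union over two layers of representatives rather than an
  instance of \<open>coh_map\<close>, so linearity is checked directly on series.\<close>

lemma beta_map_linear:
  assumes k: "k = n - 1"
  shows "linear_map K (HC_minus M b B n) (CM.H k) (beta_map M b B n)"
  unfolding k
proof (rule linear_mapI)
  fix X assume "X \<in> carrier (HC_minus M b B n)"
  then obtain w where w: "w \<in> carrier (periodic M n)" "neg_class M n w \<in> CN.Z n"
    and X: "X = CN.cls n (neg_class M n w)" by (rule HC_minus_cases)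
  have w0: "w 0 \<in> carrier (M n)" using w(1)[unfolded periodic_simps(1), rule_format, of 0] by simp
  note Bw = B_constant_term_cocycle[OF w refl]
  show "beta_map M b B n X \<in> carrier (CM.H (n - 1))"
    unfolding X beta_map_class[OF w] using Bw by simp
  show "beta_map M b B n (c \<odot>\<^bsub>HC_minus M b B n\<^esub> X) = c \<odot>\<^bsub>CM.H (n - 1)\<^esub> beta_map M b B n X"
    if c: "c \<in> carrier K" for c
  proof -
    have e: "c \<odot>\<^bsub>negative M n\<^esub> neg_class M n w = neg_class M n (c \<odot>\<^bsub>periodic M n\<^esub> w)"
      using linear_map_smult[OF neg_class_linear c w(1)] by simp
    have "c \<odot>\<^bsub>HC_minus M b B n\<^esub> X = CN.cls n (neg_class M n (c \<odot>\<^bsub>periodic M n\<^esub> w))"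
      unfolding X HC_minus_def CN.cls_smult[OF c w(2), symmetric] e ..
    moreover have "neg_class M n (c \<odot>\<^bsub>periodic M n\<^esub> w) \<in> CN.Z n"
      using CN.Z_closed(3)[OF c w(2)] e by simp
    ultimately show ?thesis
      using beta_map_class[OF P.smult_closed[OF c w(1)]]
      by (simp add: X beta_map_class[OF w] periodic_simps(3) B_smult[OF refl c w0]
          CM.cls_smult[OF c Bw])
  qed
  show "beta_map M b B n (X \<oplus>\<^bsub>HC_minus M b B n\<^esub> Y) =
      beta_map M b B n X \<oplus>\<^bsub>CM.H (n - 1)\<^esub> beta_map M b B n Y"
    if Y: "Y \<in> carrier (HC_minus M b B n)" for Y
  proof -
    obtain v where v: "v \<in> carrier (periodic M n)" "neg_class M n v \<in> CN.Z n"
      and Y: "Y = CN.cls n (neg_class M n v)" using Y by (rule HC_minus_cases)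
    have v0: "v 0 \<in> carrier (M n)" using v(1)[unfolded periodic_simps(1), rule_format, of 0] by simp
    have e: "neg_class M n w \<oplus>\<^bsub>negative M n\<^esub> neg_class M n v =
        neg_class M n (w \<oplus>\<^bsub>periodic M n\<^esub> v)"
      using linear_map_add[OF neg_class_linear w(1) v(1)] by simp
    have "X \<oplus>\<^bsub>HC_minus M b B n\<^esub> Y = CN.cls n (neg_class M n (w \<oplus>\<^bsub>periodic M n\<^esub> v))"
      unfolding X Y HC_minus_def CN.cls_add[OF w(2) v(2), symmetric] e ..
    moreover have "neg_class M n (w \<oplus>\<^bsub>periodic M n\<^esub> v) \<in> CN.Z n"
      using CN.Z_closed(2)[OF w(2) v(2)] e by simp
    ultimately show ?thesis
      using beta_map_class[OF P.M.a_closed[OF w(1) v(1)]]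
      by (simp add: X Y beta_map_class[OF w] beta_map_class[OF v] periodic_simps(2)
          B_add[OF refl w0 v0] CM.cls_add[OF Bw B_constant_term_cocycle[OF v refl]])
  qed
qed

section \<open>The map \<open>j\<close> and its compositions with \<open>\<beta>\<close>\<close>

definition single :: "int \<Rightarrow> 'm \<Rightarrow> int \<Rightarrow> 'm" where
  "single n x = (\<lambda>j. if j = 0 then x else \<zero>\<^bsub>M (n - 2 * j)\<^esub>)"

lemma const_series_single: "const_series M n x = neg_class M n (single n x)"
  by (simp add: const_series_def single_def)

lemma single_linear: "linear_map K (M n) (periodic M n) (single n)"
  by (rule linear_mapI) (auto simp: single_def periodic_simps fun_eq_iff)

lemmas single_closed = linear_map_closed[OF single_linear]

text \<open>The restriction to \<open>j \<le> 0\<close> is essential: \<open>d_u\<close> also puts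
  \<open>B x\<close> at \<open>u^1\<close>. The inclusion as constants is a chain map only because
  that term disappears in the quotient.\<close>

lemma d_u_single:
  assumes x: "x \<in> carrier (M n)" and j: "j \<le> 0"
  shows "d_u M b B n (single n x) j = single (n + 1) (b n x) j"
proof -
  have 0: "B (n - 2 * (j - 1)) \<zero>\<^bsub>M (n - 2 * (j - 1))\<^esub> = \<zero>\<^bsub>M (n + 1 - 2 * j)\<^esub>"
    "b (n - 2 * j) \<zero>\<^bsub>M (n - 2 * j)\<^esub> = \<zero>\<^bsub>M (n + 1 - 2 * j)\<^esub>"
    by (intro B_zero CM.d_zero; simp)+
  have "b n x \<in> carrier (M (n + 1))" using x by (intro CM.d_closed) auto
  then show ?thesis using j 0 by (auto simp: d_u_apply single_def)
qed

lemma d_negative_const: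
  assumes x: "x \<in> carrier (M n)"
  shows "d_negative M b B n (const_series M n x) = const_series M (n + 1) (b n x)"
  unfolding const_series_single d_negative_class[OF single_closed[OF x]]
  using d_u_closed[OF single_closed[OF x]] single_closed[OF CM.d_closed[OF refl x]] d_u_single[OF x]
  by (rule neg_class_eqI)

lemma const_series_linear: "linear_map K (M n) (negative M n) (const_series M n)"
  using linear_map_comp[OF single_linear neg_class_linear] by (simp add: const_series_single[abs_def])

lemma const_series_cocycle: "x \<in> CM.Z n \<Longrightarrow> const_series M n x \<in> CN.Z n"
proof -
  assume "x \<in> CM.Z n"
  then have x: "x \<in> carrier (M n)" "b n x = \<zero>\<^bsub>M (n + 1)\<^esub>" by (simp_all add: CM.Z_iff[OF refl, of x])
  then show ?thesis
    unfolding CN.Z_iff[OF refl] d_negative_const[OF x(1)] x(2)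
      linear_map_zero[OF const_series_linear CM.V.module_axioms negative_is_module]
    using linear_map_closed[OF const_series_linear] by simp
qed

lemma const_series_coboundary:
  assumes z: "z \<in> carrier (M (n - 1))"
  shows "CN.cls n (const_series M n (b (n - 1) z)) = \<zero>\<^bsub>CN.H n\<^esub>"
  using CN.cls_coboundary[OF linear_map_closed[OF const_series_linear z], of n] d_negative_const[OF z]
  by simp

lemma j_map_class: "x \<in> CM.Z n \<Longrightarrow> j_map M b B n (CM.cls n x) = CN.cls n (const_series M n x)"
  unfolding j_map_def
  by (rule coh_map_cls[OF CM.cochain_complex_axioms CN.cochain_complex_axioms const_series_linear
        const_series_cocycle const_series_coboundary])

lemma j_map_linear: "linear_map K (CM.H n) (HC_minus M b B n) (j_map M b B n)"
  unfolding j_map_def HC_minus_def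
  by (rule coh_map_linear[OF CM.cochain_complex_axioms CN.cochain_complex_axioms const_series_linear
        const_series_cocycle const_series_coboundary])

lemma beta_j:
  assumes "Y \<in> carrier (CM.H n)"
  shows "beta_map M b B n (j_map M b B n Y) = coh_map M b (n - 1) (B n) Y"
proof -
  obtain y where y: "y \<in> CM.Z n" "Y = CM.cls n y" using assms by (rule CM.cls_cases)
  have "beta_map M b B n (CN.cls n (neg_class M n (single n y))) = CM.cls (n - 1) (B n (single n y 0))"
    using y const_series_cocycle[OF y(1)] by (intro beta_map_class single_closed) (auto simp: const_series_single)
  then show ?thesis
    using y by (simp add: j_map_class B_coh(1) const_series_single) (simp add: single_def)
qed

text \<open>The primitive of the constant \<open>B f\<^sub>0\<close> is the polar part of \<open>f\<close> divided by \<open>u\<close>.\<close>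

lemma j_beta:
  assumes X: "X \<in> carrier (HC_minus M b B n)" and k: "k = n - 1"
  shows "j_map M b B k (beta_map M b B n X) = \<zero>\<^bsub>HC_minus M b B k\<^esub>"
proof -
  obtain w where w: "w \<in> carrier (periodic M n)" "neg_class M n w \<in> CN.Z n"
    and X: "X = CN.cls n (neg_class M n w)" using X by (rule HC_minus_cases)
  note Bw = B_constant_term_cocycle[OF w k]
  define v where "v = (\<lambda>j. if j < 0 then w (j + 1) else \<zero>\<^bsub>M (k - 1 - 2 * j)\<^esub>)"
  have wj: "w j \<in> carrier (M (n - 2 * j))" for j using w(1) unfolding periodic_simps(1) by blast
  have idx: "k - 1 - 2 * j = n - 2 * (j + 1)" for j by (simp add: k)
  have v: "v \<in> carrier (periodic M (k - 1))"
  proof (unfold periodic_simps(1), intro allI)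
    show "v j \<in> carrier (M (k - 1 - 2 * j))" for j
      using wj[of "j + 1"] unfolding v_def idx by simp
  qed
  have dv: "d_u M b B (k - 1) v \<in> carrier (periodic M k)"
    using d_u_closed[OF v] by simp
  \<comment> \<open>Below 0 the coefficient at \<open>j\<close> is that of \<open>d_u w\<close> at
    \<open>j + 1 \<le> 0\<close>, which vanishes by the cocycle condition. At \<open>j = 0\<close>
    the cut-off \<open>v 0 = 0\<close> removes \<open>b w_1\<close>, about which nothing is known,
    and leaves exactly \<open>B w_0\<close>.\<close>
  have e: "d_u M b B (k - 1) v j = single k (B n (w 0)) j" if "j \<le> 0" for j
  proof (cases "j = 0")
    case True
    have "b (n - 2) \<zero>\<^bsub>M (n - 2)\<^esub> = \<zero>\<^bsub>M (n - 1)\<^esub>" by (rule CM.d_zero) simp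
    moreover have "B n (w 0) \<in> carrier (M (n - 1))" using Bw k by auto
    ultimately show ?thesis using True by (simp add: d_u_apply v_def single_def k)
  next
    case False
    have "d_u M b B n w (j + 1) = \<zero>\<^bsub>M (n + 1 - 2 * (j + 1))\<^esub>"
      using neg_class_in_Z[OF w(1)] w(2) that False by simp
    moreover have "n - 2 * (j + 1) = k - 1 - 2 * j" "n + 1 - 2 * (j + 1) = k - 2 * j" "j + 1 - 1 = j"
      "n - 2 * j = k - 1 - 2 * (j - 1)" "k - 1 + 1 - 2 * j = k - 2 * j" "j - 1 + 1 = j"
      by (auto simp: k)
    moreover have "j < 0" "j - 1 < 0" using that False by simp_all
    ultimately show ?thesis using False
      unfolding d_u_apply v_def single_def by (simp only: if_True if_False)
  qed
  have "CN.cls k (const_series M k (B n (w 0))) = CN.cls k (d_negative M b B (k - 1) (neg_class M (k - 1) v))"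
    unfolding const_series_single d_negative_class[OF v]
    using neg_class_eqI[OF dv single_closed e] Bw by simp
  also have "\<dots> = \<zero>\<^bsub>CN.H k\<^esub>"
    using linear_map_closed[OF neg_class_linear v] by (rule CN.cls_coboundary) simp
  finally show ?thesis
    using Bw by (simp add: X beta_map_class[OF w] k[symmetric] j_map_class HC_minus_def)
qed

end

section \<open>Transport of structure\<close>

lemma linear_map_inv_into:
  assumes f: "linear_map K V W f" and bij: "bij_betw f (carrier V) (carrier W)" and V: "module K V"
  shows "linear_map K W V (inv_into (carrier V) f)"
proof -
  interpret V: module K V by fact
  let ?g = "inv_into (carrier V) f"
  have g: "?g y \<in> carrier V" "f (?g y) = y" if "y \<in> carrier W" for y
    using bij that by (auto simp: bij_betw_def inv_into_into f_inv_into_f)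
  have gf: "?g (f x) = x" if "x \<in> carrier V" for x
    using bij that by (auto simp: bij_betw_def)
  show ?thesis
  proof (rule linear_mapI)
    fix x y c assume x: "x \<in> carrier W"
    show "?g x \<in> carrier V" using g x by blast
    show "?g (x \<oplus>\<^bsub>W\<^esub> y) = ?g x \<oplus>\<^bsub>V\<^esub> ?g y" if y: "y \<in> carrier W"
      using linear_map_add[OF f g(1)[OF x] g(1)[OF y]] gf[of "?g x \<oplus>\<^bsub>V\<^esub> ?g y"] g x y by simp
    show "?g (c \<odot>\<^bsub>W\<^esub> x) = c \<odot>\<^bsub>V\<^esub> ?g x" if c: "c \<in> carrier K"
      using linear_map_smult[OF f c g(1)[OF x]] gf[of "c \<odot>\<^bsub>V\<^esub> ?g x"] g x c by simp
  qed
qed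

text \<open>Serves to carry the structure on the cohomology of \<open>\<gg>\<close> over to that of
  \<open>M\<close>. The maps are inverse to each other only on carriers, so each cancellation needs
  a closure fact.\<close>

locale graded_iso =
  fixes K :: "('k, 'r) ring_scheme" and V :: "int \<Rightarrow> ('k, 'a) module" and W :: "int \<Rightarrow> ('k, 'b) module"
    and \<Phi> :: "int \<Rightarrow> 'a \<Rightarrow> 'b" and \<Psi> :: "int \<Rightarrow> 'b \<Rightarrow> 'a"
  assumes V_space: "graded_space K V" and W_space: "graded_space K W"
    and \<Phi>_linear: "\<And>n. linear_map K (V n) (W n) (\<Phi> n)"
    and \<Psi>_linear: "\<And>n. linear_map K (W n) (V n) (\<Psi> n)"
    and \<Psi>_\<Phi>: "\<And>n x. x \<in> carrier (V n) \<Longrightarrow> \<Psi> n (\<Phi> n x) = x"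
    and \<Phi>_\<Psi>: "\<And>n y. y \<in> carrier (W n) \<Longrightarrow> \<Phi> n (\<Psi> n y) = y"
begin

sublocale V: vector_module K "V n" for n
  using V_space by (simp add: graded_space_def vector_module_def)

sublocale W: vector_module K "W n" for n
  using W_space by (simp add: graded_space_def vector_module_def)

lemmas \<Psi>_closed = linear_map_closed[OF \<Psi>_linear]
  and \<Phi>_add = linear_map_add[OF \<Phi>_linear]
  and \<Phi>_uminus = linear_map_uminus[OF \<Phi>_linear V.module_axioms W.module_axioms]
  and \<Phi>_gsign = linear_map_gsign[OF \<Phi>_linear V.module_axioms W.module_axioms]

text \<open>The equation for \<open>f'\<close> is required for all arguments, also outside the
  carriers. This costs nothing, as the operations on \<open>H(M)\<close> are defined by such a
  formula.\<close>

lemma graded_bilinear_transport: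
  assumes f: "graded_bilinear K V V V d f"
    and f': "\<And>m n x y. f' m n x y = \<Phi> (m + n + d) (f m n (\<Psi> m x) (\<Psi> n y))"
  shows "graded_bilinear K W W W d f'"
  unfolding graded_bilinear_def bilinear_map_def
proof (intro allI conjI ballI)
  fix p q
  note f = f[unfolded graded_bilinear_def bilinear_map_def, rule_format]
  show "linear_map K (W q) (W (p + q + d)) (f' p q x)" if "x \<in> carrier (W p)" for x
    unfolding f'[abs_def]
    by (intro linear_map_comp[OF _ \<Phi>_linear] linear_map_comp[OF \<Psi>_linear]
        conjunct1[OF f, rule_format] \<Psi>_closed that)
  show "linear_map K (W p) (W (p + q + d)) (\<lambda>x. f' p q x y)" if "y \<in> carrier (W q)" for y
    unfolding f'
    by (rule linear_map_comp[OF linear_map_comp[OF \<Psi>_linear] \<Phi>_linear])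
      (intro conjunct2[OF f, rule_format] \<Psi>_closed that)
qed

lemma graded_bilinear_closed:
  "graded_bilinear K V V V d f \<Longrightarrow> x \<in> carrier (V m) \<Longrightarrow> y \<in> carrier (V n) \<Longrightarrow> k = m + n + d \<Longrightarrow>
    f m n x y \<in> carrier (V k)"
  by (rule linear_map_closed[OF bilinear_map_right[OF graded_bilinearD]])

text \<open>In a nested bracket the inner \<open>\<Phi>\<close> meets the outer
  \<open>\<Psi>\<close> and cancels. Each identity in \<open>W\<close> is then \<open>\<Phi>\<close>
  applied to the corresponding identity in \<open>V\<close>.\<close>

lemma graded_lie_transport:
  assumes L: "graded_lie K V d f"
    and f': "\<And>m n x y. f' m n x y = \<Phi> (m + n + d) (f m n (\<Psi> m x) (\<Psi> n y))"
  shows "graded_lie K W d f'"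
  unfolding graded_lie_def
proof (intro conjI allI ballI)
  have bil: "graded_bilinear K V V V d f"
    and anti: "\<And>m n x y. x \<in> carrier (V m) \<Longrightarrow> y \<in> carrier (V n) \<Longrightarrow>
      f m n x y = \<ominus>\<^bsub>V (m + n + d)\<^esub> gsign (V (m + n + d)) (m * n) (f n m y x)"
    and jacobi: "\<And>l m n x y z. x \<in> carrier (V l) \<Longrightarrow> y \<in> carrier (V m) \<Longrightarrow> z \<in> carrier (V n) \<Longrightarrow>
      f l (m + n + d) x (f m n y z) =
        f (l + m + d) n (f l m x y) z \<oplus>\<^bsub>V (l + m + n + 2 * d)\<^esub>
        gsign (V (l + m + n + 2 * d)) (l * m) (f m (l + n + d) y (f l n x z))"
    using L unfolding graded_lie_def by blast+
  note fc = graded_bilinear_closed[OF bil]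
  show "graded_space K W" by (rule W_space)
  show "graded_bilinear K W W W d f'" by (rule graded_bilinear_transport[OF bil f'])
  fix l m n x y z
  assume x: "x \<in> carrier (W m)" and y: "y \<in> carrier (W n)"
  have i: "n + m + d = m + n + d" by simp
  have c: "f n m (\<Psi> n y) (\<Psi> m x) \<in> carrier (V (m + n + d))"
    by (rule fc) (use x y \<Psi>_closed in auto)
  show "f' m n x y = \<ominus>\<^bsub>W (m + n + d)\<^esub> gsign (W (m + n + d)) (m * n) (f' n m y x)"
    unfolding f' i using anti[OF \<Psi>_closed[OF x] \<Psi>_closed[OF y]] c
    by (simp add: \<Phi>_uminus \<Phi>_gsign)
next
  fix l m n x y z
  assume x: "x \<in> carrier (W l)" and y: "y \<in> carrier (W m)" and z: "z \<in> carrier (W n)"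
  have bil: "graded_bilinear K V V V d f"
    and jacobi: "\<And>l m n x y z. x \<in> carrier (V l) \<Longrightarrow> y \<in> carrier (V m) \<Longrightarrow> z \<in> carrier (V n) \<Longrightarrow>
      f l (m + n + d) x (f m n y z) =
        f (l + m + d) n (f l m x y) z \<oplus>\<^bsub>V (l + m + n + 2 * d)\<^esub>
        gsign (V (l + m + n + 2 * d)) (l * m) (f m (l + n + d) y (f l n x z))"
    using L unfolding graded_lie_def by blast+
  note fc = graded_bilinear_closed[OF bil]
  \<comment> \<open>All outer occurrences of \<open>\<Phi>\<close> must carry the same degree term
    before its additivity can be used.\<close>
  have i: "l + (m + n + d) + d = l + m + n + 2 * d" "l + m + d + n + d = l + m + n + 2 * d"
    "m + (l + n + d) + d = l + m + n + 2 * d" by auto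
  note xyz = \<Psi>_closed[OF x] \<Psi>_closed[OF y] \<Psi>_closed[OF z]
  note c1 = fc[OF xyz(2,3) refl] fc[OF xyz(1,2) refl] fc[OF xyz(1,3) refl]
  have c2: "f (l + m + d) n (f l m (\<Psi> l x) (\<Psi> m y)) (\<Psi> n z) \<in> carrier (V (l + m + n + 2 * d))"
    "f m (l + n + d) (\<Psi> m y) (f l n (\<Psi> l x) (\<Psi> n z)) \<in> carrier (V (l + m + n + 2 * d))"
    using fc[OF c1(2) xyz(3) i(2)[symmetric]] fc[OF xyz(2) c1(3) i(3)[symmetric]] .
  show "f' l (m + n + d) x (f' m n y z) =
      f' (l + m + d) n (f' l m x y) z \<oplus>\<^bsub>W (l + m + n + 2 * d)\<^esub>
      gsign (W (l + m + n + 2 * d)) (l * m) (f' m (l + n + d) y (f' l n x z))"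
    unfolding f' i \<Psi>_\<Phi>[OF c1(1)] \<Psi>_\<Phi>[OF c1(2)] \<Psi>_\<Phi>[OF c1(3)] jacobi[OF xyz]
    using c2 by (simp only: \<Phi>_add \<Phi>_gsign V.gsign_closed)
qed

end

lemma graded_iso_shift:
  assumes "graded_iso K V W \<Phi> \<Psi>"
  shows "graded_iso K (shift V k) (shift W k) (shift \<Phi> k) (shift \<Psi> k)"
  using assms by (auto simp: graded_iso_def graded_space_def shift_def)

lemma (in graded_iso) gerstenhaber_transport:
  assumes G: "gerstenhaber_algebra K V cup br"
    and cup': "\<And>m n x y. cup' m n x y = \<Phi> (m + n) (cup m n (\<Psi> m x) (\<Psi> n y))"
    and br': "\<And>m n x y. br' m n x y = \<Phi> (m + n - 1) (br m n (\<Psi> m x) (\<Psi> n y))"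
  shows "gerstenhaber_algebra K W cup' br'"
proof -
  have cup_bil: "graded_bilinear K V V V 0 cup"
    and assoc: "\<And>l m n x y z. x \<in> carrier (V l) \<Longrightarrow> y \<in> carrier (V m) \<Longrightarrow> z \<in> carrier (V n) \<Longrightarrow>
      cup (l + m) n (cup l m x y) z = cup l (m + n) x (cup m n y z)"
    and comm: "\<And>m n x y. x \<in> carrier (V m) \<Longrightarrow> y \<in> carrier (V n) \<Longrightarrow>
      cup m n x y = gsign (V (m + n)) (m * n) (cup n m y x)"
    and br_bil: "graded_bilinear K V V V (-1) br"
    and lie: "graded_lie K (shift V 1) 0 (\<lambda>m n. br (m + 1) (n + 1))"
    and poisson: "\<And>l m n x y z. x \<in> carrier (V l) \<Longrightarrow> y \<in> carrier (V m) \<Longrightarrow> z \<in> carrier (V n) \<Longrightarrow>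
      br l (m + n) x (cup m n y z) =
        cup (l + m - 1) n (br l m x y) z \<oplus>\<^bsub>V (l + m + n - 1)\<^esub>
        gsign (V (l + m + n - 1)) ((l - 1) * m) (cup m (l + n - 1) y (br l n x z))"
    using G unfolding gerstenhaber_algebra_def by blast+
  have cc: "cup m n x y \<in> carrier (V k)" if "x \<in> carrier (V m)" "y \<in> carrier (V n)" "k = m + n" for k m n x y
    using graded_bilinear_closed[OF cup_bil] that by auto
  have bc: "br m n x y \<in> carrier (V k)" if "x \<in> carrier (V m)" "y \<in> carrier (V n)" "k = m + n - 1" for k m n x y
    using graded_bilinear_closed[OF br_bil] that by auto
  show ?thesis
    unfolding gerstenhaber_algebra_def
  proof (intro conjI allI ballI)
    show "graded_space K W" by (rule W_space)
    show "graded_bilinear K W W W 0 cup'" "graded_bilinear K W W W (-1) br'"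
      by (rule graded_bilinear_transport[OF cup_bil] graded_bilinear_transport[OF br_bil];
          simp add: cup' br')+
    \<comment> \<open>The Lie axioms of a Gerstenhaber algebra live on the space shifted by one, so
      they are transported along the shifted isomorphism.\<close>
    interpret S: graded_iso K "shift V 1" "shift W 1" "shift \<Phi> 1" "shift \<Psi> 1"
      by (rule graded_iso_shift) (rule graded_iso_axioms)
    have i: "m + 1 + (n + 1) - 1 = m + n + 0 + (1::int)" for m n by simp
    show "graded_lie K (shift W 1) 0 (\<lambda>m n. br' (m + 1) (n + 1))"
      by (rule S.graded_lie_transport[OF lie]) (simp only: br' shift_def i)
  next
    fix l m n x y z
    assume x: "x \<in> carrier (W l)" and y: "y \<in> carrier (W m)" and z: "z \<in> carrier (W n)"
    note xyz = \<Psi>_closed[OF x] \<Psi>_closed[OF y] \<Psi>_closed[OF z]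
    show "cup' (l + m) n (cup' l m x y) z = cup' l (m + n) x (cup' m n y z)"
      unfolding cup' \<Psi>_\<Phi>[OF cc[OF xyz(1,2) refl]] \<Psi>_\<Phi>[OF cc[OF xyz(2,3) refl]] assoc[OF xyz]
      by (simp only: add.assoc)
    have i: "l + (m + n) - 1 = l + m + n - 1" "l + m - 1 + n = l + m + n - 1"
      "m + (l + n - 1) = l + m + n - 1" by auto
    note c1 = cc[OF xyz(2,3) refl] bc[OF xyz(1,2) refl] bc[OF xyz(1,3) refl]
    note c2 = cc[OF c1(2) xyz(3) i(2)[symmetric]] cc[OF xyz(2) c1(3) i(3)[symmetric]]
    show "br' l (m + n) x (cup' m n y z) =
        cup' (l + m - 1) n (br' l m x y) z \<oplus>\<^bsub>W (l + m + n - 1)\<^esub>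
        gsign (W (l + m + n - 1)) ((l - 1) * m) (cup' m (l + n - 1) y (br' l n x z))"
      unfolding cup' br' \<Psi>_\<Phi>[OF c1(1)] \<Psi>_\<Phi>[OF c1(2)] \<Psi>_\<Phi>[OF c1(3)] i poisson[OF xyz]
      using c2 by (simp only: \<Phi>_add \<Phi>_gsign V.gsign_closed)
  next
    fix m n x y
    assume x: "x \<in> carrier (W m)" and y: "y \<in> carrier (W n)"
    have i: "n + m = m + n" by simp
    show "cup' m n x y = gsign (W (m + n)) (m * n) (cup' n m y x)"
      unfolding cup' i comm[OF \<Psi>_closed[OF x] \<Psi>_closed[OF y]]
      by (rule \<Phi>_gsign) (rule cc[OF \<Psi>_closed[OF y] \<Psi>_closed[OF x] i[symmetric]])
  qed
qed

section \<open>Calculus on cohomology\<close>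

lemma (in mixed_complex) u_extend_closed:
  assumes P: "\<And>i x. x \<in> carrier (M i) \<Longrightarrow> P i x \<in> carrier (M (i + d))"
    and w: "w \<in> carrier (periodic M n)" and k: "k = n + d"
  shows "u_extend P n w \<in> carrier (periodic M k)"
  unfolding periodic_simps(1) u_extend_def
proof
  fix j
  have "n - 2 * j + d = k - 2 * j" by (simp add: k)
  moreover have "P (n - 2 * j) (w j) \<in> carrier (M (n - 2 * j + d))"
    using w unfolding periodic_simps(1) by (intro P) blast
  ultimately show "P (n - 2 * j) (w j) \<in> carrier (M (k - 2 * j))" by (simp only:)
qed

context homotopy_pre_cartan_calculus
begin

sublocale Cg: cochain_complex K \<gg> \<delta>
proof
  show "graded_space K \<gg>" using br_lie by (simp add: graded_lie_def)
qed (use \<delta>_linear \<delta>_square in auto)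

lemma \<iota>_lin: "f \<in> carrier (\<gg> p) \<Longrightarrow> k = p + n + 1 \<Longrightarrow> linear_map K (M n) (M k) (\<iota> p n f)"
  by (rule bilinear_map_right[OF graded_bilinearD[OF \<iota>_bilinear]])

lemma \<iota>_lin_left:
  "x \<in> carrier (M n) \<Longrightarrow> k = p + n + 1 \<Longrightarrow> linear_map K (\<gg> p) (M k) (\<lambda>f. \<iota> p n f x)"
  by (rule bilinear_map_left[OF graded_bilinearD[OF \<iota>_bilinear]])

lemma \<L>_lin: "f \<in> carrier (\<gg> p) \<Longrightarrow> k = p + n \<Longrightarrow> linear_map K (M n) (M k) (\<L> p n f)"
  by (rule bilinear_map_right[OF graded_bilinearD[OF \<L>_bilinear]]) simp_all

lemma \<S>_lin: "f \<in> carrier (\<gg> p) \<Longrightarrow> k = p + n - 1 \<Longrightarrow> linear_map K (M n) (M k) (\<S> p n f)"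
  by (rule bilinear_map_right[OF graded_bilinearD[OF \<S>_bilinear]]) simp_all

lemma \<S>_lin_left:
  "x \<in> carrier (M n) \<Longrightarrow> k = p + n - 1 \<Longrightarrow> linear_map K (\<gg> p) (M k) (\<lambda>f. \<S> p n f x)"
  by (rule bilinear_map_left[OF graded_bilinearD[OF \<S>_bilinear]]) simp_all

lemmas \<iota>_closed = linear_map_closed[OF \<iota>_lin]
  and \<iota>_zero = linear_map_zero[OF \<iota>_lin CM.V.module_axioms CM.V.module_axioms]
  and \<iota>_zero_left = linear_map_zero[OF \<iota>_lin_left Cg.V.module_axioms CM.V.module_axioms]
  and \<L>_closed = linear_map_closed[OF \<L>_lin]
  and \<L>_zero = linear_map_zero[OF \<L>_lin CM.V.module_axioms CM.V.module_axioms]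
  and \<S>_closed = linear_map_closed[OF \<S>_lin]
  and \<S>_zero = linear_map_zero[OF \<S>_lin CM.V.module_axioms CM.V.module_axioms]
  and \<S>_zero_left = linear_map_zero[OF \<S>_lin_left Cg.V.module_axioms CM.V.module_axioms]

lemma ZgD:
  assumes "f \<in> Cg.Z p"
  shows "f \<in> carrier (\<gg> p)" "k = p + 1 \<Longrightarrow> \<delta> p f = \<zero>\<^bsub>\<gg> k\<^esub>"
  using assms Cg.Z_iff[of k p f] by auto

lemma ZMD:
  assumes "x \<in> CM.Z n"
  shows "x \<in> carrier (M n)" "k = n + 1 \<Longrightarrow> b n x = \<zero>\<^bsub>M k\<^esub>"
  using assms CM.Z_iff[of k n x] by auto

text \<open>For a cocycle \<open>f\<close> the term with \<open>\<delta> f\<close> drops out. The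
  cochain \<open>x\<close> is kept arbitrary: a cocycle \<open>x\<close> gives
  \<open>\<iota>_cocycle\<close>, a primitive in its place gives
  \<open>\<iota>_coboundary\<close>.\<close>

lemma b_\<iota>_cocycle:
  assumes f: "f \<in> Cg.Z p" and x: "x \<in> carrier (M n)" and k: "k = p + n + 1"
  shows "b k (\<iota> p n f x) = gsign (M (k + 1)) (p + 1) (\<iota> p (n + 1) f (b n x))"
proof -
  note f' = ZgD[OF f]
  have i: "n + (p + 1) = k" "n + 1 + (p + 1) = k + 1" "n + p + 2 = k + 1" "1 * (p + 1) = p + 1"
    by (auto simp: k)
  have c: "b k (\<iota> p n f x) \<in> carrier (M (k + 1))" "\<iota> p (n + 1) f (b n x) \<in> carrier (M (k + 1))"
    using f' x k by (auto intro!: CM.d_closed \<iota>_closed)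
  have "gcomm M 1 (p + 1) b (\<lambda>i. \<iota> p i f) n x \<oplus>\<^bsub>M (n + p + 2)\<^esub> \<iota> (p + 1) n (\<delta> p f) x = \<zero>\<^bsub>M (n + p + 2)\<^esub>"
    using b_\<iota> f'(1) x by blast
  then have "b k (\<iota> p n f x) \<ominus>\<^bsub>M (k + 1)\<^esub> gsign (M (k + 1)) (p + 1) (\<iota> p (n + 1) f (b n x)) = \<zero>\<^bsub>M (k + 1)\<^esub>"
    unfolding gcomm_def i f'(2)[OF refl] using \<iota>_zero_left[OF x, of "k + 1" "p + 1"] c k by simp
  then show ?thesis by (rule CM.V.minus_zeroD) (use c in simp_all)
qed

lemma \<iota>_cocycle:
  assumes f: "f \<in> Cg.Z p" and x: "x \<in> CM.Z n" and k: "k = p + n + 1"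
  shows "\<iota> p n f x \<in> CM.Z k"
proof -
  have "\<iota> p (n + 1) f \<zero>\<^bsub>M (n + 1)\<^esub> = \<zero>\<^bsub>M (k + 1)\<^esub>"
    using ZgD(1)[OF f] by (rule \<iota>_zero) (simp add: k)
  then have "b k (\<iota> p n f x) = \<zero>\<^bsub>M (k + 1)\<^esub>"
    using b_\<iota>_cocycle[OF f ZMD(1)[OF x] k] ZMD(2)[OF x refl] by (simp add: gsign_def)
  then show ?thesis
    unfolding CM.Z_iff[OF refl] using \<iota>_closed[OF ZgD(1)[OF f] k ZMD(1)[OF x]] by simp
qed

lemma \<iota>_coboundary:
  assumes f: "f \<in> Cg.Z p" and z: "z \<in> carrier (M (n - 1))" and k: "k = p + n + 1"
  shows "CM.cls k (\<iota> p n f (b (n - 1) z)) = \<zero>\<^bsub>CM.H k\<^esub>"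
proof -
  have bz: "b (n - 1) z \<in> CM.Z n" using CM.coboundary_in_Z[OF z, of n] by simp
  have c: "\<iota> p n f (b (n - 1) z) \<in> CM.Z k" by (rule \<iota>_cocycle[OF f bz k])
  have iz: "\<iota> p (n - 1) f z \<in> carrier (M (k - 1))" using ZgD(1)[OF f] z k by (auto intro!: \<iota>_closed)
  have "b (k - 1) (\<iota> p (n - 1) f z) = gsign (M k) (p + 1) (\<iota> p n f (b (n - 1) z))"
    using b_\<iota>_cocycle[OF f z, of "k - 1"] k by simp
  then have "\<iota> p n f (b (n - 1) z) = gsign (M k) (p + 1) (b (k - 1) (\<iota> p (n - 1) f z))"
    using c by simp
  moreover have "b (k - 1) (\<iota> p (n - 1) f z) \<in> CM.Z k"
    using CM.coboundary_in_Z[OF iz, of k] by simp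
  ultimately show ?thesis using CM.cls_coboundary[OF iz refl]
    by (simp add: CM.cls_gsign) (simp add: gsign_def)
qed

lemma \<iota>_coh:
  assumes f: "f \<in> Cg.Z p" and k: "k = p + n + 1"
  shows "x \<in> CM.Z n \<Longrightarrow> coh_map M b k (\<iota> p n f) (CM.cls n x) = CM.cls k (\<iota> p n f x)"
    and "linear_map K (CM.H n) (CM.H k) (coh_map M b k (\<iota> p n f))"
proof -
  note C = CM.cochain_complex_axioms CM.cochain_complex_axioms \<iota>_lin[OF ZgD(1)[OF f] k]
    \<iota>_cocycle[OF f _ k] \<iota>_coboundary[OF f _ k]
  show "linear_map K (CM.H n) (CM.H k) (coh_map M b k (\<iota> p n f))"
    by (rule coh_map_linear[OF C])
  show "coh_map M b k (\<iota> p n f) (CM.cls n x) = CM.cls k (\<iota> p n f x)" if "x \<in> CM.Z n"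
    by (rule coh_map_cls[OF C that])
qed

text \<open>On cohomology \<open>\<L>_f = [B, \<iota>_f]\<close>: for cocycles \<open>f\<close> and
  \<open>x\<close> the term with \<open>\<delta> f\<close> vanishes, and
  \<open>[b, \<S>_f] x\<close> reduces to the boundary \<open>b (\<S>_f x)\<close>.\<close>

lemma \<L>_cocycle:
  assumes f: "f \<in> Cg.Z p" and x: "x \<in> CM.Z n" and k: "k = p + n"
  shows "\<L> p n f x \<in> CM.Z k"
    and "CM.cls k (\<L> p n f x) =
      CM.cls k (B (k + 1) (\<iota> p n f x)) \<ominus>\<^bsub>CM.H k\<^esub>
      gsign (CM.H k) (p + 1) (CM.cls k (\<iota> p (n - 1) f (B n x)))"
proof -
  note f' = ZgD[OF f] and x' = ZMD[OF x]
  have Bi: "B (k + 1) (\<iota> p n f x) \<in> CM.Z k"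
    using \<iota>_cocycle[OF f x, of "k + 1"] k by (intro B_cocycle) auto
  have iB: "\<iota> p (n - 1) f (B n x) \<in> CM.Z k"
    using k by (intro \<iota>_cocycle[OF f B_cocycle[OF x]]) auto
  have Sx: "\<S> p n f x \<in> carrier (M (k - 1))" using f' x' k by (intro \<S>_closed) auto
  have bS: "b (k - 1) (\<S> p n f x) \<in> CM.Z k" using CM.coboundary_in_Z[OF Sx, of k] by simp
  have i: "n + (p + 1) = k + 1" "n + - 1 + (p + 1) = k" "n - 1 + (p + 1) = k" "n + - 1 = n - 1" "n + p = k"
    "n + (p - 1) = k - 1" "n + 1 + (p - 1) = k" "n + 1 + (p - 1) = k" by (auto simp: k)
  have S0: "\<S> p (n + 1) f \<zero>\<^bsub>M (n + 1)\<^esub> = \<zero>\<^bsub>M k\<^esub>" "\<S> (p + 1) n \<zero>\<^bsub>\<gg> (p + 1)\<^esub> x = \<zero>\<^bsub>M k\<^esub>"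
    using f' x' k by (auto intro!: \<S>_zero \<S>_zero_left)
  have s: "gsign (M k) (- 1 * (p + 1)) y = gsign (M k) (p + 1) y" for y by (simp add: gsign_def)
  have "\<L> p n f x =
      gcomm M (-1) (p + 1) B (\<lambda>i. \<iota> p i f) n x
        \<oplus>\<^bsub>M (n + p)\<^esub> gcomm M 1 (p - 1) b (\<lambda>i. \<S> p i f) n x
        \<oplus>\<^bsub>M (n + p)\<^esub> \<S> (p + 1) n (\<delta> p f) x"
    using cartan_homotopy f'(1) x'(1) by blast
  also have "\<dots> = B (k + 1) (\<iota> p n f x) \<ominus>\<^bsub>M k\<^esub> gsign (M k) (p + 1) (\<iota> p (n - 1) f (B n x))
      \<oplus>\<^bsub>M k\<^esub> b (k - 1) (\<S> p n f x)"
    unfolding gcomm_def i s f'(2)[OF refl] x'(2)[OF refl] S0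
    using Bi iB bS by (simp add: gsign_def a_minus_def)
  finally have e: "\<L> p n f x = B (k + 1) (\<iota> p n f x) \<ominus>\<^bsub>M k\<^esub> gsign (M k) (p + 1) (\<iota> p (n - 1) f (B n x))
      \<oplus>\<^bsub>M k\<^esub> b (k - 1) (\<S> p n f x)" .
  show "\<L> p n f x \<in> CM.Z k" unfolding e using Bi iB bS by simp
  show "CM.cls k (\<L> p n f x) =
      CM.cls k (B (k + 1) (\<iota> p n f x)) \<ominus>\<^bsub>CM.H k\<^esub>
      gsign (CM.H k) (p + 1) (CM.cls k (\<iota> p (n - 1) f (B n x)))"
    unfolding e using Bi iB bS CM.cls_coboundary[OF Sx refl]
    by (simp add: CM.cls_add CM.cls_minus CM.cls_gsign)
qed

lemma u_contraction_closed:
  assumes f: "f \<in> carrier (\<gg> p)" and w: "w \<in> carrier (periodic M n)" and k: "k = n + p + 1"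
  shows "u_contraction M \<iota> \<S> p f n w \<in> carrier (periodic M k)"
proof -
  have "u_extend (\<lambda>i. \<iota> p i f) n w \<in> carrier (periodic M k)"
    by (rule u_extend_closed[where d = "p + 1", OF _ w]) (auto intro: \<iota>_closed[OF f] simp: k)
  moreover have "u_extend (\<lambda>i. \<S> p i f) n w \<in> carrier (periodic M (k - 2))"
    by (rule u_extend_closed[where d = "p - 1", OF _ w]) (auto intro: \<S>_closed[OF f] simp: k)
  then have "u_times (u_extend (\<lambda>i. \<S> p i f) n w) \<in> carrier (periodic M k)"
    unfolding periodic_simps(1) u_times_def
    by (intro allI) (drule_tac x = "j - 1" in spec, simp)
  ultimately show ?thesis unfolding u_contraction_def k by simp
qed

text \<open>The part \<open>u \<S>_f\<close> reaches the coefficient at 0 only from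
  \<open>w (-1)\<close>.\<close>

lemma u_contraction_0:
  assumes f: "f \<in> carrier (\<gg> p)" and w: "w \<in> carrier (periodic M n)" and w1: "w (-1) = \<zero>\<^bsub>M (n + 2)\<^esub>"
  shows "u_contraction M \<iota> \<S> p f n w 0 = \<iota> p n f (w 0)"
proof -
  have w0: "w 0 \<in> carrier (M n)" using w[unfolded periodic_simps(1), rule_format, of 0] by simp
  have "\<S> p (n + 2) f \<zero>\<^bsub>M (n + 2)\<^esub> = \<zero>\<^bsub>M (n + p + 1)\<^esub>" using f by (rule \<S>_zero) simp
  moreover have "\<iota> p n f (w 0) \<in> carrier (M (n + p + 1))" using f w0 by (intro \<iota>_closed) auto
  ultimately show ?thesis using w1
    by (simp add: u_contraction_def periodic_simps u_extend_def u_times_def)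
qed

end

section \<open>The homotopy formula in the coefficient of \<open>u^0\<close>\<close>

context homotopy_cartan_calculus
begin

lemma br_cocycle:
  assumes f: "f \<in> Cg.Z p" and h: "h \<in> Cg.Z q"
  shows "br p q f h \<in> Cg.Z (p + q)"
proof -
  have bil: "graded_bilinear K \<gg> \<gg> \<gg> 0 br" using br_lie by (simp add: graded_lie_def)
  have c: "br p q f h \<in> carrier (\<gg> (p + q))"
    using f h by (intro linear_map_closed[OF bilinear_map_right[OF graded_bilinearD[OF bil]]]) auto
  have "br (p + 1) q \<zero>\<^bsub>\<gg> (p + 1)\<^esub> h = \<zero>\<^bsub>\<gg> (p + q + 1)\<^esub>"
    using h by (intro linear_map_zero[OF bilinear_map_left[OF graded_bilinearD[OF bil]]
          Cg.V.module_axioms Cg.V.module_axioms]) auto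
  moreover have "br p (q + 1) f \<zero>\<^bsub>\<gg> (q + 1)\<^esub> = \<zero>\<^bsub>\<gg> (p + q + 1)\<^esub>"
    using f by (intro linear_map_zero[OF bilinear_map_right[OF graded_bilinearD[OF bil]]
          Cg.V.module_axioms Cg.V.module_axioms]) auto
  ultimately have "\<delta> (p + q) (br p q f h) = \<zero>\<^bsub>\<gg> (p + q + 1)\<^esub>"
    using \<delta>_br ZgD(1)[OF f] ZgD(1)[OF h] ZgD(2)[OF f refl] ZgD(2)[OF h refl]
    by (simp add: gsign_def)
  then show ?thesis unfolding Cg.Z_iff[OF refl] using c by simp
qed

lemma \<T>_trilinearD:
  "k = p + q + n \<Longrightarrow> trilinear_map K (\<gg> p) (\<gg> q) (M n) (M k) (\<T> p q n)"
  using \<T>_trilinear unfolding graded_trilinear_def by simp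

lemma \<T>_lin:
  assumes "f \<in> carrier (\<gg> p)" "h \<in> carrier (\<gg> q)" "k = p + q + n"
  shows "linear_map K (M n) (M k) (\<T> p q n f h)"
  using \<T>_trilinearD[OF assms(3)] assms by (simp add: trilinear_map_def bilinear_map_def)

lemmas \<T>_closed = linear_map_closed[OF \<T>_lin]
  and \<T>_zero = linear_map_zero[OF \<T>_lin CM.V.module_axioms CM.V.module_axioms]

lemma \<T>_zero_left:
  assumes "h \<in> carrier (\<gg> q)" "x \<in> carrier (M n)" "k = p + q + n"
  shows "\<T> p q n \<zero>\<^bsub>\<gg> p\<^esub> h x = \<zero>\<^bsub>M k\<^esub>"
proof -
  have "linear_map K (\<gg> p) (M k) (\<lambda>f. \<T> p q n f h x)"
    using \<T>_trilinearD[OF assms(3)] assms by (simp add: trilinear_map_def)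
  then show ?thesis by (rule linear_map_zero[OF _ Cg.V.module_axioms CM.V.module_axioms])
qed

lemma \<T>_zero_middle:
  assumes "f \<in> carrier (\<gg> p)" "x \<in> carrier (M n)" "k = p + q + n"
  shows "\<T> p q n f \<zero>\<^bsub>\<gg> q\<^esub> x = \<zero>\<^bsub>M k\<^esub>"
proof -
  have "linear_map K (\<gg> q) (M k) (\<lambda>h. \<T> p q n f h x)"
    using \<T>_trilinearD[OF assms(3)] assms by (simp add: trilinear_map_def bilinear_map_def)
  then show ?thesis by (rule linear_map_zero[OF _ Cg.V.module_axioms CM.V.module_axioms])
qed

text \<open>The axiom is applied to the constant series \<open>x\<close> and read at
  \<open>u^0\<close>. Every factor \<open>u\<close> pulls in a coefficient at -1, which is zero for
  a constant series and stays zero under \<open>\<L>_h\<close> and \<open>\<T>\<close>, so only the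
  parts without \<open>u\<close> remain. The terms with \<open>\<delta> f\<close> and
  \<open>\<delta> h\<close> vanish for cocycles.\<close>

lemma \<T>_homotopy_cocycles:
  assumes f: "f \<in> Cg.Z p" and h: "h \<in> Cg.Z q" and x: "x \<in> CM.Z n" and k: "k = n + p + q + 1"
  shows "\<iota> p (n + q) f (\<L> q n h x)
      \<ominus>\<^bsub>M k\<^esub> gsign (M k) ((p + 1) * q) (\<L> q (n + p + 1) h (\<iota> p n f x))
      \<ominus>\<^bsub>M k\<^esub> \<iota> (p + q) n (br p q f h) x = b (k - 1) (\<T> p q n f h x)"
proof -
  note f' = ZgD(1)[OF f] and h' = ZgD(1)[OF h] and x' = ZMD(1)[OF x]
  note brc = ZgD(1)[OF br_cocycle[OF f h]]
  define w where "w = single n x"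
  have w: "w \<in> carrier (periodic M n)" unfolding w_def using x' by (rule single_closed)
  have w0: "w 0 = x" and w1: "w (-1) = \<zero>\<^bsub>M (n + 2)\<^esub>" by (simp_all add: w_def single_def)
  have ext: "u_extend P n w 0 = P n x" for P by (simp add: u_extend_def w0)
  have Lw: "u_extend (\<lambda>i. \<L> q i h) n w \<in> carrier (periodic M (n + q))"
    by (rule u_extend_closed[OF _ w refl]) (auto intro: \<L>_closed[OF h'])
  have "\<L> q (n + 2) h \<zero>\<^bsub>M (n + 2)\<^esub> = \<zero>\<^bsub>M (n + q + 2)\<^esub>" using h' by (rule \<L>_zero) simp
  then have Lw1: "u_extend (\<lambda>i. \<L> q i h) n w (-1) = \<zero>\<^bsub>M (n + q + 2)\<^esub>"
    using w1 by (simp add: u_extend_def)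
  have Iw: "u_contraction M \<iota> \<S> p f n w \<in> carrier (periodic M (n + (p + 1)))"
    by (rule u_contraction_closed[OF f' w]) simp
  have LIw: "u_extend (\<lambda>i. \<L> q i h) (n + (p + 1)) (u_contraction M \<iota> \<S> p f n w) \<in> carrier (periodic M k)"
    by (rule u_extend_closed[OF _ Iw, where d = q]) (auto intro: \<L>_closed[OF h'] simp: k)
  have brw: "u_contraction M \<iota> \<S> (p + q) (br p q f h) n w \<in> carrier (periodic M k)"
    by (rule u_contraction_closed[OF brc w]) (simp add: k)
  have Tw: "u_extend (\<lambda>i. \<T> p q i f h) n w \<in> carrier (periodic M (n + (p + q)))"
    by (rule u_extend_closed[OF _ w refl]) (auto intro: \<T>_closed[OF f' h'])
  have "\<T> p q (n + 2) f h \<zero>\<^bsub>M (n + 2)\<^esub> = \<zero>\<^bsub>M (n + (p + q) + 2)\<^esub>" using f' h' by (rule \<T>_zero) simp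
  then have Tw1: "u_extend (\<lambda>i. \<T> p q i f h) n w (-1) = \<zero>\<^bsub>M (n + (p + q) + 2)\<^esub>"
    using w1 by (simp add: u_extend_def)
  have dw: "d_u M b B n w \<in> carrier (periodic M (n + 1))" by (rule d_u_closed[OF w])
  \<comment> \<open>At \<open>u^0\<close> the series \<open>d_u w\<close> has only
    \<open>b x = 0\<close>, while \<open>B x\<close> sits at \<open>u^1\<close>. This removes the
    term in which \<open>\<T>\<close> is applied after \<open>d_u\<close>.\<close>
  have dw0: "d_u M b B n w 0 = \<zero>\<^bsub>M (n + 1)\<^esub>"
    using d_u_single[OF x', of 0] ZMD(2)[OF x refl] by (simp add: w_def single_def)
  have Tdw: "u_extend (\<lambda>i. \<T> p q i f h) (n + 1) (d_u M b B n w) \<in> carrier (periodic M k)"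
    by (rule u_extend_closed[OF _ dw, where d = "p + q"]) (auto intro: \<T>_closed[OF f' h'] simp: k)
  have "\<T> p q (n + 1) f h \<zero>\<^bsub>M (n + 1)\<^esub> = \<zero>\<^bsub>M k\<^esub>" using f' h' by (rule \<T>_zero) (simp add: k)
  then have Tdw0: "u_extend (\<lambda>i. \<T> p q i f h) (n + 1) (d_u M b B n w) 0 = \<zero>\<^bsub>M k\<^esub>"
    using dw0 by (simp add: u_extend_def)
  have Tdf: "u_extend (\<lambda>i. \<T> (p + 1) q i (\<delta> p f) h) n w \<in> carrier (periodic M k)"
    using f' h' by (intro u_extend_closed[OF _ w, where d = "p + 1 + q"])
      (auto intro!: \<T>_closed Cg.d_closed simp: k)
  have Tdf0: "u_extend (\<lambda>i. \<T> (p + 1) q i (\<delta> p f) h) n w 0 = \<zero>\<^bsub>M k\<^esub>"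
    unfolding ext ZgD(2)[OF f refl] using h' x' by (rule \<T>_zero_left) (simp add: k)
  have Tdh: "u_extend (\<lambda>i. \<T> p (q + 1) i f (\<delta> q h)) n w \<in> carrier (periodic M k)"
    using f' h' by (intro u_extend_closed[OF _ w, where d = "p + (q + 1)"])
      (auto intro!: \<T>_closed Cg.d_closed simp: k)
  have Tdh0: "u_extend (\<lambda>i. \<T> p (q + 1) i f (\<delta> q h)) n w 0 = \<zero>\<^bsub>M k\<^esub>"
    unfolding ext ZgD(2)[OF h refl] using f' x' by (rule \<T>_zero_middle) (simp add: k)
  have i: "n + p + q + 1 = k" "n + (p + 1) + q = k" "n + 1 + (p + q) = k" "k - 2 * 0 = k"
    "n + (p + q) = k - 1" "n + p + 1 = n + (p + 1)"
    by (auto simp: k)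
  have ILw: "u_contraction M \<iota> \<S> p f (n + q) (u_extend (\<lambda>i. \<L> q i h) n w) \<in> carrier (periodic M k)"
    by (rule u_contraction_closed[OF f' Lw]) (simp add: k)
  have dTw: "d_u M b B (k - 1) (u_extend (\<lambda>i. \<T> p q i f h) n w) \<in> carrier (periodic M k)"
    using d_u_closed[OF Tw] by (simp add: i)
  have Tx: "\<T> p q n f h x \<in> carrier (M (k - 1))" using f' h' x' by (intro \<T>_closed) (auto simp: k)
  have "B (k + 1) \<zero>\<^bsub>M (k + 1)\<^esub> = \<zero>\<^bsub>M k\<^esub>" by (rule B_zero) simp
  moreover have "b (k - 1) (\<T> p q n f h x) \<in> carrier (M k)" using Tx by (intro CM.d_closed) auto
  moreover have "k - 1 + 2 = k + 1" by simp
  ultimately have dTw0: "d_u M b B (k - 1) (u_extend (\<lambda>i. \<T> p q i f h) n w) 0 = b (k - 1) (\<T> p q n f h x)"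
    using Tw1 unfolding d_u_apply i by (simp add: ext add.commute)
  have E: "(gcomm (periodic M) (p + 1) q
             (u_contraction M \<iota> \<S> p f) (u_extend (\<lambda>i. \<L> q i h)) n w
           \<ominus>\<^bsub>periodic M (n + p + q + 1)\<^esub> u_contraction M \<iota> \<S> (p + q) (br p q f h) n w) 0 =
         (gcomm (periodic M) 1 (p + q) (d_u M b B) (u_extend (\<lambda>i. \<T> p q i f h)) n w
           \<ominus>\<^bsub>periodic M (n + p + q + 1)\<^esub> u_extend (\<lambda>i. \<T> (p + 1) q i (\<delta> p f) h) n w
           \<ominus>\<^bsub>periodic M (n + p + q + 1)\<^esub>
             gsign (periodic M (n + p + q + 1)) p
               (u_extend (\<lambda>i. \<T> p (q + 1) i f (\<delta> q h)) n w)) 0"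
    using \<T>_homotopy f' h' w by metis
  have zero: "\<ominus>\<^bsub>M k\<^esub> \<zero>\<^bsub>M k\<^esub> = \<zero>\<^bsub>M k\<^esub>" by simp
  have gz: "gsign (M k) m \<zero>\<^bsub>M k\<^esub> = \<zero>\<^bsub>M k\<^esub>" for m by (simp add: gsign_def)
  have rz: "y \<ominus>\<^bsub>M k\<^esub> \<zero>\<^bsub>M k\<^esub> = y" if "y \<in> carrier (M k)" for y
    using that by (simp add: a_minus_def)
  have L: "(gcomm (periodic M) (p + 1) q
             (u_contraction M \<iota> \<S> p f) (u_extend (\<lambda>i. \<L> q i h)) n w
           \<ominus>\<^bsub>periodic M k\<^esub> u_contraction M \<iota> \<S> (p + q) (br p q f h) n w) 0 =
      \<iota> p (n + q) f (\<L> q n h x)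
      \<ominus>\<^bsub>M k\<^esub> gsign (M k) ((p + 1) * q) (\<L> q (n + p + 1) h (\<iota> p n f x))
      \<ominus>\<^bsub>M k\<^esub> \<iota> (p + q) n (br p q f h) x"
    unfolding gcomm_def i
    using ILw LIw brw u_contraction_0[OF f' Lw Lw1] u_contraction_0[OF brc w w1]
      u_contraction_0[OF f' w w1] ext
    by (simp add: periodic_minus periodic_gsign w0) (simp add: u_extend_def)
  have R: "(gcomm (periodic M) 1 (p + q) (d_u M b B) (u_extend (\<lambda>i. \<T> p q i f h)) n w
           \<ominus>\<^bsub>periodic M k\<^esub> u_extend (\<lambda>i. \<T> (p + 1) q i (\<delta> p f) h) n w
           \<ominus>\<^bsub>periodic M k\<^esub>
             gsign (periodic M k) p
               (u_extend (\<lambda>i. \<T> p (q + 1) i f (\<delta> q h)) n w)) 0 = b (k - 1) (\<T> p q n f h x)"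
    unfolding gcomm_def i
    using dTw Tdw Tdf Tdh Tdw0 Tdf0 Tdh0 dTw0 gz rz Tx CM.d_closed[OF _ Tx, of k]
    by (simp add: periodic_minus periodic_gsign)
  show ?thesis using E unfolding i(1) L R .
qed

text \<open>The chain-level formula has a boundary on its right side and three cocycles on its left,
  so it becomes an equation of classes.\<close>

lemma \<iota>_br_class:
  assumes f: "f \<in> Cg.Z p" and h: "h \<in> Cg.Z q" and x: "x \<in> CM.Z n" and k: "k = n + p + q + 1"
  shows "CM.cls k (\<iota> (p + q) n (br p q f h) x) =
    CM.cls k (\<iota> p (n + q) f (\<L> q n h x)) \<ominus>\<^bsub>CM.H k\<^esub>
    gsign (CM.H k) ((p + 1) * q) (CM.cls k (\<L> q (n + p + 1) h (\<iota> p n f x)))"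
proof -
  have c1: "\<iota> (p + q) n (br p q f h) x \<in> CM.Z k"
    by (rule \<iota>_cocycle[OF br_cocycle[OF f h] x]) (simp add: k)
  have c2: "\<iota> p (n + q) f (\<L> q n h x) \<in> CM.Z k"
    by (rule \<iota>_cocycle[OF f \<L>_cocycle(1)[OF h x]]) (simp_all add: k)
  have c3: "\<L> q (n + p + 1) h (\<iota> p n f x) \<in> CM.Z k"
    by (rule \<L>_cocycle(1)[OF h \<iota>_cocycle[OF f x]]) (simp_all add: k)
  have T: "\<T> p q n f h x \<in> carrier (M (k - 1))"
    using ZgD(1)[OF f] ZgD(1)[OF h] ZMD(1)[OF x] by (intro \<T>_closed) (auto simp: k)
  have "CM.cls k (\<iota> p (n + q) f (\<L> q n h x)
      \<ominus>\<^bsub>M k\<^esub> gsign (M k) ((p + 1) * q) (\<L> q (n + p + 1) h (\<iota> p n f x))) =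
      CM.cls k (\<iota> (p + q) n (br p q f h) x)"
    by (rule CM.cls_cong[OF _ c1 \<T>_homotopy_cocycles[OF f h x k] T refl]) (use c2 c3 in simp)
  then show ?thesis using c2 c3 by (simp add: CM.cls_minus CM.cls_gsign)
qed

end

section \<open>Duality\<close>

context homotopy_cartan_gerstenhaber_calculus
begin

text \<open>Arguments of \<open>cup m n\<close> have degrees \<open>m - 1\<close> and
  \<open>n - 1\<close> in \<open>\<gg>\<close>. As the product has degree 0 on the shifted space,
  its value has degree \<open>m + n - 1\<close> in \<open>\<gg>\<close>, one more than the
  sum.\<close>

lemma cup_map: "k = m + n - 1 \<Longrightarrow> bilinear_map K (\<gg> (m - 1)) (\<gg> (n - 1)) (\<gg> k) (cup m n)"
  using graded_bilinearD[OF cup_bilinear, of "m + n" m n] by (simp add: shift_def)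

lemmas cup_closed = linear_map_closed[OF bilinear_map_right[OF cup_map]]
  and cup_zero_left = linear_map_zero[OF bilinear_map_left[OF cup_map] Cg.V.module_axioms Cg.V.module_axioms]
  and cup_zero_right = linear_map_zero[OF bilinear_map_right[OF cup_map] Cg.V.module_axioms Cg.V.module_axioms]

lemma cup_cocycle:
  assumes f: "f \<in> Cg.Z (m - 1)" and h: "h \<in> Cg.Z (n - 1)"
  shows "cup m n f h \<in> Cg.Z (m + n - 1)"
proof -
  have "cup (m + 1) n \<zero>\<^bsub>\<gg> m\<^esub> h = \<zero>\<^bsub>\<gg> (m + n)\<^esub>"
    using cup_zero_left[of "m + n" "m + 1" n h] ZgD(1)[OF h] by simp
  moreover have "cup m (n + 1) f \<zero>\<^bsub>\<gg> n\<^esub> = \<zero>\<^bsub>\<gg> (m + n)\<^esub>"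
    using cup_zero_right[of "m + n" m "n + 1" f] ZgD(1)[OF f] by simp
  ultimately have "\<delta> (m + n - 1) (cup m n f h) = \<zero>\<^bsub>\<gg> (m + n)\<^esub>"
    using \<delta>_cup ZgD(1)[OF f] ZgD(1)[OF h] ZgD(2)[OF f, of m] ZgD(2)[OF h, of n]
    by (simp add: gsign_def)
  then show ?thesis
    using cup_closed[OF refl ZgD(1)[OF f] ZgD(1)[OF h]] Cg.Z_iff[of "m + n" "m + n - 1"] by simp
qed

lemma cup_coboundary_left:
  assumes z: "z \<in> carrier (\<gg> (m - 2))" and h: "h \<in> Cg.Z (n - 1)"
  shows "Cg.cls (m + n - 1) (cup m n (\<delta> (m - 2) z) h) = \<zero>\<^bsub>Cg.H (m + n - 1)\<^esub>"
proof -
  have dz: "\<delta> (m - 2) z \<in> carrier (\<gg> (m - 1))" using z by (intro Cg.d_closed) auto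
  have c: "cup m n (\<delta> (m - 2) z) h \<in> carrier (\<gg> (m + n - 1))"
    using cup_closed[OF refl dz ZgD(1)[OF h]] .
  have zh: "cup (m - 1) n z h \<in> carrier (\<gg> (m + n - 2))"
    using cup_closed[of "m + n - 2" "m - 1" n z h] z ZgD(1)[OF h] by simp
  have "cup (m - 1) (n + 1) z \<zero>\<^bsub>\<gg> n\<^esub> = \<zero>\<^bsub>\<gg> (m + n - 1)\<^esub>"
    using cup_zero_right[of "m + n - 1" "m - 1" "n + 1" z] z by simp
  then have "\<delta> (m + n - 2) (cup (m - 1) n z h) = cup m n (\<delta> (m - 2) z) h"
    using \<delta>_cup[rule_format, of z "m - 1" h n] z ZgD(1)[OF h] ZgD(2)[OF h, of n] c
    by (simp add: gsign_def diff_add_eq)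
  then show ?thesis
    using Cg.cls_coboundary[OF zh, of "m + n - 1"] by simp
qed

text \<open>Here \<open>\<delta>\<close> has to pass \<open>f\<close>, so the boundary of the
  product of \<open>f\<close> and \<open>z\<close> is the desired element up to the sign
  \<open>(-1)^m\<close>; a class vanishes once its signed version does.\<close>

lemma cup_coboundary_right:
  assumes f: "f \<in> Cg.Z (m - 1)" and z: "z \<in> carrier (\<gg> (n - 2))"
  shows "Cg.cls (m + n - 1) (cup m n f (\<delta> (n - 2) z)) = \<zero>\<^bsub>Cg.H (m + n - 1)\<^esub>"
proof -
  have dz: "\<delta> (n - 2) z \<in> Cg.Z (n - 1)" using z by (intro Cg.coboundary_in_Z) auto
  have c: "cup m n f (\<delta> (n - 2) z) \<in> Cg.Z (m + n - 1)"
    by (rule cup_cocycle[OF f dz])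
  have fz: "cup m (n - 1) f z \<in> carrier (\<gg> (m + n - 2))"
    using cup_closed[of "m + n - 2" m "n - 1" f z] z ZgD(1)[OF f] by simp
  have "cup (m + 1) (n - 1) \<zero>\<^bsub>\<gg> m\<^esub> z = \<zero>\<^bsub>\<gg> (m + n - 1)\<^esub>"
    using cup_zero_left[of "m + n - 1" "m + 1" "n - 1" z] z by simp
  then have "\<delta> (m + n - 2) (cup m (n - 1) f z) = gsign (\<gg> (m + n - 1)) m (cup m n f (\<delta> (n - 2) z))"
    using \<delta>_cup[rule_format, of f m z "n - 1"] z ZgD(1)[OF f] ZgD(2)[OF f, of m] c
    by (simp add: add_diff_eq)
  moreover have "Cg.cls (m + n - 1) (\<delta> (m + n - 2) (cup m (n - 1) f z)) = \<zero>\<^bsub>Cg.H (m + n - 1)\<^esub>"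
    using Cg.cls_coboundary[OF fz, of "m + n - 1"] by simp
  ultimately have "gsign (Cg.H (m + n - 1)) m (Cg.cls (m + n - 1) (cup m n f (\<delta> (n - 2) z))) =
      \<zero>\<^bsub>Cg.H (m + n - 1)\<^esub>"
    using c by (simp add: Cg.cls_gsign)
  then show ?thesis using Cg.cls_closed[OF c] by (rule Cg.H.gsign_zeroD)
qed

lemma coh_G_cup_class:
  assumes f: "f \<in> Cg.Z (m - 1)" and h: "h \<in> Cg.Z (n - 1)"
  shows "coh_G_cup \<gg> \<delta> cup m n (Cg.cls (m - 1) f) (Cg.cls (n - 1) h) =
    Cg.cls (m + n - 1) (cup m n f h)"
proof -
  have i: "m - 1 - 1 = m - 2" "n - 1 - 1 = n - 2" by auto
  have "coh_map2 \<gg> \<delta> (m + n - 1) (cup m n) (Cg.cls (m - 1) f) (Cg.cls (n - 1) h) =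
      Cg.cls (m + n - 1) (cup m n f h)"
    by (rule coh_map2_cls[OF Cg.cochain_complex_axioms Cg.cochain_complex_axioms
          Cg.cochain_complex_axioms cup_map[OF refl] cup_cocycle _ _ f h];
        simp only: i cup_coboundary_left cup_coboundary_right)
  then show ?thesis by (simp add: coh_G_cup_def coh_map2_def cohomology_shift)
qed

lemma br_map: "k = p + q \<Longrightarrow> bilinear_map K (\<gg> p) (\<gg> q) (\<gg> k) (br p q)"
  using br_lie graded_bilinearD[of K \<gg> \<gg> \<gg> 0 br k p q] by (simp add: graded_lie_def)

lemmas br_closed = linear_map_closed[OF bilinear_map_right[OF br_map]]
  and br_zero_left = linear_map_zero[OF bilinear_map_left[OF br_map] Cg.V.module_axioms Cg.V.module_axioms]
  and br_zero_right = linear_map_zero[OF bilinear_map_right[OF br_map] Cg.V.module_axioms Cg.V.module_axioms]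

lemma br_coboundary_left:
  assumes z: "z \<in> carrier (\<gg> (p - 1))" and h: "h \<in> Cg.Z q"
  shows "Cg.cls (p + q) (br p q (\<delta> (p - 1) z) h) = \<zero>\<^bsub>Cg.H (p + q)\<^esub>"
proof -
  have dz: "\<delta> (p - 1) z \<in> carrier (\<gg> p)" using z by (intro Cg.d_closed) auto
  have c: "br p q (\<delta> (p - 1) z) h \<in> carrier (\<gg> (p + q))"
    using br_closed[OF refl dz ZgD(1)[OF h]] .
  have zh: "br (p - 1) q z h \<in> carrier (\<gg> (p + q - 1))"
    using br_closed[of "p + q - 1" "p - 1" q z h] z ZgD(1)[OF h] by simp
  have "br (p - 1) (q + 1) z \<zero>\<^bsub>\<gg> (q + 1)\<^esub> = \<zero>\<^bsub>\<gg> (p + q)\<^esub>"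
    using br_zero_right[of "p + q" "p - 1" "q + 1" z] z by simp
  then have "\<delta> (p + q - 1) (br (p - 1) q z h) = br p q (\<delta> (p - 1) z) h"
    using \<delta>_br[rule_format, of z "p - 1" h q] z ZgD(1)[OF h] ZgD(2)[OF h, of "q + 1"] c
    by (simp add: gsign_def diff_add_eq)
  then show ?thesis
    using Cg.cls_coboundary[OF zh, of "p + q"] by simp
qed

lemma br_coboundary_right:
  assumes f: "f \<in> Cg.Z p" and z: "z \<in> carrier (\<gg> (q - 1))"
  shows "Cg.cls (p + q) (br p q f (\<delta> (q - 1) z)) = \<zero>\<^bsub>Cg.H (p + q)\<^esub>"
proof -
  have dz: "\<delta> (q - 1) z \<in> Cg.Z q" using z by (intro Cg.coboundary_in_Z) auto
  have c: "br p q f (\<delta> (q - 1) z) \<in> Cg.Z (p + q)"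
    by (rule br_cocycle[OF f dz])
  have fz: "br p (q - 1) f z \<in> carrier (\<gg> (p + q - 1))"
    using br_closed[of "p + q - 1" p "q - 1" f z] z ZgD(1)[OF f] by simp
  have "br (p + 1) (q - 1) \<zero>\<^bsub>\<gg> (p + 1)\<^esub> z = \<zero>\<^bsub>\<gg> (p + q)\<^esub>"
    using br_zero_left[of "p + q" "p + 1" "q - 1" z] z by simp
  then have "\<delta> (p + q - 1) (br p (q - 1) f z) = gsign (\<gg> (p + q)) p (br p q f (\<delta> (q - 1) z))"
    using \<delta>_br[rule_format, of f p z "q - 1"] z ZgD(1)[OF f] ZgD(2)[OF f, of "p + 1"] c
    by (simp add: add_diff_eq)
  moreover have "Cg.cls (p + q) (\<delta> (p + q - 1) (br p (q - 1) f z)) = \<zero>\<^bsub>Cg.H (p + q)\<^esub>"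
    using Cg.cls_coboundary[OF fz, of "p + q"] by simp
  ultimately have "gsign (Cg.H (p + q)) p (Cg.cls (p + q) (br p q f (\<delta> (q - 1) z))) =
      \<zero>\<^bsub>Cg.H (p + q)\<^esub>"
    using c by (simp add: Cg.cls_gsign)
  then show ?thesis using Cg.cls_closed[OF c] by (rule Cg.H.gsign_zeroD)
qed

lemma coh_G_br_class:
  assumes f: "f \<in> Cg.Z (m - 1)" and h: "h \<in> Cg.Z (n - 1)"
  shows "coh_G_br \<gg> \<delta> br m n (Cg.cls (m - 1) f) (Cg.cls (n - 1) h) =
    Cg.cls (m + n - 2) (br (m - 1) (n - 1) f h)"
proof -
  have i: "m + n - 2 = (m - 1) + (n - 1)" by simp
  have "coh_map2 \<gg> \<delta> ((m - 1) + (n - 1)) (br (m - 1) (n - 1)) (Cg.cls (m - 1) f) (Cg.cls (n - 1) h) =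
      Cg.cls ((m - 1) + (n - 1)) (br (m - 1) (n - 1) f h)"
    by (rule coh_map2_cls[OF Cg.cochain_complex_axioms Cg.cochain_complex_axioms
          Cg.cochain_complex_axioms br_map[OF refl] br_cocycle br_coboundary_left br_coboundary_right f h])
  then show ?thesis by (simp add: coh_G_br_def coh_map2_def cohomology_shift)
qed

text \<open>Since \<open>e\<close> is idempotent of even degree, \<open>\<delta> e = \<delta> e + \<delta> e\<close>.\<close>

lemma unit_cocycle: "e \<in> Cg.Z (-1)"
proof -
  have de: "\<delta> (-1) e \<in> carrier (\<gg> 0)" using unit_closed by (intro Cg.d_closed) auto
  have "\<delta> (-1) e = cup 1 0 (\<delta> (-1) e) e \<oplus>\<^bsub>\<gg> 0\<^esub> cup 0 1 e (\<delta> (-1) e)"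
    using \<delta>_cup[rule_format, of e 0 e 0] unit_closed cup_unit[rule_format, of e 0] by simp
  also have "\<dots> = \<delta> (-1) e \<oplus>\<^bsub>\<gg> 0\<^esub> \<delta> (-1) e"
    using cup_unit[rule_format, of "\<delta> (-1) e" 1] de by simp
  finally have "\<delta> (-1) e = \<zero>\<^bsub>\<gg> 0\<^esub>" using de Cg.V.M.add.l_cancel_one' by metis
  then show ?thesis using unit_closed Cg.Z_iff[of 0 "-1" e] by simp
qed

end

section \<open>The duality isomorphism and the operations it transports\<close>

locale palladio_calculus =
  homotopy_cartan_gerstenhaber_calculus K M b B \<gg> \<delta> br \<iota> \<L> \<S> \<T> cup e
  for K :: "('k, 'r) ring_scheme"
    and M :: "int \<Rightarrow> ('k, 'm) module"
    and b B :: "int \<Rightarrow> 'm \<Rightarrow> 'm"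
    and \<gg> :: "int \<Rightarrow> ('k, 'g) module"
    and \<delta> :: "int \<Rightarrow> 'g \<Rightarrow> 'g"
    and br :: "int \<Rightarrow> int \<Rightarrow> 'g \<Rightarrow> 'g \<Rightarrow> 'g"
    and \<iota> \<L> \<S> :: "int \<Rightarrow> int \<Rightarrow> 'g \<Rightarrow> 'm \<Rightarrow> 'm"
    and \<T> :: "int \<Rightarrow> int \<Rightarrow> int \<Rightarrow> 'g \<Rightarrow> 'g \<Rightarrow> 'm \<Rightarrow> 'm"
    and cup :: "int \<Rightarrow> int \<Rightarrow> 'g \<Rightarrow> 'g \<Rightarrow> 'g"
    and e :: 'g +
  fixes \<zeta> :: 'm
  assumes palladio: "palladio_cocycle K M b B \<gg> \<delta> \<iota> \<zeta>"
    and gerstenhaber_G: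
      "gerstenhaber_algebra K (coh_G \<gg> \<delta>) (coh_G_cup \<gg> \<delta> cup) (coh_G_br \<gg> \<delta> br)"
begin

abbreviation "pal \<equiv> palladio_map M \<iota> \<zeta>"
abbreviation "pz \<equiv> p_zeta M b \<iota> \<zeta>"
abbreviation "pz' \<equiv> p_zeta_inv M b \<gg> \<delta> \<iota> \<zeta>"
abbreviation "cupM \<equiv> coh_M_cup M b \<gg> \<delta> \<iota> \<zeta> cup"
abbreviation "brM \<equiv> coh_M_br M b \<gg> \<delta> \<iota> \<zeta> br"
abbreviation "BM \<equiv> coh_M_B M b B"
abbreviation "eM \<equiv> coh_M_unit M b \<gg> \<delta> \<iota> \<zeta> e"

lemma \<zeta>_cocycle: "\<zeta> \<in> CM.Z (-1)"
  using palladio CM.Z_iff[of 0 "-1" \<zeta>] by (simp add: palladio_cocycle_def)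

lemma B_\<zeta>:
  obtains \<eta> where "\<eta> \<in> carrier (M (-3))" "B (-1) \<zeta> = b (-3) \<eta>"
  using palladio by (auto simp: palladio_cocycle_def)

lemma pal_linear: "linear_map K (\<gg> n) (M n) (pal n)"
  and pal_chain: "f \<in> carrier (\<gg> n) \<Longrightarrow> pal (n + 1) (\<delta> n f) = b n (pal n f)"
  and pz_bij: "bij_betw (pz n) (carrier (Cg.H n)) (carrier (CM.H n))"
  using palladio by (auto simp: palladio_cocycle_def quasi_isomorphism_def graded_linear_def p_zeta_def[abs_def])

lemmas pal_closed = linear_map_closed[OF pal_linear]

lemma pal_cocycle:
  assumes "f \<in> Cg.Z n"
  shows "pal n f \<in> CM.Z n"
proof -
  have "b n (pal n f) = \<zero>\<^bsub>M (n + 1)\<^esub>"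
    using pal_chain[OF ZgD(1)[OF assms]] ZgD(2)[OF assms refl]
      linear_map_zero[OF pal_linear Cg.V.module_axioms CM.V.module_axioms, of "n + 1"] by simp
  then show ?thesis
    unfolding CM.Z_iff[OF refl] using pal_closed[OF ZgD(1)[OF assms]] by simp
qed

lemma pal_coboundary:
  assumes "z \<in> carrier (\<gg> (n - 1))"
  shows "CM.cls n (pal n (\<delta> (n - 1) z)) = \<zero>\<^bsub>CM.H n\<^esub>"
proof -
  have "pal n (\<delta> (n - 1) z) = b (n - 1) (pal (n - 1) z)"
    using pal_chain[OF assms] by (simp only: diff_add_cancel)
  then show ?thesis
    by (simp only:) (rule CM.cls_coboundary[OF pal_closed[OF assms] refl])
qed

lemma pz_class: "f \<in> Cg.Z n \<Longrightarrow> pz n (Cg.cls n f) = CM.cls n (pal n f)"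
  unfolding p_zeta_def
  by (rule coh_map_cls[OF Cg.cochain_complex_axioms CM.cochain_complex_axioms pal_linear
        pal_cocycle pal_coboundary])

lemma pz_linear: "linear_map K (Cg.H n) (CM.H n) (pz n)"
  unfolding p_zeta_def
  by (rule coh_map_linear[OF Cg.cochain_complex_axioms CM.cochain_complex_axioms pal_linear
        pal_cocycle pal_coboundary])

lemma pz'_linear: "linear_map K (CM.H n) (Cg.H n) (pz' n)"
  unfolding p_zeta_inv_def by (rule linear_map_inv_into[OF pz_linear pz_bij Cg.H.module_axioms])

lemma pz'_pz: "X \<in> carrier (Cg.H n) \<Longrightarrow> pz' n (pz n X) = X"
  and pz_pz': "Y \<in> carrier (CM.H n) \<Longrightarrow> pz n (pz' n Y) = Y"
  using pz_bij[of n] by (auto simp: p_zeta_inv_def bij_betw_def f_inv_into_f)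

lemma pz'_class: "f \<in> Cg.Z n \<Longrightarrow> pz' n (CM.cls n (pal n f)) = Cg.cls n f"
  using pz'_pz[of "Cg.cls n f" n] by (simp add: pz_class)

lemma coh_G_eq: "coh_G \<gg> \<delta> n = Cg.H (n - 1)"
  by (simp add: coh_G_def cohomology_shift)

text \<open>Surjectivity of \<open>p_zeta\<close>: each class of \<open>M\<close> is represented by
  some \<open>f\<close> in \<open>\<gg>\<close> contracted with \<open>\<zeta>\<close>, up to sign.
  This turns products in \<open>H(M)\<close> into compositions of contractions.\<close>

lemma pal_cases:
  assumes "Y \<in> carrier (CM.H n)"
  obtains f where "f \<in> Cg.Z n" "Y = CM.cls n (pal n f)"
proof -
  obtain X where X: "X \<in> carrier (Cg.H n)" "Y = pz n X"
    using assms pz_bij[of n] by (auto simp: bij_betw_def)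
  obtain f where "f \<in> Cg.Z n" "X = Cg.cls n f" using X(1) by (rule Cg.cls_cases)
  then show ?thesis using X(2) pz_class that by simp
qed

lemma cupM_class:
  assumes "f \<in> Cg.Z (m - 1)" "h \<in> Cg.Z (n - 1)"
  shows "cupM m n (CM.cls (m - 1) (pal (m - 1) f)) (CM.cls (n - 1) (pal (n - 1) h)) =
    CM.cls (m + n - 1) (pal (m + n - 1) (cup m n f h))"
  using assms cup_cocycle[OF assms] by (simp add: coh_M_cup_def pz'_class coh_G_cup_class pz_class)

lemma brM_class:
  assumes "f \<in> Cg.Z (m - 1)" "h \<in> Cg.Z (n - 1)"
  shows "brM m n (CM.cls (m - 1) (pal (m - 1) f)) (CM.cls (n - 1) (pal (n - 1) h)) =
    CM.cls (m + n - 2) (pal (m + n - 2) (br (m - 1) (n - 1) f h))"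
  using assms br_cocycle[OF assms] by (simp add: coh_M_br_def pz'_class coh_G_br_class pz_class)

sublocale G_iso: graded_iso K "coh_G \<gg> \<delta>" "shift (cohomology M b) (-1)" "shift pz (-1)" "shift pz' (-1)"
proof
  have K: "field K" using M_graded_space by (simp add: graded_space_def)
  then show "graded_space K (coh_G \<gg> \<delta>)" "graded_space K (shift (cohomology M b) (-1))"
    using Cg.H.module_axioms CM.H.module_axioms by (simp_all add: graded_space_def coh_G_eq shift_def)
qed (auto simp: coh_G_eq shift_def pz_linear pz'_linear pz'_pz pz_pz')

lemma gerstenhaber_M: "gerstenhaber_algebra K (shift (cohomology M b) (-1)) cupM brM"
proof (rule G_iso.gerstenhaber_transport[OF gerstenhaber_G])
  fix m n x y
  show "cupM m n x y = shift pz (-1) (m + n) (coh_G_cup \<gg> \<delta> cup m n (shift pz' (-1) m x) (shift pz' (-1) n y))"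
    by (simp add: coh_M_cup_def shift_def)
  have "m + n - 1 + - 1 = m + n - 2" by simp
  then show "brM m n x y = shift pz (-1) (m + n - 1) (coh_G_br \<gg> \<delta> br m n (shift pz' (-1) m x) (shift pz' (-1) n y))"
    by (simp add: coh_M_br_def shift_def)
qed

lemma HM_eq: "shift (cohomology M b) (-1) n = CM.H (n - 1)"
  by (simp add: shift_def)

lemma cupM_bilinear: "k = m + n - 1 \<Longrightarrow> bilinear_map K (CM.H (m - 1)) (CM.H (n - 1)) (CM.H k) (cupM m n)"
proof -
  assume k: "k = m + n - 1"
  have "graded_bilinear K (shift (cohomology M b) (-1)) (shift (cohomology M b) (-1))
      (shift (cohomology M b) (-1)) 0 cupM"
    using gerstenhaber_M unfolding gerstenhaber_algebra_def by blast
  from graded_bilinearD[OF this, of "m + n" m n] show ?thesis by (simp add: HM_eq k)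
qed

lemmas cupM_closed = linear_map_closed[OF bilinear_map_right[OF cupM_bilinear]]

lemma cupM_comm:
  assumes "X \<in> carrier (CM.H (m - 1))" "Y \<in> carrier (CM.H (n - 1))" "k = m + n - 1"
  shows "cupM m n X Y = gsign (CM.H k) (m * n) (cupM n m Y X)"
proof -
  have "\<forall>m n. \<forall>x\<in>carrier (shift (cohomology M b) (-1) m). \<forall>y\<in>carrier (shift (cohomology M b) (-1) n).
      cupM m n x y = gsign (shift (cohomology M b) (-1) (m + n)) (m * n) (cupM n m y x)"
    using gerstenhaber_M unfolding gerstenhaber_algebra_def by blast
  then show ?thesis using assms unfolding HM_eq by blast
qed

text \<open>Both sides are \<open>\<iota>_f \<iota>_h \<zeta>\<close> up to sign, where
  \<open>h\<close> represents \<open>Y\<close>. Dualising the product contributes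
  \<open>(-1)^k\<close> and dualising \<open>h\<close> contributes \<open>(-1)^(n - 1)\<close>; with
  \<open>k = m + n - 1\<close> the quotient is \<open>(-1)^m\<close>.\<close>

lemma \<iota>_eq_cupM:
  assumes f: "f \<in> Cg.Z (m - 1)" and Y: "Y \<in> carrier (CM.H (n - 1))" and k: "k = m + n - 1"
  shows "coh_map M b k (\<iota> (m - 1) (n - 1) f) Y =
    gsign (CM.H k) m (cupM m n (CM.cls (m - 1) (pal (m - 1) f)) Y)"
proof -
  obtain h where h: "h \<in> Cg.Z (n - 1)" "Y = CM.cls (n - 1) (pal (n - 1) h)"
    using Y by (rule pal_cases)
  have k': "k = m - 1 + (n - 1) + 1" by (simp add: k)
  define x where "x = \<iota> (n - 1) (-1) h \<zeta>"
  have x: "x \<in> CM.Z (n - 1)" unfolding x_def by (rule \<iota>_cocycle[OF h(1) \<zeta>_cocycle]) simp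
  have fx: "\<iota> (m - 1) (n - 1) f x \<in> CM.Z k" by (rule \<iota>_cocycle[OF f x k'])
  have "\<iota> k (-1) (cup m n f h) \<zeta> = \<iota> (m - 1) (n - 1) f x"
    using \<iota>_cup[rule_format, of f m h n \<zeta> "-1"] ZgD(1)[OF f] ZgD(1)[OF h(1)] ZMD(1)[OF \<zeta>_cocycle]
    by (simp add: x_def k)
  then have 1: "pal k (cup m n f h) = gsign (M k) k (\<iota> (m - 1) (n - 1) f x)"
    by (simp add: palladio_map_def)
  have "\<iota> (m - 1) (n - 1) f (pal (n - 1) h) = gsign (M k) (n - 1) (\<iota> (m - 1) (n - 1) f x)"
    using linear_map_gsign[OF \<iota>_lin[OF ZgD(1)[OF f] k'] CM.V.module_axioms CM.V.module_axioms, of x "n - 1"] x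
    by (simp add: palladio_map_def x_def)
  then have 2: "coh_map M b k (\<iota> (m - 1) (n - 1) f) Y =
      gsign (CM.H k) (n - 1) (CM.cls k (\<iota> (m - 1) (n - 1) f x))"
    unfolding h(2) \<iota>_coh(1)[OF f k' pal_cocycle[OF h(1)]] using fx by (simp add: CM.cls_gsign)
  have "cupM m n (CM.cls (m - 1) (pal (m - 1) f)) Y =
      gsign (CM.H k) k (CM.cls k (\<iota> (m - 1) (n - 1) f x))"
    using cupM_class[OF f h(1)] 1 fx by (simp add: h(2) k[symmetric] CM.cls_gsign)
  then show ?thesis unfolding 2 using CM.cls_closed[OF fx]
    by (simp only: CM.H.gsign_gsign) (simp add: gsign_def k)
qed

lemma BM_linear: "k = n - 2 \<Longrightarrow> linear_map K (CM.H (n - 1)) (CM.H k) (BM n)"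
  unfolding coh_M_B_def using B_coh(2)[of "n - 2" "n - 1"] by simp

lemma BM_class: "x \<in> CM.Z (n - 1) \<Longrightarrow> k = n - 2 \<Longrightarrow> BM n (CM.cls (n - 1) x) = CM.cls k (B (n - 1) x)"
  unfolding coh_M_B_def using B_coh(1)[of "n - 2" "n - 1" x] by simp

lemmas BM_closed = linear_map_closed[OF BM_linear]
  and BM_gsign = linear_map_gsign[OF BM_linear CM.H.module_axioms CM.H.module_axioms]

lemma BM_BM:
  assumes "X \<in> carrier (CM.H (n - 1))"
  shows "BM (n - 1) (BM n X) = \<zero>\<^bsub>CM.H (n - 3)\<^esub>"
proof -
  obtain x where x: "x \<in> CM.Z (n - 1)" "X = CM.cls (n - 1) x" using assms by (rule CM.cls_cases)
  have "B (n - 1) x \<in> CM.Z (n - 2)" using x(1) by (rule B_cocycle) simp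
  then show ?thesis
    using x BM_class[of x n "n - 2"] BM_class[of "B (n - 1) x" "n - 1" "n - 3"]
      B_B[of x "n - 1" "n - 2" "n - 3"] by (simp add: CM.cls_zero)
qed

text \<open>The minus sign arises because the unit has degree -1 in \<open>\<gg>\<close>, the degree
  that enters the sign of \<open>palladio_map\<close>.\<close>

lemma cls_pal_unit: "eM = CM.cls (-1) (\<ominus>\<^bsub>M (-1)\<^esub> \<zeta>)"
  using \<iota>_unit[rule_format, of \<zeta> "-1"] ZMD(1)[OF \<zeta>_cocycle] pz_class[OF unit_cocycle]
  by (simp add: coh_M_unit_def palladio_map_def)

text \<open>This is condition (ii) on \<open>\<zeta>\<close>: the unit is represented by
  \<open>- \<zeta>\<close>, and \<open>B \<zeta>\<close> is exact.\<close>

lemma BM_unit: "BM 0 eM = \<zero>\<^bsub>CM.H (-2)\<^esub>"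
proof -
  obtain \<eta> where \<eta>: "\<eta> \<in> carrier (M (-3))" "B (-1) \<zeta> = b (-3) \<eta>" by (rule B_\<zeta>)
  have "b (-3) \<eta> \<in> CM.Z (-2)" using \<eta>(1) by (rule CM.coboundary_in_Z) simp
  moreover have "CM.cls (-2) (b (-3) \<eta>) = \<zero>\<^bsub>CM.H (-2)\<^esub>"
    using \<eta>(1) by (rule CM.cls_coboundary) simp
  moreover have "B (-1) (\<ominus>\<^bsub>M (-1)\<^esub> \<zeta>) = \<ominus>\<^bsub>M (-2)\<^esub> b (-3) \<eta>"
    using \<eta>(2) ZMD(1)[OF \<zeta>_cocycle] B_uminus[of "-2" "-1" \<zeta>] by simp
  ultimately show ?thesis
    using BM_class[of "\<ominus>\<^bsub>M (-1)\<^esub> \<zeta>" 0 "-2"] \<zeta>_cocycle by (simp add: cls_pal_unit CM.cls_uminus)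
qed

lemma unit_closed_M: "eM \<in> carrier (CM.H (-1))"
  unfolding cls_pal_unit using \<zeta>_cocycle by simp

lemma cupM_unit:
  assumes X: "X \<in> carrier (CM.H (n - 1))"
  shows "cupM 0 n eM X = X" "cupM n 0 X eM = X"
proof -
  obtain f where f: "f \<in> Cg.Z (n - 1)" "X = CM.cls (n - 1) (pal (n - 1) f)" using X by (rule pal_cases)
  have u: "eM = CM.cls (0 - 1) (pal (0 - 1) e)" and e: "e \<in> Cg.Z (0 - 1)"
    using pz_class[OF unit_cocycle] unit_cocycle by (simp_all add: coh_M_unit_def)
  show "cupM 0 n eM X = X" "cupM n 0 X eM = X"
    using cupM_class[OF e f(1)] cupM_class[OF f(1) e] cup_unit[rule_format, of f n] ZgD(1)[OF f(1)]
    by (simp_all add: u f(2))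
qed

end

section \<open>The Batalin-Vilkoviskii identity\<close>

lemma (in vector_module) bv_signs:
  assumes c: "L \<in> carrier V" "P \<in> carrier V" "Q \<in> carrier V" "R \<in> carrier V"
    and "gsign V (m + n - 2) L = gsign V (n - 1 + m) P \<ominus>\<^bsub>V\<^esub>
      gsign V (m * (n - 1)) (gsign V (n + (m - 1) + m * n) Q \<ominus>\<^bsub>V\<^esub>
        gsign V n (gsign V (n + (m - 1) + n * (m - 1)) R))"
  shows "L = gsign V m Q \<ominus>\<^bsub>V\<^esub> gsign V m R \<ominus>\<^bsub>V\<^esub> P"
proof -
  \<comment> \<open>Here \<open>L\<close> stands for \<open>{X, Y}\<close>, \<open>P\<close> for
    \<open>X cup B Y\<close>, \<open>Q\<close> for \<open>B (X cup Y)\<close> and \<open>R\<close>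
    for \<open>B X cup Y\<close>. The exponents are left as the commutations produce them, and the
    claim is a check over the parities of \<open>m\<close> and \<open>n\<close>.\<close>
  have "L = gsign V (m + n - 2) (gsign V (m + n - 2) L)"
    using c by (simp add: gsign_def)
  then have "L = gsign V (m + n - 2) (gsign V (n - 1 + m) P \<ominus>\<^bsub>V\<^esub>
      gsign V (m * (n - 1)) (gsign V (n + (m - 1) + m * n) Q \<ominus>\<^bsub>V\<^esub>
        gsign V n (gsign V (n + (m - 1) + n * (m - 1)) R)))"
    using assms(5) by simp
  also have "\<dots> = gsign V m Q \<ominus>\<^bsub>V\<^esub> gsign V m R \<ominus>\<^bsub>V\<^esub> P"
    by (cases "even m"; cases "even n")
      (use c in \<open>simp_all add: a_minus_def M.minus_add M.a_ac\<close>)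
  finally show ?thesis .
qed

context palladio_calculus
begin

lemma \<iota>_\<zeta>_class:
  assumes f: "f \<in> Cg.Z p"
  shows "\<iota> p (-1) f \<zeta> \<in> CM.Z p" "CM.cls p (\<iota> p (-1) f \<zeta>) = gsign (CM.H p) p (CM.cls p (pal p f))"
proof -
  show *: "\<iota> p (-1) f \<zeta> \<in> CM.Z p" by (rule \<iota>_cocycle[OF f \<zeta>_cocycle]) simp
  show "CM.cls p (\<iota> p (-1) f \<zeta>) = gsign (CM.H p) p (CM.cls p (pal p f))"
    using * by (simp add: palladio_map_def CM.cls_uminus gsign_def)
qed

text \<open>The term with \<open>B \<zeta>\<close> vanishes because \<open>B \<zeta>\<close> is exact.\<close>

lemma \<L>_\<zeta>_class:
  assumes h: "h \<in> Cg.Z (n - 1)"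
  shows "CM.cls (n - 2) (\<L> (n - 1) (-1) h \<zeta>) =
    gsign (CM.H (n - 2)) (n - 1) (BM n (CM.cls (n - 1) (pal (n - 1) h)))"
proof -
  obtain \<eta> where \<eta>: "\<eta> \<in> carrier (M (-3))" "B (-1) \<zeta> = b (-3) \<eta>" by (rule B_\<zeta>)
  note x = \<iota>_\<zeta>_class[OF h]
  have k: "n - 2 = n - 1 + - 1" by simp
  have Bx: "B (n - 1) (\<iota> (n - 1) (-1) h \<zeta>) \<in> CM.Z (n - 2)" using x(1) by (rule B_cocycle) simp
  have 0: "CM.cls (n - 2) (\<iota> (n - 1) (-2) h (b (-3) \<eta>)) = \<zero>\<^bsub>CM.H (n - 2)\<^esub>"
    using \<iota>_coboundary[OF h, of \<eta> "-2" "n - 2"] \<eta>(1) by simp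
  have "CM.cls (n - 2) (\<L> (n - 1) (-1) h \<zeta>) = CM.cls (n - 2) (B (n - 1) (\<iota> (n - 1) (-1) h \<zeta>))"
    using \<L>_cocycle(2)[OF h \<zeta>_cocycle k] 0 \<eta>(2) CM.cls_closed[OF Bx]
    by (simp add: gsign_def a_minus_def)
  also have "\<dots> = BM n (CM.cls (n - 1) (\<iota> (n - 1) (-1) h \<zeta>))"
    using BM_class[OF x(1) refl] by simp
  also have "\<dots> = gsign (CM.H (n - 2)) (n - 1) (BM n (CM.cls (n - 1) (pal (n - 1) h)))"
    unfolding x(2) using CM.cls_closed[OF pal_cocycle[OF h]] by (rule BM_gsign[OF refl])
  finally show ?thesis .
qed

text \<open>Expanding \<open>\<L>_h\<close> as \<open>[B, \<iota>_h]\<close> gives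
  \<open>B \<iota>_h \<iota>_f \<zeta>\<close> and \<open>\<iota>_h B \<iota>_f \<zeta>\<close>.
  Contraction by \<open>h\<close> multiplies by \<open>Y\<close> from the left, so graded
  commutativity is needed to restore the order \<open>X\<close>, \<open>Y\<close>; this is the
  origin of the exponents \<open>m * n\<close> and \<open>n * (m - 1)\<close>.\<close>

lemma \<L>_\<iota>_\<zeta>_class:
  assumes f: "f \<in> Cg.Z (m - 1)" and h: "h \<in> Cg.Z (n - 1)" and k: "k = m + n - 2"
  defines "X \<equiv> CM.cls (m - 1) (pal (m - 1) f)" and "Y \<equiv> CM.cls (n - 1) (pal (n - 1) h)"
  shows "CM.cls k (\<L> (n - 1) (m - 1) h (\<iota> (m - 1) (-1) f \<zeta>)) =
    gsign (CM.H k) (n + (m - 1) + m * n) (BM (m + n) (cupM m n X Y)) \<ominus>\<^bsub>CM.H k\<^esub>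
    gsign (CM.H k) n (gsign (CM.H k) (n + (m - 1) + n * (m - 1)) (cupM (m - 1) n (BM m X) Y))"
proof -
  have X: "X \<in> carrier (CM.H (m - 1))" and Y: "Y \<in> carrier (CM.H (n - 1))"
    unfolding X_def Y_def using pal_cocycle f h by blast+
  define x where "x = \<iota> (m - 1) (-1) f \<zeta>"
  have x: "x \<in> CM.Z (m - 1)" "CM.cls (m - 1) x = gsign (CM.H (m - 1)) (m - 1) X"
    unfolding x_def X_def by (rule \<iota>_\<zeta>_class[OF f])+
  have hx: "\<iota> (n - 1) (m - 1) h x \<in> CM.Z (m + n - 1)"
    by (rule \<iota>_cocycle[OF h x(1)]) simp
  have Bx: "B (m - 1) x \<in> CM.Z (m - 2)" using x(1) by (rule B_cocycle) simp
  have XY: "cupM m n X Y \<in> carrier (CM.H (m + n - 1))" by (rule cupM_closed[OF refl X Y])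
  have YX: "cupM n m Y X = gsign (CM.H (m + n - 1)) (m * n) (cupM m n X Y)"
    using cupM_comm[OF Y X, of "m + n - 1"] by (simp add: mult.commute)
  have BX: "BM m X \<in> carrier (CM.H (m - 1 - 1))" using BM_closed[OF refl X] by simp
  have BXY: "cupM (m - 1) n (BM m X) Y \<in> carrier (CM.H k)"
    by (rule cupM_closed[OF _ BX Y]) (simp add: k)
  have YBX: "cupM n (m - 1) Y (BM m X) = gsign (CM.H k) (n * (m - 1)) (cupM (m - 1) n (BM m X) Y)"
    by (rule cupM_comm[OF Y BX]) (simp add: k)
  have i: "m - 1 - 1 = m - 2" by simp
  have "CM.cls (m + n - 1) (\<iota> (n - 1) (m - 1) h x) =
      coh_map M b (m + n - 1) (\<iota> (n - 1) (m - 1) h) (gsign (CM.H (m - 1)) (m - 1) X)"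
    unfolding x(2)[symmetric] by (rule \<iota>_coh(1)[OF h _ x(1), symmetric]) simp
  also have "\<dots> = gsign (CM.H (m + n - 1)) n (cupM n m Y (gsign (CM.H (m - 1)) (m - 1) X))"
    unfolding Y_def using X by (intro \<iota>_eq_cupM[OF h]) auto
  also have "cupM n m Y (gsign (CM.H (m - 1)) (m - 1) X) = gsign (CM.H (m + n - 1)) (m - 1) (cupM n m Y X)"
    using X by (intro linear_map_gsign[OF bilinear_map_right[OF cupM_bilinear Y]
          CM.H.module_axioms CM.H.module_axioms]) auto
  finally have "CM.cls (m + n - 1) (\<iota> (n - 1) (m - 1) h x) =
      gsign (CM.H (m + n - 1)) (n + (m - 1) + m * n) (cupM m n X Y)"
    using XY by (simp add: YX add.assoc)
  then have 1: "CM.cls k (B (k + 1) (\<iota> (n - 1) (m - 1) h x)) =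
      gsign (CM.H k) (n + (m - 1) + m * n) (BM (m + n) (cupM m n X Y))"
    using BM_class[OF hx, of k] BM_gsign[OF _ XY, of k] by (simp add: k)
  have "CM.cls k (\<iota> (n - 1) (m - 2) h (B (m - 1) x)) =
      coh_map M b k (\<iota> (n - 1) (m - 2) h) (CM.cls (m - 2) (B (m - 1) x))"
    by (rule \<iota>_coh(1)[OF h _ Bx, symmetric]) (simp add: k)
  also have "CM.cls (m - 2) (B (m - 1) x) = gsign (CM.H (m - 2)) (m - 1) (BM m X)"
    unfolding BM_class[OF x(1) refl, symmetric] x(2) by (rule BM_gsign[OF refl X])
  also have "coh_map M b k (\<iota> (n - 1) (m - 2) h) (gsign (CM.H (m - 2)) (m - 1) (BM m X)) =
      gsign (CM.H k) n (cupM n (m - 1) Y (gsign (CM.H (m - 2)) (m - 1) (BM m X)))"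
    unfolding Y_def i[symmetric] using BX by (intro \<iota>_eq_cupM[OF h]) (auto simp: k)
  also have "cupM n (m - 1) Y (gsign (CM.H (m - 2)) (m - 1) (BM m X)) =
      gsign (CM.H k) (m - 1) (cupM n (m - 1) Y (BM m X))"
    unfolding i[symmetric] using BX
    by (intro linear_map_gsign[OF bilinear_map_right[OF cupM_bilinear Y]
          CM.H.module_axioms CM.H.module_axioms]) (auto simp: k)
  finally have 2: "CM.cls k (\<iota> (n - 1) (m - 2) h (B (m - 1) x)) =
      gsign (CM.H k) (n + (m - 1) + n * (m - 1)) (cupM (m - 1) n (BM m X) Y)"
    using BXY by (simp add: YBX add.assoc)
  have k': "k = n - 1 + (m - 1)" by (simp add: k)
  show ?thesis
    using \<L>_cocycle(2)[OF h x(1) k'] unfolding i 1 2 x_def[symmetric] by simp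
qed

text \<open>In \<open>\<iota>_br_class\<close> at \<open>\<zeta>\<close>, the term
  \<open>\<iota>_f \<L>_h \<zeta>\<close> yields \<open>X cup B Y\<close>, and
  \<open>\<L>_h \<iota>_f \<zeta>\<close> yields the other two terms. The left side is the bracket
  up to \<open>(-1)^k\<close>.\<close>

lemma bv_identity:
  assumes X: "X \<in> carrier (CM.H (m - 1))" and Y: "Y \<in> carrier (CM.H (n - 1))" and k: "k = m + n - 2"
  shows "brM m n X Y =
    gsign (CM.H k) m (BM (m + n) (cupM m n X Y))
      \<ominus>\<^bsub>CM.H k\<^esub> gsign (CM.H k) m (cupM (m - 1) n (BM m X) Y)
      \<ominus>\<^bsub>CM.H k\<^esub> cupM m (n - 1) X (BM n Y)"
proof -
  obtain f where f: "f \<in> Cg.Z (m - 1)" and Xf: "X = CM.cls (m - 1) (pal (m - 1) f)"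
    using X by (rule pal_cases)
  obtain h where h: "h \<in> Cg.Z (n - 1)" and Yh: "Y = CM.cls (n - 1) (pal (n - 1) h)"
    using Y by (rule pal_cases)
  have fh: "br (m - 1) (n - 1) f h \<in> Cg.Z k" using br_cocycle[OF f h] by (simp add: k)
  have BX: "BM m X \<in> carrier (CM.H (m - 1 - 1))" using BM_closed[OF refl X] by simp
  have BY: "BM n Y \<in> carrier (CM.H (n - 1 - 1))" using BM_closed[OF refl Y] by simp
  have L: "brM m n X Y = CM.cls k (pal k (br (m - 1) (n - 1) f h))"
    using brM_class[OF f h] by (simp add: Xf Yh k)
  have P: "cupM m (n - 1) X (BM n Y) \<in> carrier (CM.H k)"
    by (rule cupM_closed[OF _ X BY]) (simp add: k)
  have Q: "BM (m + n) (cupM m n X Y) \<in> carrier (CM.H k)"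
    using cupM_closed[OF refl X Y] by (intro BM_closed) (auto simp: k)
  have R: "cupM (m - 1) n (BM m X) Y \<in> carrier (CM.H k)"
    by (rule cupM_closed[OF _ BX Y]) (simp add: k)
  have i: "n - 1 - 1 = n - 2" "-1 + (n - 1) = n - 2" "-1 + (m - 1) + 1 = m - 1"
    "m - 1 + (n - 1) = k" "m - 1 + 1 = m" by (auto simp: k)
  have Lz: "\<L> (n - 1) (-1) h \<zeta> \<in> CM.Z (n - 2)" by (rule \<L>_cocycle(1)[OF h \<zeta>_cocycle]) simp
  have "CM.cls k (\<iota> (m - 1) (n - 2) f (\<L> (n - 1) (-1) h \<zeta>)) =
      coh_map M b k (\<iota> (m - 1) (n - 2) f) (gsign (CM.H (n - 2)) (n - 1) (BM n Y))"
    unfolding Yh \<L>_\<zeta>_class[OF h, symmetric] by (rule \<iota>_coh(1)[OF f _ Lz, symmetric]) (simp add: k)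
  also have "\<dots> = gsign (CM.H k) m (cupM m (n - 1) X (gsign (CM.H (n - 2)) (n - 1) (BM n Y)))"
    unfolding Xf i(1)[symmetric] using BY by (intro \<iota>_eq_cupM[OF f]) (auto simp: k)
  also have "cupM m (n - 1) X (gsign (CM.H (n - 2)) (n - 1) (BM n Y)) =
      gsign (CM.H k) (n - 1) (cupM m (n - 1) X (BM n Y))"
    unfolding i(1)[symmetric] using BY
    by (intro linear_map_gsign[OF bilinear_map_right[OF cupM_bilinear X]
          CM.H.module_axioms CM.H.module_axioms]) (auto simp: k)
  finally have 1: "CM.cls k (\<iota> (m - 1) (n - 2) f (\<L> (n - 1) (-1) h \<zeta>)) =
      gsign (CM.H k) (n - 1 + m) (cupM m (n - 1) X (BM n Y))"
    using P by (simp add: add.commute)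
  have "gsign (CM.H k) k (brM m n X Y) = CM.cls k (\<iota> k (-1) (br (m - 1) (n - 1) f h) \<zeta>)"
    unfolding L by (rule \<iota>_\<zeta>_class(2)[OF fh, symmetric])
  also have "\<dots> = CM.cls k (\<iota> (m - 1) (n - 2) f (\<L> (n - 1) (-1) h \<zeta>)) \<ominus>\<^bsub>CM.H k\<^esub>
      gsign (CM.H k) (m * (n - 1)) (CM.cls k (\<L> (n - 1) (m - 1) h (\<iota> (m - 1) (-1) f \<zeta>)))"
    using \<iota>_br_class[OF f h \<zeta>_cocycle, of k] unfolding i by (simp add: k)
  finally show ?thesis
    unfolding 1 \<L>_\<iota>_\<zeta>_class[OF f h k, folded Xf Yh] unfolding k
    using L CM.cls_closed[OF pal_cocycle[OF fh]] P Q R unfolding k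
    by (intro CM.H.bv_signs) simp_all
qed

lemma bv_algebra_M: "bv_algebra K (shift (cohomology M b) (-1)) brM cupM eM BM"
  unfolding bv_algebra_def
proof (intro conjI allI ballI)
  show "gerstenhaber_algebra K (shift (cohomology M b) (-1)) cupM brM" by (rule gerstenhaber_M)
  show "eM \<in> carrier (shift (cohomology M b) (-1) 0)" using unit_closed_M by (simp add: HM_eq)
  show "graded_linear K (shift (cohomology M b) (-1)) (shift (cohomology M b) (-1)) (-1) BM"
    unfolding graded_linear_def HM_eq by (intro allI BM_linear) simp
  show "BM 0 eM = \<zero>\<^bsub>shift (cohomology M b) (-1) (-1)\<^esub>" using BM_unit by (simp add: HM_eq)
  fix n x assume "x \<in> carrier (shift (cohomology M b) (-1) n)"
  then have x: "x \<in> carrier (CM.H (n - 1))" by (simp add: HM_eq)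
  show "cupM 0 n eM x = x" "cupM n 0 x eM = x" by (rule cupM_unit[OF x])+
  show "BM (n - 1) (BM n x) = \<zero>\<^bsub>shift (cohomology M b) (-1) (n - 2)\<^esub>"
    using BM_BM[OF x] by (simp add: HM_eq)
next
  fix m n x y
  assume "x \<in> carrier (shift (cohomology M b) (-1) m)" "y \<in> carrier (shift (cohomology M b) (-1) n)"
  then have x: "x \<in> carrier (CM.H (m - 1))" and y: "y \<in> carrier (CM.H (n - 1))"
    by (simp_all add: HM_eq)
  have i: "m + n - 1 - 1 = m + n - 2" by simp
  show "brM m n x y =
      gsign (shift (cohomology M b) (-1) (m + n - 1)) m (BM (m + n) (cupM m n x y))
        \<ominus>\<^bsub>shift (cohomology M b) (-1) (m + n - 1)\<^esub>
          gsign (shift (cohomology M b) (-1) (m + n - 1)) m (cupM (m - 1) n (BM m x) y)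
        \<ominus>\<^bsub>shift (cohomology M b) (-1) (m + n - 1)\<^esub> cupM m (n - 1) x (BM n y)"
    unfolding HM_eq i by (rule bv_identity[OF x y refl])
qed

end

section \<open>The Chas-Sullivan-Menichi bracket\<close>

lemma (in vector_module) gsign_zero: "gsign V n \<zero>\<^bsub>V\<^esub> = \<zero>\<^bsub>V\<^esub>"
  by (simp add: gsign_def)

lemma (in vector_module) minus_zero: "x \<in> carrier V \<Longrightarrow> x \<ominus>\<^bsub>V\<^esub> \<zero>\<^bsub>V\<^esub> = x"
  by (simp add: a_minus_def)

text \<open>The elements \<open>u\<close>, \<open>v\<close>, \<open>w\<close> stand for
  \<open>j\<close> of \<open>X cup {Y, Z}\<close>, \<open>{X, Y} cup Z\<close> and
  \<open>Y cup {X, Z}\<close>. The degrees \<open>l\<close>, \<open>m\<close> are those in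
  \<open>HC_minus[-1]\<close>; \<open>\<beta>\<close> lowers them by one, hence \<open>m - 1\<close>
  and \<open>(l - 2) * (m - 1)\<close> in the premise. The exponent \<open>t\<close> is the sign
  from \<open>\<beta>\<close> of the inner bracket and is later \<open>s + 1\<close>.\<close>

lemma (in vector_module) jacobi_signs:
  assumes c: "u \<in> carrier V" "v \<in> carrier V" "w \<in> carrier V"
    and "\<ominus>\<^bsub>V\<^esub> gsign V (m - 1) u = v \<oplus>\<^bsub>V\<^esub> gsign V ((l - 2) * (m - 1)) w"
  shows "gsign V (l - s + t) u =
    gsign V (l + m - 2 - s + t) v \<oplus>\<^bsub>V\<^esub> gsign V (l * m) (gsign V (m - s + t) w)"
proof -
  have "u = gsign V (m - 1) (\<ominus>\<^bsub>V\<^esub> (\<ominus>\<^bsub>V\<^esub> gsign V (m - 1) u))"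
    using c by (simp add: gsign_def)
  then have "u = gsign V (m - 1) (\<ominus>\<^bsub>V\<^esub> (v \<oplus>\<^bsub>V\<^esub> gsign V ((l - 2) * (m - 1)) w))"
    using assms(4) by simp
  moreover have "gsign V (l - s + t) (gsign V (m - 1) (\<ominus>\<^bsub>V\<^esub> (v \<oplus>\<^bsub>V\<^esub> gsign V ((l - 2) * (m - 1)) w))) =
      gsign V (l + m - 2 - s + t) v \<oplus>\<^bsub>V\<^esub> gsign V (l * m) (gsign V (m - s + t) w)"
    by (cases "even m"; cases "even l"; cases "even (s + t)")
      (use c in \<open>simp_all add: gsign_def M.minus_add M.a_ac\<close>)
  ultimately show ?thesis by simp
qed

context palladio_calculus
begin

abbreviation "HC \<equiv> HC_minus M b B"
abbreviation "\<beta> \<equiv> beta_map M b B"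
abbreviation "csm s \<equiv> csm_bracket s M b B \<gg> \<delta> \<iota> \<zeta> cup"

sublocale HC: vector_module K "HC n" for n
  unfolding vector_module_def by (rule HC_minus_module)

lemmas \<beta>_closed = linear_map_closed[OF beta_map_linear]
  and j_closed = linear_map_closed[OF j_map_linear]
  and j_gsign = linear_map_gsign[OF j_map_linear CM.H.module_axioms HC_minus_module]
  and \<beta>_gsign = linear_map_gsign[OF beta_map_linear HC_minus_module CM.H.module_axioms]

lemma BM_eq_\<beta>_j: "Y \<in> carrier (CM.H n) \<Longrightarrow> BM (n + 1) Y = \<beta> n (j_map M b B n Y)"
  using beta_j[of Y n] by (simp add: coh_M_B_def)

lemma BM_\<beta>:
  assumes x: "x \<in> carrier (HC n)"
  shows "BM n (\<beta> n x) = \<zero>\<^bsub>CM.H (n - 2)\<^esub>"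
proof -
  have "BM n (\<beta> n x) = \<beta> (n - 1) (j_map M b B (n - 1) (\<beta> n x))"
    using BM_eq_\<beta>_j[of "\<beta> n x" "n - 1"] \<beta>_closed[OF refl x] by simp
  also have "\<dots> = \<beta> (n - 1) \<zero>\<^bsub>HC (n - 1)\<^esub>" using j_beta[OF x refl] by simp
  also have "\<dots> = \<zero>\<^bsub>CM.H (n - 2)\<^esub>"
    by (rule linear_map_zero[OF beta_map_linear HC_minus_module CM.H.module_axioms]) simp
  finally show ?thesis .
qed

lemma j_BM:
  assumes Y: "Y \<in> carrier (CM.H (k + 1))"
  shows "j_map M b B k (BM (k + 2) Y) = \<zero>\<^bsub>HC k\<^esub>"
  using j_beta[OF j_closed[OF Y], of k] BM_eq_\<beta>_j[OF Y] by (simp add: add.assoc)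

lemma cupM_zero_left:
  "Y \<in> carrier (CM.H (n - 1)) \<Longrightarrow> k = m + n - 1 \<Longrightarrow> cupM m n \<zero>\<^bsub>CM.H (m - 1)\<^esub> Y = \<zero>\<^bsub>CM.H k\<^esub>"
  by (rule linear_map_zero[OF bilinear_map_left[OF cupM_bilinear] CM.H.module_axioms CM.H.module_axioms])

lemma cupM_zero_right:
  "X \<in> carrier (CM.H (m - 1)) \<Longrightarrow> k = m + n - 1 \<Longrightarrow> cupM m n X \<zero>\<^bsub>CM.H (n - 1)\<^esub> = \<zero>\<^bsub>CM.H k\<^esub>"
  by (rule linear_map_zero[OF bilinear_map_right[OF cupM_bilinear] CM.H.module_axioms CM.H.module_axioms])

lemma cupM_gsign_left:
  assumes "X \<in> carrier (CM.H (m - 1))" "Y \<in> carrier (CM.H (n - 1))" "k = m + n - 1"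
  shows "cupM m n (gsign (CM.H (m - 1)) i X) Y = gsign (CM.H k) i (cupM m n X Y)"
  by (rule linear_map_gsign[OF bilinear_map_left[OF cupM_bilinear] CM.H.module_axioms CM.H.module_axioms])
    (use assms in auto)

lemma cupM_gsign_right:
  assumes "X \<in> carrier (CM.H (m - 1))" "Y \<in> carrier (CM.H (n - 1))" "k = m + n - 1"
  shows "cupM m n X (gsign (CM.H (n - 1)) i Y) = gsign (CM.H k) i (cupM m n X Y)"
  by (rule linear_map_gsign[OF bilinear_map_right[OF cupM_bilinear] CM.H.module_axioms CM.H.module_axioms])
    (use assms in auto)

lemma brM_closed:
  assumes "X \<in> carrier (CM.H (m - 1))" "Y \<in> carrier (CM.H (n - 1))" "k = m + n - 2"
  shows "brM m n X Y \<in> carrier (CM.H k)"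
proof -
  have "graded_bilinear K (shift (cohomology M b) (-1)) (shift (cohomology M b) (-1))
      (shift (cohomology M b) (-1)) (-1) brM"
    using gerstenhaber_M unfolding gerstenhaber_algebra_def by blast
  from graded_bilinearD[OF this refl, of m n]
  have "bilinear_map K (CM.H (m - 1)) (CM.H (n - 1)) (CM.H (m + n + - 1 - 1)) (brM m n)"
    unfolding HM_eq .
  then show ?thesis
    using linear_map_closed[OF bilinear_map_right] assms by fastforce
qed

lemma brM_closed_elements:
  assumes X: "X \<in> carrier (CM.H (m - 1))" and Y: "Y \<in> carrier (CM.H (n - 1))" and k: "k = m + n - 2"
    and BX: "BM m X = \<zero>\<^bsub>CM.H (m - 2)\<^esub>" and BY: "BM n Y = \<zero>\<^bsub>CM.H (n - 2)\<^esub>"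
  shows "brM m n X Y = gsign (CM.H k) m (BM (m + n) (cupM m n X Y))"
proof -
  have "cupM (m - 1) n (BM m X) Y = \<zero>\<^bsub>CM.H k\<^esub>"
    using cupM_zero_left[OF Y, of k "m - 1"] by (simp add: BX k)
  moreover have "cupM m (n - 1) X (BM n Y) = \<zero>\<^bsub>CM.H k\<^esub>"
    using cupM_zero_right[OF X, of k "n - 1"] by (simp add: BY k)
  moreover have "BM (m + n) (cupM m n X Y) \<in> carrier (CM.H k)"
    using cupM_closed[OF refl X Y] by (intro BM_closed) (auto simp: k)
  ultimately show ?thesis
    using bv_identity[OF X Y k] by (simp add: CM.H.minus_zero CM.H.gsign_zero)
qed

lemma poisson_M:
  assumes X: "X \<in> carrier (CM.H (l - 1))" and Y: "Y \<in> carrier (CM.H (m - 1))"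
    and Z: "Z \<in> carrier (CM.H (n - 1))" and k: "k = l + m + n - 2"
  shows "brM l (m + n) X (cupM m n Y Z) =
    cupM (l + m - 1) n (brM l m X Y) Z \<oplus>\<^bsub>CM.H k\<^esub>
    gsign (CM.H k) ((l - 1) * m) (cupM m (l + n - 1) Y (brM l n X Z))"
proof -
  have "\<forall>l m n. \<forall>x\<in>carrier (shift (cohomology M b) (-1) l).
      \<forall>y\<in>carrier (shift (cohomology M b) (-1) m). \<forall>z\<in>carrier (shift (cohomology M b) (-1) n).
        brM l (m + n) x (cupM m n y z) =
          cupM (l + m - 1) n (brM l m x y) z
            \<oplus>\<^bsub>shift (cohomology M b) (-1) (l + m + n - 1)\<^esub>
          gsign (shift (cohomology M b) (-1) (l + m + n - 1)) ((l - 1) * m)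
            (cupM m (l + n - 1) y (brM l n x z))"
    using gerstenhaber_M unfolding gerstenhaber_algebra_def by blast
  moreover have "l + m + n - 1 - 1 = k" by (simp add: k)
  ultimately show ?thesis using X Y Z unfolding HM_eq by metis
qed

text \<open>The Poisson identity for \<open>\<beta> x, \<beta> y, \<beta> z\<close>, after \<open>j\<close> has killed the image of \<open>B\<close>.\<close>

lemma j_cup_bracket:
  assumes X: "X \<in> carrier (CM.H (l - 1))" and Y: "Y \<in> carrier (CM.H (m - 1))"
    and Z: "Z \<in> carrier (CM.H (n - 1))" and k: "k = l + m + n - 2"
    and BX: "BM l X = \<zero>\<^bsub>CM.H (l - 2)\<^esub>" and BY: "BM m Y = \<zero>\<^bsub>CM.H (m - 2)\<^esub>"
    and BZ: "BM n Z = \<zero>\<^bsub>CM.H (n - 2)\<^esub>"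
  shows "\<ominus>\<^bsub>HC k\<^esub> gsign (HC k) m (j_map M b B k (cupM l (m + n - 1) X (brM m n Y Z))) =
    j_map M b B k (cupM (l + m - 1) n (brM l m X Y) Z) \<oplus>\<^bsub>HC k\<^esub>
    gsign (HC k) ((l - 1) * m) (j_map M b B k (cupM m (l + n - 1) Y (brM l n X Z)))"
proof -
  have YZ: "cupM m n Y Z \<in> carrier (CM.H (m + n - 1))" by (rule cupM_closed[OF refl Y Z])
  have XYZ: "cupM l (m + n) X (cupM m n Y Z) \<in> carrier (CM.H (k + 1))"
    by (rule cupM_closed[OF _ X YZ]) (simp add: k)
  have bYZ: "brM m n Y Z \<in> carrier (CM.H (m + n - 1 - 1))" by (rule brM_closed[OF Y Z]) simp
  have bXY: "brM l m X Y \<in> carrier (CM.H (l + m - 1 - 1))" by (rule brM_closed[OF X Y]) simp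
  have bXZ: "brM l n X Z \<in> carrier (CM.H (l + n - 1 - 1))" by (rule brM_closed[OF X Z]) simp
  \<comment> \<open>This is \<open>brM_closed_elements\<close> solved for the \<open>B\<close> term;
    a sign is its own inverse.\<close>
  have BYZ: "BM (m + n) (cupM m n Y Z) = gsign (CM.H (m + n - 1 - 1)) m (brM m n Y Z)"
    using brM_closed_elements[OF Y Z _ BY BZ, of "m + n - 1 - 1"]
      BM_closed[of "m + n - 1 - 1" "m + n", OF _ YZ] by (simp add: gsign_def)
  have u: "cupM l (m + n - 1) X (brM m n Y Z) \<in> carrier (CM.H k)"
    by (rule cupM_closed[OF _ X bYZ]) (simp add: k)
  have v: "cupM (l + m - 1) n (brM l m X Y) Z \<in> carrier (CM.H k)"
    by (rule cupM_closed[OF _ bXY Z]) (simp add: k)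
  have w: "cupM m (l + n - 1) Y (brM l n X Z) \<in> carrier (CM.H k)"
    by (rule cupM_closed[OF _ Y bXZ]) (simp add: k)
  have q: "BM (k + 2) (cupM l (m + n) X (cupM m n Y Z)) \<in> carrier (CM.H k)"
    using XYZ by (intro BM_closed) (auto simp: add.commute)
  have k2: "k + 2 = l + (m + n)" by (simp add: k)
  have z: "cupM (l - 1) (m + n) \<zero>\<^bsub>CM.H (l - 2)\<^esub> (cupM m n Y Z) = \<zero>\<^bsub>CM.H k\<^esub>"
    using cupM_zero_left[OF YZ, of k "l - 1"] by (simp add: k)
  have t: "cupM l (m + n - 1) X (gsign (CM.H (m + n - 1 - 1)) m (brM m n Y Z)) =
      gsign (CM.H k) m (cupM l (m + n - 1) X (brM m n Y Z))"
    by (rule cupM_gsign_right[OF X bYZ]) (simp add: k)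
  \<comment> \<open>The product of \<open>Y\<close> and \<open>Z\<close> need not be killed by
    \<open>B\<close>, so the full identity is used here: \<open>B X = 0\<close> removes one term,
    and the term with \<open>B (Y cup Z)\<close> becomes the iterated bracket term.\<close>
  have "brM l (m + n) X (cupM m n Y Z) =
      gsign (CM.H k) l (BM (k + 2) (cupM l (m + n) X (cupM m n Y Z))) \<ominus>\<^bsub>CM.H k\<^esub>
      gsign (CM.H k) m (cupM l (m + n - 1) X (brM m n Y Z))"
    using bv_identity[OF X YZ, of k] q unfolding k2 BX z BYZ t CM.H.gsign_zero
    by (simp add: k CM.H.minus_zero)
  then have E: "gsign (CM.H k) l (BM (k + 2) (cupM l (m + n) X (cupM m n Y Z))) \<ominus>\<^bsub>CM.H k\<^esub>
      gsign (CM.H k) m (cupM l (m + n - 1) X (brM m n Y Z)) =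
      cupM (l + m - 1) n (brM l m X Y) Z \<oplus>\<^bsub>CM.H k\<^esub>
      gsign (CM.H k) ((l - 1) * m) (cupM m (l + n - 1) Y (brM l n X Z))"
    using poisson_M[OF X Y Z k] by simp
  note jl = linear_map_add[OF j_map_linear] j_gsign
    linear_map_minus[OF j_map_linear CM.H.module_axioms HC_minus_module]
  show ?thesis
    using arg_cong[OF E, of "j_map M b B k"] q u v w j_closed[OF u] j_BM[OF XYZ]
    by (simp add: jl HC.gsign_zero) (simp add: a_minus_def)
qed

text \<open>Since \<open>\<beta> j = B\<close>, applying \<open>\<beta>\<close> to the bracket gives
  \<open>B (\<beta> x cup \<beta> y)\<close> with exponent \<open>m - s\<close>, whereas the
  Gerstenhaber bracket carries it with exponent \<open>m - 1\<close>, the degree of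
  \<open>\<beta> x\<close>. The two differ by the parity of \<open>s + 1\<close>.\<close>

lemma beta_csm:
  assumes x: "x \<in> carrier (HC (m - 1))" and y: "y \<in> carrier (HC (n - 1))"
  shows "\<beta> (m + n - 3) (csm s m n x y) =
    gsign (CM.H (m + n - 4)) (s + 1) (brM (m - 1) (n - 1) (\<beta> (m - 1) x) (\<beta> (n - 1) y))"
proof -
  have X: "\<beta> (m - 1) x \<in> carrier (CM.H (m - 1 - 1))" and Y: "\<beta> (n - 1) y \<in> carrier (CM.H (n - 1 - 1))"
    using \<beta>_closed[OF refl x] \<beta>_closed[OF refl y] .
  let ?Q = "cupM (m - 1) (n - 1) (\<beta> (m - 1) x) (\<beta> (n - 1) y)"
  have Q: "?Q \<in> carrier (CM.H (m + n - 3))" by (rule cupM_closed[OF _ X Y]) simp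
  have BQ: "BM (m + n - 2) ?Q \<in> carrier (CM.H (m + n - 4))"
    using BM_closed[of "m + n - 4" "m + n - 2" ?Q] Q by simp
  have i: "m - 1 + (n - 1) = m + n - 2" "m + n - 4 = m - 1 + (n - 1) - 2" by auto
  have "\<beta> (m + n - 3) (csm s m n x y) = gsign (CM.H (m + n - 4)) (m - s) (\<beta> (m + n - 3) (j_map M b B (m + n - 3) ?Q))"
    unfolding csm_bracket_def by (rule \<beta>_gsign[OF _ j_closed[OF Q]]) simp
  also have "\<beta> (m + n - 3) (j_map M b B (m + n - 3) ?Q) = BM (m + n - 2) ?Q"
    using BM_eq_\<beta>_j[OF Q] by simp
  also have "gsign (CM.H (m + n - 4)) (m - s) (BM (m + n - 2) ?Q) =
      gsign (CM.H (m + n - 4)) (s + 1) (gsign (CM.H (m + n - 4)) (m - 1) (BM (m + n - 2) ?Q))"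
    using BQ by (simp add: gsign_def)
  also have "gsign (CM.H (m + n - 4)) (m - 1) (BM (m + n - 2) ?Q) =
      brM (m - 1) (n - 1) (\<beta> (m - 1) x) (\<beta> (n - 1) y)"
    using brM_closed_elements[OF X Y i(2)] BM_\<beta>[OF x] BM_\<beta>[OF y] unfolding i(1) by simp
  finally show ?thesis .
qed

text \<open>Antisymmetry is commutativity of the product in degrees \<open>m - 1\<close>,
  \<open>n - 1\<close>: \<open>(m - s) + (m - 1) (n - 1)\<close> and
  \<open>1 + m n + (n - s)\<close> have the same parity. For the Jacobi identity,
  \<open>beta_csm\<close> turns each iterated bracket into \<open>j\<close> of a product with a
  Gerstenhaber bracket, which are the three terms of \<open>j_cup_bracket\<close>.\<close>

lemma csm_lie: "graded_lie K (shift HC (-1)) (-2) (csm s)"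
  unfolding graded_lie_def
proof (intro conjI allI ballI)
  have HCs: "shift HC (-1) n = HC (n - 1)" for n by (simp add: shift_def)
  show "graded_space K (shift HC (-1))"
    using M_graded_space HC_minus_module by (simp add: graded_space_def HCs)
  show "graded_bilinear K (shift HC (-1)) (shift HC (-1)) (shift HC (-1)) (-2) (csm s)"
    unfolding graded_bilinear_def bilinear_map_def HCs
  proof (intro allI conjI ballI)
    fix m n :: int
    \<comment> \<open>Degree \<open>m + n - 2\<close> of the shifted space is degree
      \<open>m + n - 3\<close> of \<open>HC\<close>, and the product of classes of shifted degrees
      \<open>m - 1\<close> and \<open>n - 1\<close> lies in just this degree of
      \<open>H(M)\<close>.\<close>
    have i: "m + n + - 2 - 1 = m + n - 3" and c: "m + n - 3 = m - 1 + (n - 1) - 1" by auto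
    note post = linear_map_comp[OF j_map_linear HC.gsign_linear]
    show "linear_map K (HC (n - 1)) (HC (m + n + - 2 - 1)) (csm s m n x)"
      if x: "x \<in> carrier (HC (m - 1))" for x
      unfolding csm_bracket_def[abs_def] i
      by (rule linear_map_comp[OF linear_map_comp[OF beta_map_linear[OF refl]
              bilinear_map_right[OF cupM_bilinear[OF c] \<beta>_closed[OF refl x]]] post])
    show "linear_map K (HC (m - 1)) (HC (m + n + - 2 - 1)) (\<lambda>x. csm s m n x y)"
      if y: "y \<in> carrier (HC (n - 1))" for y
      unfolding csm_bracket_def i
      by (rule linear_map_comp[OF linear_map_comp[OF beta_map_linear[OF refl]
              bilinear_map_left[OF cupM_bilinear[OF c] \<beta>_closed[OF refl y]]] post])
  qed
next
  have HCs: "shift HC (-1) n = HC (n - 1)" for n by (simp add: shift_def)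
  fix m n x y
  assume "x \<in> carrier (shift HC (-1) m)" "y \<in> carrier (shift HC (-1) n)"
  then have x: "x \<in> carrier (HC (m - 1))" and y: "y \<in> carrier (HC (n - 1))" by (simp_all add: HCs)
  note X = \<beta>_closed[OF refl x] and Y = \<beta>_closed[OF refl y]
  define k where "k = m + n - 3"
  define YX where "YX = j_map M b B k (cupM (n - 1) (m - 1) (\<beta> (n - 1) y) (\<beta> (m - 1) x))"
  have c: "cupM (n - 1) (m - 1) (\<beta> (n - 1) y) (\<beta> (m - 1) x) \<in> carrier (CM.H k)"
    by (rule cupM_closed[OF _ Y X]) (simp add: k_def)
  then have YX: "YX \<in> carrier (HC k)" unfolding YX_def by (rule j_closed)
  have "cupM (m - 1) (n - 1) (\<beta> (m - 1) x) (\<beta> (n - 1) y) =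
      gsign (CM.H k) ((m - 1) * (n - 1)) (cupM (n - 1) (m - 1) (\<beta> (n - 1) y) (\<beta> (m - 1) x))"
    by (rule cupM_comm[OF X Y]) (simp add: k_def)
  then have "csm s m n x y = gsign (HC k) (m - s) (gsign (HC k) ((m - 1) * (n - 1)) YX)"
    using j_gsign[OF c] by (simp add: csm_bracket_def k_def YX_def)
  moreover have "csm s n m y x = gsign (HC k) (n - s) YX"
    by (simp add: csm_bracket_def k_def YX_def add.commute)
  moreover have "gsign (HC k) (m - s) (gsign (HC k) ((m - 1) * (n - 1)) YX) =
      \<ominus>\<^bsub>HC k\<^esub> gsign (HC k) (m * n) (gsign (HC k) (n - s) YX)"
    by (cases "even m"; cases "even n"; cases "even s") (use YX in \<open>simp_all add: gsign_def\<close>)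
  moreover have "m + n + - 2 - 1 = k" by (simp add: k_def)
  ultimately show "csm s m n x y = \<ominus>\<^bsub>shift HC (-1) (m + n + - 2)\<^esub>
      gsign (shift HC (-1) (m + n + - 2)) (m * n) (csm s n m y x)"
    unfolding HCs by simp
next
  have HCs: "shift HC (-1) n = HC (n - 1)" for n by (simp add: shift_def)
  fix l m n x y z
  assume "x \<in> carrier (shift HC (-1) l)" "y \<in> carrier (shift HC (-1) m)" "z \<in> carrier (shift HC (-1) n)"
  then have x: "x \<in> carrier (HC (l - 1))" and y: "y \<in> carrier (HC (m - 1))" and z: "z \<in> carrier (HC (n - 1))"
    by (simp_all add: HCs)
  define X Y Z where "X = \<beta> (l - 1) x" and "Y = \<beta> (m - 1) y" and "Z = \<beta> (n - 1) z"
  have X: "X \<in> carrier (CM.H (l - 1 - 1))" and Y: "Y \<in> carrier (CM.H (m - 1 - 1))"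
    and Z: "Z \<in> carrier (CM.H (n - 1 - 1))"
    unfolding X_def Y_def Z_def using \<beta>_closed[OF refl x] \<beta>_closed[OF refl y] \<beta>_closed[OF refl z] .
  define k where "k = l + m + n - 5"
  \<comment> \<open>Stated for arbitrary degrees because it serves two of the three Jacobi terms,
    those with the inner bracket in the second argument. The summand \<open>s + 1\<close> of the
    exponent comes from \<open>beta_csm\<close> for the inner bracket.\<close>
  have J: "csm s p (q + r + - 2) a (csm s q r c d) =
      gsign (HC k) (p - s + (s + 1)) (j_map M b B k (cupM (p - 1) (q - 1 + (r - 1) - 1) (\<beta> (p - 1) a)
        (brM (q - 1) (r - 1) (\<beta> (q - 1) c) (\<beta> (r - 1) d))))"
    if a: "a \<in> carrier (HC (p - 1))" and c: "c \<in> carrier (HC (q - 1))" and d: "d \<in> carrier (HC (r - 1))"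
      and k: "k = p + q + r - 5" for p q r a c d
  proof -
    have i: "q + r + - 2 - 1 = q + r - 3" "q - 1 + (r - 1) - 1 = q + r - 3" "p + (q + r + - 2) - 3 = k"
      using k by auto
    have A: "\<beta> (p - 1) a \<in> carrier (CM.H (p - 1 - 1))" by (rule \<beta>_closed[OF refl a])
    have D: "brM (q - 1) (r - 1) (\<beta> (q - 1) c) (\<beta> (r - 1) d) \<in> carrier (CM.H (q + r - 3 - 1))"
      by (rule brM_closed[OF \<beta>_closed[OF refl c] \<beta>_closed[OF refl d]]) simp
    have k': "k = p - 1 + (q + r - 3) - 1" using k by simp
    show ?thesis
      using beta_csm[OF c d, of s] cupM_gsign_right[OF A D k', of "s + 1"]
        j_gsign[OF cupM_closed[OF k' A D], of "s + 1"] j_closed[OF cupM_closed[OF k' A D]]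
      unfolding csm_bracket_def[of s M b B \<gg> \<delta> \<iota> \<zeta> cup p] i by simp
  qed
  \<comment> \<open>The remaining Jacobi term, with the inner bracket on the left: the outer sign
    now involves its degree \<open>l + m - 2\<close>.\<close>
  have J': "csm s (l + m + - 2) n (csm s l m x y) z =
      gsign (HC k) (l + m - 2 - s + (s + 1)) (j_map M b B k (cupM (l - 1 + (m - 1) - 1) (n - 1)
        (brM (l - 1) (m - 1) X Y) Z))"
  proof -
    have i: "l + m + - 2 - 1 = l + m - 3" "l - 1 + (m - 1) - 1 = l + m - 3" "l + m + - 2 + n - 3 = k"
      "l + m + - 2 - s = l + m - 2 - s" by (auto simp: k_def)
    have D: "brM (l - 1) (m - 1) X Y \<in> carrier (CM.H (l + m - 3 - 1))"
      by (rule brM_closed[OF X Y]) simp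
    have k': "k = l + m - 3 + (n - 1) - 1" by (simp add: k_def)
    show ?thesis
      using beta_csm[OF x y, of s] cupM_gsign_left[OF D Z k', of "s + 1"]
        j_gsign[OF cupM_closed[OF k' D Z], of "s + 1"] j_closed[OF cupM_closed[OF k' D Z]]
      unfolding csm_bracket_def[of s M b B \<gg> \<delta> \<iota> \<zeta> cup "l + m + - 2"] i X_def Y_def Z_def by simp
  qed
  have B0: "BM (l - 1) X = \<zero>\<^bsub>CM.H (l - 1 - 2)\<^esub>" "BM (m - 1) Y = \<zero>\<^bsub>CM.H (m - 1 - 2)\<^esub>"
    "BM (n - 1) Z = \<zero>\<^bsub>CM.H (n - 1 - 2)\<^esub>"
    unfolding X_def Y_def Z_def by (rule BM_\<beta> x y z)+
  have kk: "k = l - 1 + (m - 1) + (n - 1) - 2" by (simp add: k_def)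
  have b: "brM (m - 1) (n - 1) Y Z \<in> carrier (CM.H (m - 1 + (n - 1) - 1 - 1))"
    "brM (l - 1) (m - 1) X Y \<in> carrier (CM.H (l - 1 + (m - 1) - 1 - 1))"
    "brM (l - 1) (n - 1) X Z \<in> carrier (CM.H (l - 1 + (n - 1) - 1 - 1))"
    by (intro brM_closed X Y Z; simp)+
  note E = j_cup_bracket[OF X Y Z kk B0]
  have e: "l - 1 - 1 = l - 2" by simp
  have "gsign (HC k) (l - s + (s + 1)) (j_map M b B k (cupM (l - 1) (m - 1 + (n - 1) - 1) X (brM (m - 1) (n - 1) Y Z))) =
      gsign (HC k) (l + m - 2 - s + (s + 1)) (j_map M b B k (cupM (l - 1 + (m - 1) - 1) (n - 1) (brM (l - 1) (m - 1) X Y) Z))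
      \<oplus>\<^bsub>HC k\<^esub> gsign (HC k) (l * m) (gsign (HC k) (m - s + (s + 1))
        (j_map M b B k (cupM (m - 1) (l - 1 + (n - 1) - 1) Y (brM (l - 1) (n - 1) X Z))))"
    by (rule HC.jacobi_signs[OF _ _ _ E[unfolded e]])
      (intro j_closed cupM_closed[OF _ X b(1)] cupM_closed[OF _ b(2) Z] cupM_closed[OF _ Y b(3)];
        simp add: k_def)+
  moreover have "csm s l (m + n + - 2) x (csm s m n y z) = gsign (HC k) (l - s + (s + 1))
      (j_map M b B k (cupM (l - 1) (m - 1 + (n - 1) - 1) X (brM (m - 1) (n - 1) Y Z)))"
    unfolding X_def Y_def Z_def by (rule J[OF x y z]) (simp add: k_def)
  moreover have "csm s m (l + n + - 2) y (csm s l n x z) = gsign (HC k) (m - s + (s + 1))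
      (j_map M b B k (cupM (m - 1) (l - 1 + (n - 1) - 1) Y (brM (l - 1) (n - 1) X Z)))"
    unfolding X_def Y_def Z_def by (rule J[OF y x z]) (simp add: k_def)
  moreover have "l + m + n + 2 * - 2 - 1 = k" by (simp add: k_def)
  ultimately show "csm s l (m + n + - 2) x (csm s m n y z) =
      csm s (l + m + - 2) n (csm s l m x y) z \<oplus>\<^bsub>shift HC (-1) (l + m + n + 2 * - 2)\<^esub>
      gsign (shift HC (-1) (l + m + n + 2 * - 2)) (l * m) (csm s m (l + n + - 2) y (csm s l n x z))"
    unfolding HCs J' by (simp only:)
qed

end

theorem theoremD:
  fixes K :: "('k, 'r) ring_scheme"
    and M :: "int \<Rightarrow> ('k, 'm) module"
    and b B :: "int \<Rightarrow> 'm \<Rightarrow> 'm"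
    and \<gg> :: "int \<Rightarrow> ('k, 'g) module"
    and \<delta> :: "int \<Rightarrow> 'g \<Rightarrow> 'g"
    and br cup :: "int \<Rightarrow> int \<Rightarrow> 'g \<Rightarrow> 'g \<Rightarrow> 'g"
    and \<iota> \<L> \<S> :: "int \<Rightarrow> int \<Rightarrow> 'g \<Rightarrow> 'm \<Rightarrow> 'm"
    and \<T> :: "int \<Rightarrow> int \<Rightarrow> int \<Rightarrow> 'g \<Rightarrow> 'g \<Rightarrow> 'm \<Rightarrow> 'm"
    and e :: 'g
    and \<zeta> :: 'm
  assumes "field K"
    and "\<forall>n::nat. n > 0 \<longrightarrow> [n] \<cdot>\<^bsub>K\<^esub> \<one>\<^bsub>K\<^esub> \<noteq> \<zero>\<^bsub>K\<^esub>"
    and "mixed_complex K M b B"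
    and "homotopy_cartan_gerstenhaber_calculus K M b B \<gg> \<delta> br \<iota> \<L> \<S> \<T> cup e"
    and "palladio_cocycle K M b B \<gg> \<delta> \<iota> \<zeta>"
    and "gerstenhaber_algebra K (coh_G \<gg> \<delta>) (coh_G_cup \<gg> \<delta> cup) (coh_G_br \<gg> \<delta> br)"
  shows
    "bv_algebra K (shift (cohomology M b) (-1))
       (coh_M_br M b \<gg> \<delta> \<iota> \<zeta> br) (coh_M_cup M b \<gg> \<delta> \<iota> \<zeta> cup)
       (coh_M_unit M b \<gg> \<delta> \<iota> \<zeta> e) (coh_M_B M b B)
     \<and> graded_lie K (shift (HC_minus M b B) (-1)) (-2)
         (csm_bracket 0 M b B \<gg> \<delta> \<iota> \<zeta> cup)
     \<and> graded_lie K (shift (HC_minus M b B) (-1)) (-2)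
         (csm_bracket 1 M b B \<gg> \<delta> \<iota> \<zeta> cup)
     \<and> (\<forall>m n. \<forall>x\<in>carrier (shift (HC_minus M b B) (-1) m).
               \<forall>y\<in>carrier (shift (HC_minus M b B) (-1) n).
          beta_map M b B (m + n - 3) (csm_bracket 1 M b B \<gg> \<delta> \<iota> \<zeta> cup m n x y) =
            coh_M_br M b \<gg> \<delta> \<iota> \<zeta> br (m - 1) (n - 1)
              (beta_map M b B (m - 1) x) (beta_map M b B (n - 1) y)
        \<and> beta_map M b B (m + n - 3) (csm_bracket 0 M b B \<gg> \<delta> \<iota> \<zeta> cup m n x y) =
            \<ominus>\<^bsub>shift (cohomology M b) (-1) (m + n - 3)\<^esub>
              coh_M_br M b \<gg> \<delta> \<iota> \<zeta> br (m - 1) (n - 1)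
                (beta_map M b B (m - 1) x) (beta_map M b B (n - 1) y))"
proof -
  interpret palladio_calculus K M b B \<gg> \<delta> br \<iota> \<L> \<S> \<T> cup e \<zeta>
    by (intro palladio_calculus.intro palladio_calculus_axioms.intro assms)
  have beta: "\<beta> (m + n - 3) (csm 1 m n x y) = brM (m - 1) (n - 1) (\<beta> (m - 1) x) (\<beta> (n - 1) y)"
    "\<beta> (m + n - 3) (csm 0 m n x y) =
      \<ominus>\<^bsub>shift (cohomology M b) (-1) (m + n - 3)\<^esub> brM (m - 1) (n - 1) (\<beta> (m - 1) x) (\<beta> (n - 1) y)"
    if "x \<in> carrier (shift HC (-1) m)" "y \<in> carrier (shift HC (-1) n)" for m n x y
    using that beta_csm[of x m y n 1] beta_csm[of x m y n 0] by (simp_all add: shift_def)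
  show ?thesis
    by (intro conjI allI ballI bv_algebra_M csm_lie beta)
qed

end
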